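(* The piecewise constant interpolations $(r_\tau,\sigma_\tau)_{\tau>0}$ produced by the splitting scheme satisfy $\sup_{t\in[0,T]}\|r_\tau(t)\|_{L^\infty}\le C$, $\sup_{t\in[0,T]}\|\sigma_\tau(t)\|_{L^\infty}\le C$, $\sup_{t\in[0,T]}|r_\tau(t)|_{BV}\le C$, $\sup_{t\in[0,T]}|\sigma_\tau(t)|_{BV}\le C$, for a constant $C<\infty$ independent of $\tau$ (depending on $T$, the data and $F_i,G_i$). Consequently (Corollary), $(\rho_\tau)_{\tau>0}$ and $(\eta_\tau)_{\tau>0}$ are bounded in $BV(\Omega)\cap L^\infty(\Omega)$ uniformly in $t\in[0,T]$ and $\tau$.
   Context: Setting. $\Omega\subset\mathbb R$ is a bounded open interval and $T>0$. $BV(\Omega)$ is the space of functions $f:\bar\Omega\to\mathbb R$ with finite total variation $|f|_{BV}:=\sup_P\sum_{i=1}^{|P|-1}|f(x_{i+1})-f(x_i)|$, the supremum over finite partitions $P=\{x_1<\dots<x_{|P|}\}\subset\Omega$. A function $\chi:[0,\infty)\to\mathbb R$ is an internal energy density: $\chi\in C^0([0,\infty))\cap C^2((0,\infty))$, $\chi''>0$ on $(0,\infty)$, $\lim_{h\downarrow0}\chi'(h)=0$, and the integrals $\kappa(x):=\int_1^x\frac{\chi''(s)}{s}\,ds$ and $K(\sigma):=\int_0^\sigma\kappa(x)\,dx$ exist. Put $\mathcal K(\sigma):=\int_\Omega K(\sigma)\,dx$ and $\mathcal E(\rho,\eta):=\int_\Omega\chi(\rho+\eta)\,dx$. The functions $F_1,F_2,G_1,G_2:[0,\infty)^2\to\mathbb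 R$ are bounded and Lipschitz, with $G_1(0,\eta)\ge0$ for all $\eta\ge0$ and $G_2(\rho,0)\ge0$ for all $\rho\ge0$. For $\sigma\ge0$, $r\in[0,1]$ set $\tilde F_i(\sigma,r)=F_i(r\sigma,(1-r)\sigma)$, $\tilde G_i(\sigma,r)=G_i(r\sigma,(1-r)\sigma)$, $A_1=\tilde F_1+\tilde G_2$, $A_2=\tilde G_1+\tilde F_2$, $A_3=\tilde F_1-\tilde F_2$, $\Sigma(\sigma,r)=\sigma(rA_1+(1-r)A_2)$, $R(\sigma,r)=r(1-r)A_3+(1-r)^2\tilde G_1-r^2\tilde G_2$. Initial data: $\rho_0,\eta_0\in BV(\Omega)\cap L^\infty(\Omega)$ nonnegative, $\sigma_0=\rho_0+\eta_0$, and $r_0\in BV(\Omega)$ with $0\le r_0\le1$ and $r_0=\rho_0/\sigma_0$ on $\{\sigma_0>0\}$. For $m>0$, $\mathcal P^m(\Omega)$ is the set of nonnegative Borel measures on $\Omega$ of total mass $m$; $W_p$ ($p=1,2$) is the $p$-Wasserstein distance between measures of equal mass, $W_p^p(\mu,\nu)=\inf_\gamma\int|x-y|^p\,d\gamma$ over couplings $\gamma$ of $\mu,\nu$. Splitting scheme. Fix $\tau\in(0,1)$ and $N\in\mathbb N$ with $N\tau=T$; set $r^0=r_0$, $\sigma^0=\sigma_0$. For $n=0,\dots,N-1$: (Reaction step) for each $x\in\Omega$ solve $\dot\sigma=\Sigma(\sigma,r)$, $\dot r=R(\sigma,r)$ on $[0,\tau]$ with $\sigma(0)=\sigma^n(x)$,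 $r(0)=r^n(x)$, and set $\sigma^{n+1/2}(x)=\sigma(\tau)$, $r^{n+1/2}(x)=r(\tau)$, $\rho^{n+1/2}=r^{n+1/2}\sigma^{n+1/2}$, $\eta^{n+1/2}=(1-r^{n+1/2})\sigma^{n+1/2}$, $U^{n+1/2}=(\rho^{n+1/2},\eta^{n+1/2})$. (Diffusion step) with $m_1=\int_\Omega\rho^{n+1/2}$, $m_2=\int_\Omega\eta^{n+1/2}$, let $U^{n+1}=(\rho^{n+1},\eta^{n+1})$ be a minimiser over $(\rho,\eta)\in\mathcal P^{m_1}(\Omega)\times\mathcal P^{m_2}(\Omega)$ of $\frac1{2\tau}\big[W_2^2(\rho,\rho^{n+1/2})+W_2^2(\eta,\eta^{n+1/2})\big]+\mathcal E(\rho,\eta)$; set $\sigma^{n+1}=\rho^{n+1}+\eta^{n+1}$ and $r^{n+1}=r^{n+1/2}\circ\mathcal T$, where $\mathcal T$ is the nondecreasing optimal transport map pushing $\sigma^{n+1}$ forward to $\sigma^{n+1/2}$. Also $\rho^n=r^n\sigma^n$, $\eta^n=(1-r^n)\sigma^n$, $U^n=(\rho^n,\eta^n)$. Piecewise constant interpolation: for $t\in[n\tau,(n+1)\tau)$, $r_\tau(t)=r^n$, $\sigma_\tau(t)=\sigma^n$, $\rho_\tau(t)=r^n\sigma^n$, $\eta_\tau(t)=(1-r^n)\sigma^n$, $U_\tau=(\rho_\tau,\eta_\tau)$. *)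

theory Defs
  imports "HOL-Analysis.Analysis"
begin

section \<open>Functional-analytic notions (Omega = {a<..<b}, closure = {a..b})\<close>

definition pvar :: "real set \<Rightarrow> (real \<Rightarrow> real) \<Rightarrow> ereal" where
  "pvar S f = (SUP P \<in> {P. sorted_wrt (<) P \<and> set P \<subseteq> S}.
      ereal (\<Sum>i<length P - 1. \<bar>f (P ! Suc i) - f (P ! i)\<bar>))"

definition good_rep :: "real \<Rightarrow> real \<Rightarrow> (real \<Rightarrow> real) \<Rightarrow> bool" where
  "good_rep a b g \<longleftrightarrow> (\<forall>h. (AE x in lborel. x \<in> {a<..<b} \<longrightarrow> h x = g x)
       \<longrightarrow> pvar {a..b} g \<le> pvar {a..b} h)"

definition dmeas :: "real \<Rightarrow> real \<Rightarrow> (real \<Rightarrow> real) \<Rightarrow> real measure" where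
  "dmeas a b f = density lborel (\<lambda>x. ennreal (f x) * indicator {a<..<b} x)"

definition couplings :: "real measure \<Rightarrow> real measure \<Rightarrow> (real \<times> real) measure set" where
  "couplings \<mu> \<nu> = {\<gamma>. sets \<gamma> = sets (lborel \<Otimes>\<^sub>M lborel)
      \<and> distr \<gamma> lborel fst = \<mu> \<and> distr \<gamma> lborel snd = \<nu>}"

definition W2sq :: "real measure \<Rightarrow> real measure \<Rightarrow> ennreal" where
  "W2sq \<mu> \<nu> = (INF \<gamma> \<in> couplings \<mu> \<nu>. \<integral>\<^sup>+ z. ennreal ((fst z - snd z)\<^sup>2) \<partial>\<gamma>)"

definition kappa :: "(real \<Rightarrow> real) \<Rightarrow> real \<Rightarrow> real" where
  "kappa chi x = interval_lebesgue_integral lborel (ereal 1) (ereal x)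
      (\<lambda>s. deriv (deriv chi) s / s)"

definition internal_energy :: "(real \<Rightarrow> real) \<Rightarrow> bool" where
  "internal_energy chi \<longleftrightarrow>
     continuous_on {0..} chi
   \<and> (\<forall>h>0. chi differentiable (at h) \<and> deriv chi differentiable (at h)
            \<and> deriv (deriv chi) h > 0)
   \<and> continuous_on {0<..} (deriv (deriv chi))
   \<and> ((deriv chi) \<longlongrightarrow> 0) (at_right 0)
   \<and> (\<forall>x>0. interval_lebesgue_integrable lborel (ereal 1) (ereal x)
              (\<lambda>s. deriv (deriv chi) s / s))
   \<and> (\<forall>\<sigma>>0. set_integrable lborel {0<..\<sigma>} (kappa chi))"

definition rate_fun :: "(real \<times> real \<Rightarrow> real) \<Rightarrow> bool" where
  "rate_fun F \<longleftrightarrow> bounded (F ` ({0..} \<times> {0..})) \<and> (\<exists>L. L-lipschitz_on ({0..} \<times> {0..}) F)"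

definition tld :: "(real \<times> real \<Rightarrow> real) \<Rightarrow> real \<Rightarrow> real \<Rightarrow> real" where
  "tld F \<sigma> r = F (r * \<sigma>, (1 - r) * \<sigma>)"

definition SigF where
  "SigF F1 F2 G1 G2 \<sigma> r = \<sigma> * (r * (tld F1 \<sigma> r + tld G2 \<sigma> r) + (1 - r) * (tld G1 \<sigma> r + tld F2 \<sigma> r))"

definition RF where
  "RF F1 F2 G1 G2 \<sigma> r = r * (1 - r) * (tld F1 \<sigma> r - tld F2 \<sigma> r)
      + (1 - r)\<^sup>2 * tld G1 \<sigma> r - r\<^sup>2 * tld G2 \<sigma> r"

definition reaction_step ::
  "(real \<Rightarrow> real \<Rightarrow> real) \<Rightarrow> (real \<Rightarrow> real \<Rightarrow> real) \<Rightarrow> real \<Rightarrow> real \<Rightarrow> real \<Rightarrow> real \<Rightarrow> real \<Rightarrow> bool" where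
  "reaction_step Sg Rr \<tau> s0 q0 s1 q1 \<longleftrightarrow> (\<exists>s q :: real \<Rightarrow> real.
     s 0 = s0 \<and> q 0 = q0 \<and> s \<tau> = s1 \<and> q \<tau> = q1 \<and>
     (\<forall>t\<in>{0..\<tau>}. 0 \<le> s t \<and> 0 \<le> q t \<and> q t \<le> 1
        \<and> (s has_real_derivative Sg (s t) (q t)) (at t within {0..\<tau>})
        \<and> (q has_real_derivative Rr (s t) (q t)) (at t within {0..\<tau>})))"

definition energy :: "real \<Rightarrow> real \<Rightarrow> (real \<Rightarrow> real) \<Rightarrow> (real \<Rightarrow> real) \<Rightarrow> (real \<Rightarrow> real) \<Rightarrow> real" where
  "energy a b chi \<rho> \<eta> = (LINT x:{a<..<b}|lborel. chi (\<rho> x + \<eta> x))"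

text \<open>Admissible competitors: absolutely continuous nonnegative measures on Omega of the
  prescribed masses with finite energy (competitors of infinite energy cannot be minimisers).\<close>
definition admissible :: "real \<Rightarrow> real \<Rightarrow> (real \<Rightarrow> real) \<Rightarrow> real \<Rightarrow> real \<Rightarrow> (real \<Rightarrow> real) \<Rightarrow> (real \<Rightarrow> real) \<Rightarrow> bool" where
  "admissible a b chi m1 m2 \<rho> \<eta> \<longleftrightarrow>
     \<rho> \<in> borel_measurable borel \<and> \<eta> \<in> borel_measurable borel
   \<and> (\<forall>x\<in>{a<..<b}. 0 \<le> \<rho> x \<and> 0 \<le> \<eta> x)
   \<and> set_integrable lborel {a<..<b} \<rho> \<and> set_integrable lborel {a<..<b} \<eta>
   \<and> (LINT x:{a<..<b}|lborel. \<rho> x) = m1 \<and> (LINT x:{a<..<b}|lborel. \<eta> x) = m2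
   \<and> set_integrable lborel {a<..<b} (\<lambda>x. chi (\<rho> x + \<eta> x))"

definition jko :: "real \<Rightarrow> real \<Rightarrow> (real \<Rightarrow> real) \<Rightarrow> real \<Rightarrow> (real \<Rightarrow> real) \<Rightarrow> (real \<Rightarrow> real)
                    \<Rightarrow> (real \<Rightarrow> real) \<Rightarrow> (real \<Rightarrow> real) \<Rightarrow> real" where
  "jko a b chi \<tau> \<rho>h \<eta>h \<rho> \<eta> =
     (enn2real (W2sq (dmeas a b \<rho>) (dmeas a b \<rho>h)) + enn2real (W2sq (dmeas a b \<eta>) (dmeas a b \<eta>h)))
       / (2 * \<tau>) + energy a b chi \<rho> \<eta>"

definition splitting_run where
  "splitting_run a b chi F1 F2 G1 G2 rho0 eta0 r0 \<tau> N
      (sg :: nat \<Rightarrow> real \<Rightarrow> real) (r :: nat \<Rightarrow> real \<Rightarrow> real)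
      (sigh :: nat \<Rightarrow> real \<Rightarrow> real) (rh :: nat \<Rightarrow> real \<Rightarrow> real)
      (rhoD :: nat \<Rightarrow> real \<Rightarrow> real) (etaD :: nat \<Rightarrow> real \<Rightarrow> real) (Tm :: nat \<Rightarrow> real \<Rightarrow> real)
   \<longleftrightarrow>
     (\<forall>x\<in>{a..b}. sg 0 x = rho0 x + eta0 x \<and> r 0 x = r0 x)
   \<and> (\<forall>n<N. \<forall>x\<in>{a..b}. reaction_step (SigF F1 F2 G1 G2) (RF F1 F2 G1 G2) \<tau>
                         (sg n x) (r n x) (sigh n x) (rh n x))
   \<and> (\<forall>n<N.
        let \<rho>h = (\<lambda>x. rh n x * sigh n x); \<eta>h = (\<lambda>x. (1 - rh n x) * sigh n x);
            m1 = (LINT x:{a<..<b}|lborel. \<rho>h x); m2 = (LINT x:{a<..<b}|lborel. \<eta>h x)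
        in admissible a b chi m1 m2 (rhoD n) (etaD n)
           \<and> (\<forall>\<rho> \<eta>. admissible a b chi m1 m2 \<rho> \<eta> \<longrightarrow>
                 jko a b chi \<tau> \<rho>h \<eta>h (rhoD n) (etaD n) \<le> jko a b chi \<tau> \<rho>h \<eta>h \<rho> \<eta>))
   \<and> (\<forall>n<N. (AE x in lborel. x \<in> {a<..<b} \<longrightarrow> sg (Suc n) x = rhoD n x + etaD n x)
            \<and> good_rep a b (sg (Suc n)))
   \<and> (\<forall>n<N. Tm n \<in> borel_measurable borel \<and> mono_on {a..b} (Tm n) \<and> Tm n ` {a..b} \<subseteq> {a..b}
            \<and> distr (dmeas a b (sg (Suc n))) lborel (Tm n) = dmeas a b (sigh n)
            \<and> (\<integral>\<^sup>+ x. ennreal ((x - Tm n x)\<^sup>2) \<partial>(dmeas a b (sg (Suc n))))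
                 = W2sq (dmeas a b (sg (Suc n))) (dmeas a b (sigh n))
            \<and> (\<forall>x\<in>{a..b}. r (Suc n) x = rh n (Tm n x)))"

definition pc_interp :: "real \<Rightarrow> (nat \<Rightarrow> 'a) \<Rightarrow> real \<Rightarrow> 'a" where
  "pc_interp \<tau> f t = f (nat \<lfloor>t / \<tau>\<rfloor>)"

end

theory Submission
  imports Defs
begin

text \<open>
  The reaction step is a Lipschitz ODE flow, so by Gronwall it multiplies the sup bound and the
  total variation of the pair (sigma, r) by at most exp (C tau). Composition with a monotone map
  does not increase the variation of r. Everything therefore rests on the diffusion step not
  increasing the supremum and the variation of sigma.

  Adding couplings of the two species shows that sigma minimises the one-species functional, and
  the given monotone map T is optimal for it. Inner variations by the flow x + e int g, with g
  supported where sigma is bounded so that the energy stays finite, give the Euler-Lagrange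
  equation p(sigma) = q almost everywhere with q' = (T - x) sigma / tau and p(h) = h chi'(h) - chi(h)
  strictly increasing; in particular sigma has a continuous representative.
  Around a point where sigma is nearly maximal one finds z' < z with T z' >= z' and T z <= z: mass is
  compressed onto a shorter interval, hence the half-step density is at least as large somewhere
  in [T z', T z]. Near minima the inequalities are reversed. Along an alternating chain of extrema
  these intervals are ordered because T is monotone, which bounds the variation.
\<close>

section \<open>Variation along finite partitions\<close>

fun lvar :: "(real \<Rightarrow> real) \<Rightarrow> real list \<Rightarrow> real" where
  "lvar f [] = 0"
| "lvar f [x] = 0"
| "lvar f (x # y # xs) = \<bar>f y - f x\<bar> + lvar f (y # xs)"

lemma lvar_eq_sum: "lvar f P = (\<Sum>i<length P - 1. \<bar>f (P ! Suc i) - f (P ! i)\<bar>)"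
proof (induction f P rule: lvar.induct)
  case (3 f x y xs)
  then show ?case by (simp add: sum.lessThan_Suc_shift del: sum.lessThan_Suc)
qed auto

lemma lvar_nonneg: "0 \<le> lvar f P"
  by (induction f P rule: lvar.induct) auto

lemma lvar_Cons_le: "lvar f xs \<le> lvar f (x # xs)"
  by (cases xs) auto

lemma lvar_snoc: "lvar f (P @ [z]) = lvar f P + (if P = [] then 0 else \<bar>f z - f (last P)\<bar>)"
  by (induction f P rule: lvar.induct) auto

lemma lvar_map: "lvar f (map T P) = lvar (\<lambda>x. f (T x)) P"
  by (induction "\<lambda>x. f (T x)" P rule: lvar.induct) auto

lemma abs_diff_hd_le_lvar: "v \<in> set (x # P) \<Longrightarrow> \<bar>f v - f x\<bar> \<le> lvar f (x # P)"
proof (induction P arbitrary: x)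
  case (Cons y P)
  show ?case
  proof (cases "v = x")
    case True
    then show ?thesis using lvar_nonneg[of f "x # y # P"] by simp
  next
    case False
    then have "\<bar>f v - f y\<bar> \<le> lvar f (y # P)" using Cons by auto
    then show ?thesis by simp
  qed
qed simp

lemma abs_diff_le_lvar: "u \<in> set P \<Longrightarrow> v \<in> set P \<Longrightarrow> \<bar>f v - f u\<bar> \<le> lvar f P"
proof (induction P)
  case (Cons x P)
  consider "u = x" | "v = x" | "u \<in> set P" "v \<in> set P" using Cons.prems by auto
  then show ?case
  proof cases
    case 1 then show ?thesis using abs_diff_hd_le_lvar Cons.prems by blast
  next
    case 2 then show ?thesis using abs_diff_hd_le_lvar[of u x P f] Cons.prems by auto
  next
    case 3 then show ?thesis using Cons.IH lvar_Cons_le[of f P x] by linarith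
  qed
qed simp

lemma lvar_insort: "lvar f P \<le> lvar f (insort x P)"
proof (induction f P rule: lvar.induct)
  case (3 f u v xs)
  then show ?case by (cases "x \<le> u"; cases "x \<le> v") auto
qed auto

lemma lvar_remdups: "sorted P \<Longrightarrow> lvar f (remdups P) = lvar f P \<and> (P \<noteq> [] \<longrightarrow> hd (remdups P) = hd P \<and> remdups P \<noteq> [])"
proof (induction f P rule: lvar.induct)
  case (3 f x y xs)
  then have IH: "lvar f (remdups (y # xs)) = lvar f (y # xs)" "hd (remdups (y # xs)) = y"
      "remdups (y # xs) \<noteq> []" and le: "x \<le> y" "\<forall>z\<in>set xs. y \<le> z" by auto
  show ?case
  proof (cases "x \<in> set (y # xs)")
    case True
    then have "x = y" using le by auto
    then show ?thesis using IH by auto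
  next
    case False
    then have "remdups (x # y # xs) = x # remdups (y # xs)" by simp
    moreover obtain zs where "remdups (y # xs) = y # zs" using IH by (metis list.collapse)
    ultimately show ?thesis using IH by simp
  qed
qed auto

lemma lvar_le_pvar:
  assumes "sorted P" "set P \<subseteq> S"
  shows "ereal (lvar f P) \<le> pvar S f"
proof -
  have "sorted_wrt (<) (remdups P)"
    using assms(1) by (simp add: strict_sorted_iff)
  then have "ereal (lvar f (remdups P)) \<le> pvar S f"
    unfolding pvar_def lvar_eq_sum using assms(2) by (intro SUP_upper) auto
  then show ?thesis using lvar_remdups[OF assms(1)] by simp
qed

lemma pvar_leI:
  assumes "\<And>P. sorted_wrt (<) P \<Longrightarrow> set P \<subseteq> S \<Longrightarrow> ereal (lvar f P) \<le> B"
  shows "pvar S f \<le> B"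
  unfolding pvar_def using assms by (intro SUP_least) (auto simp: lvar_eq_sum)

lemma sorted_wrt_less_sorted: "sorted_wrt (<) P \<Longrightarrow> sorted (P :: real list)"
  by (simp add: strict_sorted_iff)

lemma pvar_nonneg: "0 \<le> pvar S f"
  using lvar_le_pvar[of "[]" S f] by (simp add: zero_ereal_def)

lemma pvar_mono: "S \<subseteq> S' \<Longrightarrow> pvar S f \<le> pvar S' f"
  by (rule pvar_leI) (auto intro!: lvar_le_pvar sorted_wrt_less_sorted)

lemma pvar_eq_ereal:
  assumes "pvar S f < \<infinity>"
  obtains V where "pvar S f = ereal V" "0 \<le> V"
proof -
  have "\<bar>pvar S f\<bar> \<noteq> \<infinity>" using assms pvar_nonneg[of S f] by auto
  then obtain V where "pvar S f = ereal V" by (metis ereal_real')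
  then show ?thesis using that pvar_nonneg[of S f] by auto
qed

lemma abs_diff_le_pvar:
  assumes "u \<in> S" "v \<in> S" "pvar S f \<le> ereal V"
  shows "\<bar>f v - f u\<bar> \<le> V"
proof -
  have "\<bar>f v - f u\<bar> \<le> lvar f (sort [u, v])" by (intro abs_diff_le_lvar) auto
  also have "ereal \<dots> \<le> pvar S f" using assms by (intro lvar_le_pvar) auto
  finally show ?thesis using assms(3) by (metis ereal_less_eq(3) order_trans)
qed

lemma pvar_combination:
  assumes "\<And>u v. u \<in> S \<Longrightarrow> v \<in> S \<Longrightarrow> \<bar>h u - h v\<bar> \<le> \<alpha> * \<bar>f u - f v\<bar> + \<beta> * \<bar>g u - g v\<bar>"
    and "0 \<le> \<alpha>" "0 \<le> \<beta>" and f: "pvar S f \<le> ereal A" and g: "pvar S g \<le> ereal B"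
  shows "pvar S h \<le> ereal (\<alpha> * A + \<beta> * B)"
proof (rule pvar_leI)
  fix P assume P: "sorted_wrt (<) P" "set P \<subseteq> S"
  have 1: "set P \<subseteq> S \<Longrightarrow> lvar h P \<le> \<alpha> * lvar f P + \<beta> * lvar g P" for P
  proof (induction P rule: induct_list012)
    case (3 x y zs)
    then have "lvar h (y # zs) \<le> \<alpha> * lvar f (y # zs) + \<beta> * lvar g (y # zs)" by simp
    moreover have "\<bar>h y - h x\<bar> \<le> \<alpha> * \<bar>f y - f x\<bar> + \<beta> * \<bar>g y - g x\<bar>" using 3 assms(1) by simp
    ultimately show ?case by (simp add: algebra_simps)
  qed auto
  have "lvar f P \<le> A" "lvar g P \<le> B"
    using lvar_le_pvar[OF sorted_wrt_less_sorted[OF P(1)] P(2)] f g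
    by (meson ereal_less_eq(3) order_trans)+
  then have "\<alpha> * lvar f P + \<beta> * lvar g P \<le> \<alpha> * A + \<beta> * B"
    using assms by (intro add_mono mult_left_mono)
  then show "ereal (lvar h P) \<le> ereal (\<alpha> * A + \<beta> * B)" using 1[OF P(2)] by simp
qed

lemma pvar_compose_mono:
  assumes "mono_on S T" "T ` S \<subseteq> S'"
  shows "pvar S (\<lambda>x. f (T x)) \<le> pvar S' f"
proof (rule pvar_leI)
  fix P assume P: "sorted_wrt (<) P" "set P \<subseteq> S"
  have "sorted (map T P)"
    unfolding sorted_map
    by (rule sorted_wrt_mono_rel[OF _ P(1)]) (use P(2) assms(1) in \<open>auto simp: monotone_on_def subset_iff\<close>)
  then have "ereal (lvar f (map T P)) \<le> pvar S' f"
    using P assms by (intro lvar_le_pvar) auto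
  then show "ereal (lvar (\<lambda>x. f (T x)) P) \<le> pvar S' f" by (simp add: lvar_map)
qed

lemma pvar_cong:
  assumes "\<And>x. x \<in> S \<Longrightarrow> f x = g x"
  shows "pvar S f = pvar S g"
proof -
  have "set P \<subseteq> S \<Longrightarrow> lvar f P = lvar g P" for P
    by (induction P rule: induct_list012) (auto simp: assms)
  then show ?thesis
    unfolding pvar_def lvar_eq_sum[symmetric] by (intro SUP_cong) auto
qed

lemma pvar_finite_closure:
  assumes "a < b" "pvar {a<..<b} f < \<infinity>"
  shows "pvar {a..b} f < \<infinity>"
proof -
  obtain V where V: "pvar {a<..<b} f = ereal V" using pvar_eq_ereal[OF assms(2)] by blast
  define c where "c = (a + b) / 2"
  define K where "K = V + \<bar>f c\<bar> + \<bar>f a\<bar> + \<bar>f b\<bar>"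
  have c: "c \<in> {a<..<b}" using assms(1) by (auto simp: c_def)
  have V0: "0 \<le> V" using pvar_nonneg[of "{a<..<b}" f] V by simp
  have K: "\<bar>f x\<bar> \<le> K" if "x \<in> {a..b}" for x
  proof (cases "x \<in> {a<..<b}")
    case True
    then show ?thesis using abs_diff_le_pvar[OF c True, of f V] V by (simp add: K_def)
  next
    case False
    then have "x = a \<or> x = b" using that by auto
    then show ?thesis using V0 by (auto simp: K_def)
  qed
  have "pvar {a..b} f \<le> ereal (V + 4 * K)"
  proof (rule pvar_leI)
    fix P assume P: "sorted_wrt (<) P" "set P \<subseteq> {a..b}"
    have K0: "0 \<le> K" using K[of a] assms(1) by auto
    show "ereal (lvar f P) \<le> ereal (V + 4 * K)"
    proof (cases P)
      case (Cons x Q)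
      have 1: "lvar f P \<le> lvar f Q + 2 * K"
      proof (cases Q)
        case (Cons y ys)
        then show ?thesis using \<open>P = x # Q\<close> P K[of x] K[of y] by auto
      qed (use Cons K0 in auto)
      show ?thesis
      proof (cases Q rule: rev_exhaust)
        case (snoc R z)
        have "lvar f Q \<le> lvar f R + 2 * K"
        proof (cases "R = []")
          case False
          then have "last R \<in> set R" by simp
          then have "last R \<in> {a..b}" "z \<in> {a..b}" using Cons snoc P(2) by auto
          then show ?thesis using snoc K[of "last R"] K[of z] False by (auto simp: lvar_snoc)
        qed (use snoc K0 in auto)
        moreover have "lvar f R \<le> V"
        proof -
          have "ereal (lvar f R) \<le> pvar {a<..<b} f"
          proof (rule lvar_le_pvar)
            show "sorted R" using P(1) Cons snoc
              by (simp add: sorted_wrt_append strict_sorted_iff)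
            show "set R \<subseteq> {a<..<b}"
            proof
              fix w assume "w \<in> set R"
              then have "x < w" "w < z" "x \<in> {a..b}" "z \<in> {a..b}"
                using P Cons snoc by (auto simp: sorted_wrt_append)
              then show "w \<in> {a<..<b}" by auto
            qed
          qed
          then show ?thesis using V by simp
        qed
        ultimately show ?thesis using 1 by simp
      qed (use 1 V0 K0 in auto)
    qed (use V0 K0 in auto)
  qed
  then show ?thesis by (rule le_less_trans) simp
qed

lemma pvar_finite_borel_measurable:
  assumes "pvar {a..b} f < \<infinity>"
  shows "(\<lambda>x. indicator {a..b} x * f x) \<in> borel_measurable borel"
proof -
  define V where "V x = real_of_ereal (pvar {a..x} f)" for x
  have Vx: "pvar {a..x} f = ereal (V x)" if "x \<le> b" for x
  proof -
    have "pvar {a..x} f \<le> pvar {a..b} f" by (rule pvar_mono) (use that in auto)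
    then have "\<bar>pvar {a..x} f\<bar> \<noteq> \<infinity>" using assms pvar_nonneg[of "{a..x}" f] by auto
    then show ?thesis unfolding V_def by (simp add: ereal_real')
  qed
  have inc: "V x + \<bar>f y - f x\<bar> \<le> V y" if xy: "a \<le> x" "x \<le> y" "y \<le> b" for x y
  proof -
    have "pvar {a..x} f \<le> ereal (V y - \<bar>f y - f x\<bar>)"
    proof (rule pvar_leI)
      fix P assume P: "sorted_wrt (<) P" "set P \<subseteq> {a..x}"
      have "ereal (lvar f ((P @ [x]) @ [y])) \<le> pvar {a..y} f"
        using P xy by (intro lvar_le_pvar) (auto simp: sorted_append sorted_wrt_less_sorted subset_iff
            intro: order_trans)
      then have "lvar f P + \<bar>f y - f x\<bar> \<le> V y"
        using Vx[OF xy(3)] lvar_snoc[of f "P @ [x]" y] lvar_snoc[of f P x] by (auto split: if_splits)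
      then show "ereal (lvar f P) \<le> ereal (V y - \<bar>f y - f x\<bar>)" by simp
    qed
    then show ?thesis using Vx[of x] xy by simp
  qed
  have "mono_on {a..b} V" "mono_on {a..b} (\<lambda>x. V x - f x)"
    using inc by (fastforce simp: monotone_on_def)+
  then have "(\<lambda>x. V x - (V x - f x)) \<in> borel_measurable (restrict_space borel {a..b})"
    by (intro borel_measurable_diff borel_measurable_mono_on_fnc)
  then show ?thesis
    by (simp add: borel_measurable_restrict_space_iff)
qed

text \<open>Clamping to \<open>{0..M}\<close> splits the variation of \<open>g\<close> exactly into the variation of the clamped
  function and that of the excess, so a representative of minimal variation has no excess.\<close>

lemma good_rep_bounds:
  assumes "a < b" "good_rep a b g" "0 \<le> M"
    and ae: "AE x in lborel. x \<in> {a<..<b} \<longrightarrow> 0 \<le> g x \<and> g x \<le> M"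
    and h: "AE x in lborel. x \<in> {a<..<b} \<longrightarrow> h x = g x" "pvar {a..b} h < \<infinity>"
    and x: "x \<in> {a..b}"
  shows "0 \<le> g x \<and> g x \<le> M"
proof -
  define c where "c y = min M (max 0 (g y))" for y
  define e where "e y = g y - c y" for y
  have "pvar {a..b} g \<le> pvar {a..b} h" using assms(2) h(1) by (simp add: good_rep_def)
  then have "pvar {a..b} g < \<infinity>" using h(2) by (rule le_less_trans)
  then obtain V where V: "pvar {a..b} g = ereal V" using pvar_eq_ereal by blast
  have le: "pvar {a..b} g \<le> pvar {a..b} c"
  proof -
    have "AE x in lborel. x \<in> {a<..<b} \<longrightarrow> c x = g x"
      using ae by eventually_elim (auto simp: c_def)
    then show ?thesis using assms(2) by (simp add: good_rep_def)
  qed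
  have "\<exists>y\<in>{a<..<b}. 0 \<le> g y \<and> g y \<le> M"
  proof (rule ccontr)
    assume no: "\<not> ?thesis"
    have "AE x in lborel. x \<notin> {a<..<b}" using ae by eventually_elim (use no in auto)
    then have "emeasure lborel {a<..<b} = 0"
      by (subst (asm) AE_iff_measurable[where N = "{a<..<b}"]) auto
    then show False using assms(1) by simp
  qed
  then obtain y where y: "y \<in> {a<..<b}" "0 \<le> g y" "g y \<le> M" by blast
  then have ey: "e y = 0" by (auto simp: e_def c_def)
  have "\<bar>g u - g v\<bar> = \<bar>c u - c v\<bar> + \<bar>e u - e v\<bar>" for u v
  proof -
    have "c u \<le> c v \<and> e u \<le> e v" if "g u \<le> g v" for u v
      using that \<open>0 \<le> M\<close> unfolding e_def c_def min_def max_def by auto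
    from this[of u v] this[of v u] show ?thesis
      unfolding e_def by (cases "g u \<le> g v") auto
  qed
  then have split: "lvar g P = lvar c P + lvar e P" for P
    by (induction P rule: induct_list012) auto
  have "pvar {a..b} c \<le> ereal (V - \<bar>e x\<bar>)"
  proof (rule pvar_leI)
    fix P assume P: "sorted_wrt (<) P" "set P \<subseteq> {a..b}"
    define Q where "Q = insort x (insort y P)"
    have "lvar c P \<le> lvar c Q" unfolding Q_def using lvar_insort order_trans by blast
    moreover have "\<bar>e x - e y\<bar> \<le> lvar e Q"
      by (rule abs_diff_le_lvar) (auto simp: Q_def set_insort_key)
    moreover have "ereal (lvar g Q) \<le> ereal V"
      unfolding V[symmetric] using P x y(1) by (intro lvar_le_pvar)
        (auto simp: Q_def set_insort_key sorted_insort sorted_wrt_less_sorted)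
    ultimately show "ereal (lvar c P) \<le> ereal (V - \<bar>e x\<bar>)" using split[of Q] ey by simp
  qed
  then have "ereal V \<le> ereal (V - \<bar>e x\<bar>)" using le V by (metis order_trans)
  then have "e x = 0" by simp
  then show ?thesis using \<open>0 \<le> M\<close> by (auto simp: e_def c_def min_def max_def split: if_splits)
qed

text \<open>The flag tells whether the next step of the list goes up.\<close>

fun zigzag :: "real \<Rightarrow> (real \<Rightarrow> real) \<Rightarrow> bool \<Rightarrow> real list \<Rightarrow> bool" where
  "zigzag d f up [] = True"
| "zigzag d f up [x] = True"
| "zigzag d f up (x # y # xs) \<longleftrightarrow>
     (if up then f x + d < f y else f y + d < f x) \<and> zigzag d f (\<not> up) (y # xs)"

lemma zigzag_sublist:
  "sorted_wrt (<) (x # xs) \<Longrightarrow> \<exists>ys up. sorted_wrt (<) (x # ys) \<and> set ys \<subseteq> set xs \<and>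
     zigzag 0 f up (x # ys) \<and> lvar f (x # ys) = lvar f (x # xs)"
proof (induction xs arbitrary: x)
  case (Cons y xs)
  have "sorted_wrt (<) (y # xs)" using Cons.prems by simp
  from Cons.IH[OF this] obtain ys up where ys: "sorted_wrt (<) (y # ys)" "set ys \<subseteq> set xs"
    "zigzag 0 f up (y # ys)" "lvar f (y # ys) = lvar f (y # xs)" by blast
  have xy: "x < y" "\<forall>z\<in>set ys. x < z" using Cons.prems ys by auto
  show ?case
  proof (cases ys)
    case Nil
    show ?thesis
    proof (cases "f x = f y")
      case True
      then show ?thesis using ys Nil by (intro exI[of _ "[]"]) auto
    next
      case False
      then show ?thesis using ys Nil xy by (intro exI[of _ "[y]"] exI[of _ "f x < f y"]) auto
    qed
  next
    case (Cons z zs)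
    have sx: "sorted_wrt (<) (x # ys)" "sorted_wrt (<) (x # y # ys)" using ys(1) xy by auto
    consider "f x = f y" | "up" "f x < f y" | "\<not> up" "f x > f y" | "up" "f x > f y" | "\<not> up" "f x < f y"
      by linarith
    then show ?thesis
    proof cases
      case 1 then show ?thesis using sx ys Cons by (intro exI[of _ ys] exI[of _ up]) auto
    next
      case 2 then show ?thesis using sx ys Cons by (intro exI[of _ ys] exI[of _ up]) auto
    next
      case 3 then show ?thesis using sx ys Cons by (intro exI[of _ ys] exI[of _ up]) auto
    next
      case 4 then show ?thesis using sx ys Cons by (intro exI[of _ "y # ys"] exI[of _ "\<not> up"]) auto
    next
      case 5 then show ?thesis using sx ys Cons by (intro exI[of _ "y # ys"] exI[of _ "\<not> up"]) auto
    qed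
  qed
qed auto

lemma zigzag_mono: "zigzag d f up xs \<Longrightarrow> d' \<le> d \<Longrightarrow> zigzag d' f up xs"
  by (induction d f up xs rule: zigzag.induct) (auto split: if_splits)

lemma zigzag_gap: "zigzag 0 f up xs \<Longrightarrow> \<exists>d>0. zigzag d f up xs"
proof (induction "0::real" f up xs rule: zigzag.induct)
  case (3 f up x y xs)
  then obtain d where d: "d > 0" "zigzag d f (\<not> up) (y # xs)" by auto
  define d' where "d' = min d (\<bar>f y - f x\<bar> / 2)"
  have "d' > 0" using 3 d by (auto simp: d'_def split: if_splits)
  moreover have "zigzag d' f (\<not> up) (y # xs)" using d(2) zigzag_mono by (simp add: d'_def)
  moreover have "if up then f x + d' < f y else f y + d' < f x"
    using 3(2) unfolding d'_def by (auto simp: min_def field_simps split: if_splits)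
  ultimately show ?case by auto
qed (auto intro: exI[of _ 1])

lemma pvar_le_of_extremal_points:
  assumes T: "mono_on {a..b} T" "T ` {a..b} \<subseteq> {a..b}"
    and hi: "\<And>x e. x \<in> {a..b} \<Longrightarrow> 0 < e \<Longrightarrow> \<exists>z' z y. z' \<in> {a..x} \<and> z \<in> {x..b} \<and>
        (\<forall>t\<in>{z'..z}. f x - e \<le> f t) \<and> y \<in> {T z'..T z} \<and> f x - 2 * e \<le> g y"
    and lo: "\<And>x e. x \<in> {a..b} \<Longrightarrow> 0 < e \<Longrightarrow> \<exists>z' z y. z' \<in> {a..x} \<and> z \<in> {x..b} \<and>
        (\<forall>t\<in>{z'..z}. f t \<le> f x + e) \<and> y \<in> {T z'..T z} \<and> g y \<le> f x + 2 * e"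
  shows "pvar {a..b} f \<le> pvar {a..b} g"
proof (rule pvar_leI)
  fix P assume P: "sorted_wrt (<) P" "set P \<subseteq> {a..b}"
  show "ereal (lvar f P) \<le> pvar {a..b} g"
  proof (cases P)
    case Nil then show ?thesis using pvar_nonneg by (simp add: zero_ereal_def[symmetric])
  next
    case (Cons x xs)
    obtain ys up where ys: "sorted_wrt (<) (x # ys)" "set ys \<subseteq> set xs" "zigzag 0 f up (x # ys)"
      "lvar f (x # ys) = lvar f P" using zigzag_sublist[of x xs f] P Cons by auto
    obtain d where d: "d > 0" "zigzag d f up (x # ys)" using zigzag_gap[OF ys(3)] by blast
    define n where "n = length (x # ys)"
    have close: "ereal (lvar f P - 4 * e * n) \<le> pvar {a..b} g" if e: "0 < e" "2 * e \<le> d" for e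
    proof -
      define sgn where "sgn up u = (if up then - u else (u::real))" for up u
      have "\<forall>up. \<forall>x\<in>{a..b}. \<exists>w. fst w \<in> {a..x} \<and> fst (snd w) \<in> {x..b} \<and>
        (\<forall>t\<in>{fst w..fst (snd w)}. sgn up (f x) - e \<le> sgn up (f t)) \<and>
        snd (snd w) \<in> {T (fst w)..T (fst (snd w))} \<and> sgn up (f x) - 2 * e \<le> sgn up (g (snd (snd w)))"
      proof (intro allI ballI)
        fix up x assume x: "x \<in> {a..b}"
        show "\<exists>w. fst w \<in> {a..x} \<and> fst (snd w) \<in> {x..b} \<and>
        (\<forall>t\<in>{fst w..fst (snd w)}. sgn up (f x) - e \<le> sgn up (f t)) \<and>
        snd (snd w) \<in> {T (fst w)..T (fst (snd w))} \<and> sgn up (f x) - 2 * e \<le> sgn up (g (snd (snd w)))"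
        proof (cases up)
          case True
          obtain z' z y where "z' \<in> {a..x} \<and> z \<in> {x..b} \<and>
            (\<forall>t\<in>{z'..z}. f t \<le> f x + e) \<and> y \<in> {T z'..T z} \<and> g y \<le> f x + 2 * e"
            using lo[OF x e(1)] by blast
          then show ?thesis using True by (intro exI[of _ "(z', z, y)"]) (auto simp: sgn_def)
        next
          case False
          obtain z' z y where "z' \<in> {a..x} \<and> z \<in> {x..b} \<and>
            (\<forall>t\<in>{z'..z}. f x - e \<le> f t) \<and> y \<in> {T z'..T z} \<and> f x - 2 * e \<le> g y"
            using hi[OF x e(1)] by blast
          then show ?thesis using False by (intro exI[of _ "(z', z, y)"]) (auto simp: sgn_def)
        qed
      qed
      then obtain w where w: "\<forall>up. \<forall>x\<in>{a..b}. fst (w up x) \<in> {a..x} \<and> fst (snd (w up x)) \<in> {x..b} \<and>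
        (\<forall>t\<in>{fst (w up x)..fst (snd (w up x))}. sgn up (f x) - e \<le> sgn up (f t)) \<and>
        snd (snd (w up x)) \<in> {T (fst (w up x))..T (fst (snd (w up x)))} \<and>
        sgn up (f x) - 2 * e \<le> sgn up (g (snd (snd (w up x))))"
        by metis
      define l where "l up x = fst (w up x)" for up x
      define r where "r up x = fst (snd (w up x))" for up x
      define Y where "Y up x = snd (snd (w up x))" for up x
      have w': "l up x \<in> {a..x}" "r up x \<in> {x..b}"
        "\<And>t. t \<in> {l up x..r up x} \<Longrightarrow> sgn up (f x) - e \<le> sgn up (f t)"
        "Y up x \<in> {T (l up x)..T (r up x)}" "sgn up (f x) - 2 * e \<le> sgn up (g (Y up x))"
        if "x \<in> {a..b}" for up x
        using w that unfolding l_def r_def Y_def by blast+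
      have Yab: "Y up x \<in> {a..b}" if x: "x \<in> {a..b}" for up x
      proof -
        have "T (l up x) \<in> {a..b}" "T (r up x) \<in> {a..b}"
          using w'(1,2)[OF x, of up] T(2) x by (auto simp: image_subset_iff)
        then show ?thesis using w'(4)[OF x, of up] by auto
      qed
      have YY: "Y up x \<le> Y (\<not> up) y"
        if xy: "x \<in> {a..b}" "y \<in> {a..b}" "x < y" "if up then f x + d < f y else f y + d < f x" for up x y
      proof -
        have "r up x < l (\<not> up) y"
        proof (rule ccontr)
          assume "\<not> ?thesis"
          then have "\<exists>t. t \<in> {l up x..r up x} \<and> t \<in> {l (\<not> up) y..r (\<not> up) y}"
            using w'(1,2)[OF xy(1), of up] w'(1,2)[OF xy(2), of "\<not> up"] xy(3)
            by (intro exI[of _ "max x (l (\<not> up) y)"]) auto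
          then obtain t where "t \<in> {l up x..r up x}" "t \<in> {l (\<not> up) y..r (\<not> up) y}" by blast
          then show False
            using w'(3)[OF xy(1), of t up] w'(3)[OF xy(2), of t "\<not> up"] xy(4) e(2)
            by (auto simp: sgn_def split: if_splits)
        qed
        then have "T (r up x) \<le> T (l (\<not> up) y)"
          using w'(1,2)[OF xy(1), of up] w'(1,2)[OF xy(2), of "\<not> up"] xy(1,2)
          by (intro mono_onD[OF T(1)]) auto
        then show ?thesis using w'(4)[OF xy(1), of up] w'(4)[OF xy(2), of "\<not> up"] by auto
      qed
      define Yl where "Yl = rec_list (\<lambda>up. []) (\<lambda>x xs F up. Y up x # F (\<not> up))"
      have Yl: "Yl [] up = []" "Yl (x # xs) up = Y up x # Yl xs (\<not> up)" for x xs up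
        by (auto simp: Yl_def)
      have main: "sorted_wrt (<) xs \<Longrightarrow> set xs \<subseteq> {a..b} \<Longrightarrow> zigzag d f up xs \<Longrightarrow>
          sorted (Yl xs up) \<and> set (Yl xs up) \<subseteq> {a..b} \<and>
          lvar f xs - 4 * e * length xs \<le> lvar g (Yl xs up)" for xs up
      proof (induction xs arbitrary: up rule: induct_list012)
        case (2 x)
        then show ?case using Yab e by (simp add: Yl)
      next
        case (3 x y zs)
        have xy: "x \<in> {a..b}" "y \<in> {a..b}" "x < y" "if up then f x + d < f y else f y + d < f x"
          using "3.prems" by auto
        have IH: "sorted (Yl (y # zs) (\<not> up))" "set (Yl (y # zs) (\<not> up)) \<subseteq> {a..b}"
          "lvar f (y # zs) - 4 * e * length (y # zs) \<le> lvar g (Yl (y # zs) (\<not> up))"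
          using "3.IH"(2)[of "\<not> up"] "3.prems" by auto
        have "\<bar>f y - f x\<bar> - 4 * e \<le> \<bar>g (Y (\<not> up) y) - g (Y up x)\<bar>"
          using w'(5)[OF xy(1), of up] w'(5)[OF xy(2), of "\<not> up"] xy(4) e d(1)
          by (auto simp: sgn_def split: if_splits)
        then show ?case
          using IH YY[OF xy] Yab[OF xy(1), of up] by (auto simp: Yl algebra_simps)
      qed (auto simp: Yl)
      have "set (x # ys) \<subseteq> {a..b}" using ys(2) P(2) Cons by auto
      note m = main[OF ys(1) this d(2)]
      then have "ereal (lvar g (Yl (x # ys) up)) \<le> pvar {a..b} g" by (intro lvar_le_pvar) auto
      moreover have "ereal (lvar f P - 4 * e * n) \<le> ereal (lvar g (Yl (x # ys) up))"
        using m ys(4) by (simp add: n_def)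
      ultimately show ?thesis by (rule order_trans[rotated])
    qed
    show ?thesis
    proof (rule ereal_le_epsilon2)
      fix e :: real assume e: "0 < e"
      define e' where "e' = min (d / 2) (e / (4 * n))"
      have n: "0 < n" by (simp add: n_def)
      have e': "0 < e'" "2 * e' \<le> d" using d(1) e n by (auto simp: e'_def)
      have "e' \<le> e / (4 * n)" by (simp add: e'_def)
      then have "4 * e' * n \<le> e" using n by (simp add: field_simps)
      then have "ereal (lvar f P - e) \<le> pvar {a..b} g"
        by (intro order_trans[OF _ close[OF e']]) simp
      then show "ereal (lvar f P) \<le> pvar {a..b} g + ereal e"
        by (cases "pvar {a..b} g") auto
    qed
  qed
qed

section \<open>The reaction step\<close>

definition bounded_lipschitz :: "real \<Rightarrow> (real \<Rightarrow> real \<Rightarrow> real) \<Rightarrow> bool" where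
  "bounded_lipschitz M \<phi> \<longleftrightarrow> (\<exists>B L. 0 \<le> B \<and> 0 \<le> L \<and> (\<forall>s\<in>{0..M}. \<forall>r\<in>{0..1}. \<bar>\<phi> s r\<bar> \<le> B \<and>
      (\<forall>s'\<in>{0..M}. \<forall>r'\<in>{0..1}. \<bar>\<phi> s r - \<phi> s' r'\<bar> \<le> L * (\<bar>s - s'\<bar> + \<bar>r - r'\<bar>))))"

lemma bounded_lipschitzI:
  assumes "0 \<le> B" "0 \<le> L" "\<And>s r. s \<in> {0..M} \<Longrightarrow> r \<in> {0..1} \<Longrightarrow> \<bar>\<phi> s r\<bar> \<le> B"
    "\<And>s r s' r'. s \<in> {0..M} \<Longrightarrow> r \<in> {0..1} \<Longrightarrow> s' \<in> {0..M} \<Longrightarrow> r' \<in> {0..1} \<Longrightarrow>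
       \<bar>\<phi> s r - \<phi> s' r'\<bar> \<le> L * (\<bar>s - s'\<bar> + \<bar>r - r'\<bar>)"
  shows "bounded_lipschitz M \<phi>"
  unfolding bounded_lipschitz_def using assms by blast

lemma bounded_lipschitzE:
  assumes "bounded_lipschitz M \<phi>"
  obtains B L where "0 \<le> B" "0 \<le> L" "\<And>s r. s \<in> {0..M} \<Longrightarrow> r \<in> {0..1} \<Longrightarrow> \<bar>\<phi> s r\<bar> \<le> B"
    "\<And>s r s' r'. s \<in> {0..M} \<Longrightarrow> r \<in> {0..1} \<Longrightarrow> s' \<in> {0..M} \<Longrightarrow> r' \<in> {0..1} \<Longrightarrow>
       \<bar>\<phi> s r - \<phi> s' r'\<bar> \<le> L * (\<bar>s - s'\<bar> + \<bar>r - r'\<bar>)"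
  using assms unfolding bounded_lipschitz_def by metis

lemma abs_mult_diff_le:
  fixes u v u' v' :: real
  assumes "\<bar>u\<bar> \<le> A" "\<bar>v'\<bar> \<le> B"
  shows "\<bar>u * v - u' * v'\<bar> \<le> A * \<bar>v - v'\<bar> + B * \<bar>u - u'\<bar>"
proof -
  have "u * v - u' * v' = u * (v - v') + v' * (u - u')" by (simp add: algebra_simps)
  then have "\<bar>u * v - u' * v'\<bar> \<le> \<bar>u\<bar> * \<bar>v - v'\<bar> + \<bar>v'\<bar> * \<bar>u - u'\<bar>"
    by (metis abs_mult abs_triangle_ineq)
  also have "\<dots> \<le> A * \<bar>v - v'\<bar> + B * \<bar>u - u'\<bar>"
    using assms by (intro add_mono mult_right_mono) auto
  finally show ?thesis .
qed

lemma bounded_lipschitz_const: "bounded_lipschitz M (\<lambda>s r. c)"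
  by (rule bounded_lipschitzI[of "\<bar>c\<bar>" 0]) auto

lemma bounded_lipschitz_fst: "bounded_lipschitz M (\<lambda>s r. s)"
  by (rule bounded_lipschitzI[of "\<bar>M\<bar>" 1]) auto

lemma bounded_lipschitz_snd: "bounded_lipschitz M (\<lambda>s r. r)"
  by (rule bounded_lipschitzI[of 1 1]) auto

lemma bounded_lipschitz_mult:
  assumes "bounded_lipschitz M \<phi>" "bounded_lipschitz M \<psi>"
  shows "bounded_lipschitz M (\<lambda>s r. \<phi> s r * \<psi> s r)"
proof -
  obtain B L where 1: "0 \<le> B" "0 \<le> L" "\<And>s r. s \<in> {0..M} \<Longrightarrow> r \<in> {0..1} \<Longrightarrow> \<bar>\<phi> s r\<bar> \<le> B"
    "\<And>s r s' r'. s \<in> {0..M} \<Longrightarrow> r \<in> {0..1} \<Longrightarrow> s' \<in> {0..M} \<Longrightarrow> r' \<in> {0..1} \<Longrightarrow>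
       \<bar>\<phi> s r - \<phi> s' r'\<bar> \<le> L * (\<bar>s - s'\<bar> + \<bar>r - r'\<bar>)" using bounded_lipschitzE[OF assms(1)] by metis
  obtain C K where 2: "0 \<le> C" "0 \<le> K" "\<And>s r. s \<in> {0..M} \<Longrightarrow> r \<in> {0..1} \<Longrightarrow> \<bar>\<psi> s r\<bar> \<le> C"
    "\<And>s r s' r'. s \<in> {0..M} \<Longrightarrow> r \<in> {0..1} \<Longrightarrow> s' \<in> {0..M} \<Longrightarrow> r' \<in> {0..1} \<Longrightarrow>
       \<bar>\<psi> s r - \<psi> s' r'\<bar> \<le> K * (\<bar>s - s'\<bar> + \<bar>r - r'\<bar>)" using bounded_lipschitzE[OF assms(2)] by metis
  show ?thesis
  proof (rule bounded_lipschitzI[of "B * C" "B * K + C * L"])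
    fix s r s' r' assume *: "s \<in> {0..M}" "r \<in> {0..1::real}" "s' \<in> {0..M}" "r' \<in> {0..1::real}"
    have "\<bar>\<phi> s r * \<psi> s r - \<phi> s' r' * \<psi> s' r'\<bar> \<le> B * \<bar>\<psi> s r - \<psi> s' r'\<bar> + C * \<bar>\<phi> s r - \<phi> s' r'\<bar>"
      using 1 2 * by (intro abs_mult_diff_le) auto
    also have "\<dots> \<le> B * (K * (\<bar>s - s'\<bar> + \<bar>r - r'\<bar>)) + C * (L * (\<bar>s - s'\<bar> + \<bar>r - r'\<bar>))"
      using 1 2 * by (intro add_mono mult_left_mono) auto
    finally show "\<bar>\<phi> s r * \<psi> s r - \<phi> s' r' * \<psi> s' r'\<bar> \<le> (B * K + C * L) * (\<bar>s - s'\<bar> + \<bar>r - r'\<bar>)"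
      by (simp add: algebra_simps)
  qed (use 1 2 in \<open>auto simp: abs_mult intro!: mult_mono\<close>)
qed

lemma bounded_lipschitz_add:
  assumes "bounded_lipschitz M \<phi>" "bounded_lipschitz M \<psi>"
  shows "bounded_lipschitz M (\<lambda>s r. \<phi> s r + \<psi> s r)"
proof -
  obtain B L where 1: "0 \<le> B" "0 \<le> L" "\<And>s r. s \<in> {0..M} \<Longrightarrow> r \<in> {0..1} \<Longrightarrow> \<bar>\<phi> s r\<bar> \<le> B"
    "\<And>s r s' r'. s \<in> {0..M} \<Longrightarrow> r \<in> {0..1} \<Longrightarrow> s' \<in> {0..M} \<Longrightarrow> r' \<in> {0..1} \<Longrightarrow>
       \<bar>\<phi> s r - \<phi> s' r'\<bar> \<le> L * (\<bar>s - s'\<bar> + \<bar>r - r'\<bar>)" using bounded_lipschitzE[OF assms(1)] by metis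
  obtain C K where 2: "0 \<le> C" "0 \<le> K" "\<And>s r. s \<in> {0..M} \<Longrightarrow> r \<in> {0..1} \<Longrightarrow> \<bar>\<psi> s r\<bar> \<le> C"
    "\<And>s r s' r'. s \<in> {0..M} \<Longrightarrow> r \<in> {0..1} \<Longrightarrow> s' \<in> {0..M} \<Longrightarrow> r' \<in> {0..1} \<Longrightarrow>
       \<bar>\<psi> s r - \<psi> s' r'\<bar> \<le> K * (\<bar>s - s'\<bar> + \<bar>r - r'\<bar>)" using bounded_lipschitzE[OF assms(2)] by metis
  show ?thesis
  proof (rule bounded_lipschitzI[of "B + C" "L + K"])
    fix s r assume *: "s \<in> {0..M}" "r \<in> {0..1::real}"
    show "\<bar>\<phi> s r + \<psi> s r\<bar> \<le> B + C" using 1(3)[OF *] 2(3)[OF *] by linarith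
    fix s' r' assume **: "s' \<in> {0..M}" "r' \<in> {0..1::real}"
    show "\<bar>\<phi> s r + \<psi> s r - (\<phi> s' r' + \<psi> s' r')\<bar> \<le> (L + K) * (\<bar>s - s'\<bar> + \<bar>r - r'\<bar>)"
      using 1(4)[OF * **] 2(4)[OF * **] unfolding distrib_right[of L K] by linarith
  qed (use 1 2 in auto)
qed

lemma bounded_lipschitz_diff:
  assumes "bounded_lipschitz M \<phi>" "bounded_lipschitz M \<psi>"
  shows "bounded_lipschitz M (\<lambda>s r. \<phi> s r - \<psi> s r)"
  using bounded_lipschitz_add[OF assms(1) bounded_lipschitz_mult[OF bounded_lipschitz_const[of M "-1"] assms(2)]]
  by simp

lemma rate_fun_bound:
  assumes "rate_fun F"
  obtains B where "0 \<le> B" "\<And>s r. 0 \<le> s \<Longrightarrow> r \<in> {0..1} \<Longrightarrow> \<bar>tld F s r\<bar> \<le> B"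
proof -
  obtain B where B: "\<forall>x\<in>F ` ({0..} \<times> {0..}). norm x \<le> B"
    using assms unfolding rate_fun_def bounded_iff by blast
  have "\<bar>tld F s r\<bar> \<le> B" if "0 \<le> s" "r \<in> {0..1}" for s r
    using B that by (auto simp: tld_def)
  moreover from this[of 0 0] have "0 \<le> B" by simp
  ultimately show ?thesis using that by blast
qed

lemma bounded_lipschitz_tld:
  assumes "rate_fun F"
  shows "bounded_lipschitz M (tld F)"
proof -
  obtain B where B: "0 \<le> B" "\<And>s r. 0 \<le> s \<Longrightarrow> r \<in> {0..1} \<Longrightarrow> \<bar>tld F s r\<bar> \<le> B"
    using rate_fun_bound[OF assms] by metis
  obtain L where L: "L-lipschitz_on ({0..} \<times> {0..}) F" using assms unfolding rate_fun_def by blast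
  have L0: "0 \<le> L" using L by (rule lipschitz_on_nonneg)
  show ?thesis
  proof (rule bounded_lipschitzI[OF B(1), of "2 * L * (1 + \<bar>M\<bar>)"])
    fix s r s' r' assume *: "s \<in> {0..M}" "r \<in> {0..1::real}" "s' \<in> {0..M}" "r' \<in> {0..1::real}"
    let ?d = "dist (r * s, (1 - r) * s) (r' * s', (1 - r') * s')"
    have 1: "\<bar>tld F s r - tld F s' r'\<bar> \<le> L * ?d"
      using lipschitz_onD[OF L, of "(r * s, (1 - r) * s)" "(r' * s', (1 - r') * s')"] *
      by (auto simp: tld_def dist_real_def)
    have "?d \<le> \<bar>r * s - r' * s'\<bar> + \<bar>(1 - r) * s - (1 - r') * s'\<bar>"
      unfolding dist_prod_def by (auto simp: dist_real_def intro: order_trans[OF sqrt_sum_squares_le_sum_abs])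
    also have "\<dots> \<le> (1 * \<bar>s - s'\<bar> + M * \<bar>r - r'\<bar>) + (1 * \<bar>s - s'\<bar> + M * \<bar>(1 - r) - (1 - r')\<bar>)"
      using * by (intro add_mono abs_mult_diff_le) auto
    also have "\<dots> \<le> 2 * (1 + \<bar>M\<bar>) * (\<bar>s - s'\<bar> + \<bar>r - r'\<bar>)"
      using * by (simp add: algebra_simps abs_minus_commute)
    finally have "L * ?d \<le> L * (2 * (1 + \<bar>M\<bar>) * (\<bar>s - s'\<bar> + \<bar>r - r'\<bar>))"
      using L0 by (rule mult_left_mono)
    then show "\<bar>tld F s r - tld F s' r'\<bar> \<le> 2 * L * (1 + \<bar>M\<bar>) * (\<bar>s - s'\<bar> + \<bar>r - r'\<bar>)"
      using 1 by (simp add: mult_ac)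
  qed (use B L0 in auto)
qed

lemma bounded_lipschitz_SigF:
  assumes "rate_fun F1" "rate_fun F2" "rate_fun G1" "rate_fun G2"
  shows "bounded_lipschitz M (SigF F1 F2 G1 G2)"
proof -
  have "SigF F1 F2 G1 G2 =
      (\<lambda>s r. s * (r * (tld F1 s r + tld G2 s r) + (1 - r) * (tld G1 s r + tld F2 s r)))"
    by (simp add: SigF_def fun_eq_iff)
  then show ?thesis
    using assms by (simp only:) (intro bounded_lipschitz_mult bounded_lipschitz_add bounded_lipschitz_diff
        bounded_lipschitz_fst bounded_lipschitz_snd bounded_lipschitz_const bounded_lipschitz_tld)
qed

lemma bounded_lipschitz_RF:
  assumes "rate_fun F1" "rate_fun F2" "rate_fun G1" "rate_fun G2"
  shows "bounded_lipschitz M (RF F1 F2 G1 G2)"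
proof -
  have "RF F1 F2 G1 G2 = (\<lambda>s r. r * (1 - r) * (tld F1 s r - tld F2 s r)
      + (1 - r) * (1 - r) * tld G1 s r - r * r * tld G2 s r)"
    by (simp add: RF_def fun_eq_iff power2_eq_square)
  then show ?thesis
    using assms by (simp only:) (intro bounded_lipschitz_mult bounded_lipschitz_add bounded_lipschitz_diff
        bounded_lipschitz_fst bounded_lipschitz_snd bounded_lipschitz_const bounded_lipschitz_tld)
qed

lemma gronwall_within:
  fixes u :: "real \<Rightarrow> real"
  assumes der: "\<And>t. t \<in> {0..\<tau>} \<Longrightarrow> (u has_real_derivative u' t) (at t within {0..\<tau>})"
    and le: "\<And>t. t \<in> {0..\<tau>} \<Longrightarrow> u' t \<le> C * u t" and t: "t \<in> {0..\<tau>}"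
  shows "u t \<le> u 0 * exp (C * t)"
proof -
  have d: "((\<lambda>t. u t * exp (- C * t)) has_real_derivative (u' x - C * u x) * exp (- C * x))
      (at x within {0..\<tau>})" if "x \<in> {0..\<tau>}" for x
    by (auto intro!: derivative_eq_intros der[OF that] simp: algebra_simps)
  have "u t * exp (- C * t) \<le> u 0 * exp (- C * 0)"
  proof (rule DERIV_nonpos_imp_decreasing_open[where f = "\<lambda>t. u t * exp (- C * t)"])
    show "0 \<le> t" using t by simp
    have "continuous_on {0..\<tau>} (\<lambda>t. u t * exp (- C * t))"
      using d by (meson DERIV_continuous continuous_on_eq_continuous_within)
    then show "continuous_on {0..t} (\<lambda>t. u t * exp (- C * t))"
      by (rule continuous_on_subset) (use t in auto)
    fix x assume x: "0 < x" "x < t"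
    then have "at x within {0..\<tau>} = at x" using t by (intro at_within_interior) auto
    then show "\<exists>y. ((\<lambda>t. u t * exp (- C * t)) has_real_derivative y) (at x) \<and> y \<le> 0"
      using d[of x] le[of x] x t by (intro exI conjI) (auto simp: mult_nonpos_nonneg)
  qed
  then have "u t * exp (- C * t) * exp (C * t) \<le> u 0 * exp (C * t)"
    by (intro mult_right_mono) auto
  then show ?thesis by (simp add: mult.assoc flip: exp_add)
qed

lemma SigF_growth:
  assumes "rate_fun F1" "rate_fun F2" "rate_fun G1" "rate_fun G2"
  obtains C where "0 \<le> C" "\<And>s r. 0 \<le> s \<Longrightarrow> r \<in> {0..1} \<Longrightarrow> SigF F1 F2 G1 G2 s r \<le> C * s"
proof -
  obtain B1 where B1: "0 \<le> B1" "\<And>s r. 0 \<le> s \<Longrightarrow> r \<in> {0..1} \<Longrightarrow> \<bar>tld F1 s r\<bar> \<le> B1"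
    using rate_fun_bound[OF assms(1)] by metis
  obtain B2 where B2: "0 \<le> B2" "\<And>s r. 0 \<le> s \<Longrightarrow> r \<in> {0..1} \<Longrightarrow> \<bar>tld F2 s r\<bar> \<le> B2"
    using rate_fun_bound[OF assms(2)] by metis
  obtain B3 where B3: "0 \<le> B3" "\<And>s r. 0 \<le> s \<Longrightarrow> r \<in> {0..1} \<Longrightarrow> \<bar>tld G1 s r\<bar> \<le> B3"
    using rate_fun_bound[OF assms(3)] by metis
  obtain B4 where B4: "0 \<le> B4" "\<And>s r. 0 \<le> s \<Longrightarrow> r \<in> {0..1} \<Longrightarrow> \<bar>tld G2 s r\<bar> \<le> B4"
    using rate_fun_bound[OF assms(4)] by metis
  define C where "C = B1 + B2 + B3 + B4"
  have "SigF F1 F2 G1 G2 s r \<le> C * s" if s: "0 \<le> s" and r: "r \<in> {0..1}" for s r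
  proof -
    have "r * (tld F1 s r + tld G2 s r) + (1 - r) * (tld G1 s r + tld F2 s r) \<le> r * C + (1 - r) * C"
      using B1(1) B2(1) B3(1) B4(1) B1(2)[OF s r] B2(2)[OF s r] B3(2)[OF s r] B4(2)[OF s r] r unfolding C_def by (intro add_mono[OF mult_left_mono mult_left_mono]) auto
    also have "\<dots> = C" by (simp add: algebra_simps)
    finally show ?thesis using s unfolding SigF_def by (metis mult.commute mult_left_mono)
  qed
  moreover have "0 \<le> C" using B1 B2 B3 B4 by (simp add: C_def)
  ultimately show ?thesis using that by blast
qed

lemma reaction_step_bounds:
  assumes "reaction_step Sg Rr \<tau> s0 q0 s1 q1" "0 \<le> \<tau>"
    and C: "\<And>s r. 0 \<le> s \<Longrightarrow> r \<in> {0..1} \<Longrightarrow> Sg s r \<le> C * s"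
  shows "0 \<le> s1" "q1 \<in> {0..1}" "s1 \<le> s0 * exp (C * \<tau>)"
proof -
  obtain s q where *: "s 0 = s0" "s \<tau> = s1" "q \<tau> = q1"
     "\<forall>t\<in>{0..\<tau>}. 0 \<le> s t \<and> 0 \<le> q t \<and> q t \<le> 1
        \<and> (s has_real_derivative Sg (s t) (q t)) (at t within {0..\<tau>})
        \<and> (q has_real_derivative Rr (s t) (q t)) (at t within {0..\<tau>})"
    using assms(1) unfolding reaction_step_def by blast
  show "0 \<le> s1" "q1 \<in> {0..1}" using * assms(2) by auto
  show "s1 \<le> s0 * exp (C * \<tau>)"
    using gronwall_within[of \<tau> s "\<lambda>t. Sg (s t) (q t)" C \<tau>] * C assms(2) by auto
qed

lemma reaction_step_stability:
  assumes Sg: "bounded_lipschitz M Sg" and Rr: "bounded_lipschitz M Rr"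
    and C: "0 \<le> C" "\<And>s r. 0 \<le> s \<Longrightarrow> r \<in> {0..1} \<Longrightarrow> Sg s r \<le> C * s"
  obtains K where "0 \<le> K"
    "\<And>\<tau> s0 q0 s1 q1 s0' q0' s1' q1'. 0 < \<tau> \<Longrightarrow> \<tau> < 1 \<Longrightarrow>
       reaction_step Sg Rr \<tau> s0 q0 s1 q1 \<Longrightarrow> reaction_step Sg Rr \<tau> s0' q0' s1' q1' \<Longrightarrow>
       s0 * exp (C * \<tau>) \<le> M \<Longrightarrow> s0' * exp (C * \<tau>) \<le> M \<Longrightarrow>
       \<bar>s1 - s1'\<bar> \<le> \<bar>s0 - s0'\<bar> + K * \<tau> * (\<bar>s0 - s0'\<bar> + \<bar>q0 - q0'\<bar>) \<and>
       \<bar>q1 - q1'\<bar> \<le> \<bar>q0 - q0'\<bar> + K * \<tau> * (\<bar>s0 - s0'\<bar> + \<bar>q0 - q0'\<bar>)"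
proof -
  obtain B1 L1 where L1: "0 \<le> L1"
    "\<And>s r s' r'. s \<in> {0..M} \<Longrightarrow> r \<in> {0..1} \<Longrightarrow> s' \<in> {0..M} \<Longrightarrow> r' \<in> {0..1} \<Longrightarrow>
       \<bar>Sg s r - Sg s' r'\<bar> \<le> L1 * (\<bar>s - s'\<bar> + \<bar>r - r'\<bar>)" using bounded_lipschitzE[OF Sg] by metis
  obtain B2 L2 where L2: "0 \<le> L2"
    "\<And>s r s' r'. s \<in> {0..M} \<Longrightarrow> r \<in> {0..1} \<Longrightarrow> s' \<in> {0..M} \<Longrightarrow> r' \<in> {0..1} \<Longrightarrow>
       \<bar>Rr s r - Rr s' r'\<bar> \<le> L2 * (\<bar>s - s'\<bar> + \<bar>r - r'\<bar>)" using bounded_lipschitzE[OF Rr] by metis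
  define L where "L = max L1 L2"
  have L: "0 \<le> L" "L1 \<le> L" "L2 \<le> L" using L1 by (auto simp: L_def)
  define K where "K = L * (2 * exp (2 * L))"
  show ?thesis
  proof (rule that[of K])
    show "0 \<le> K" using L by (simp add: K_def)
    fix \<tau> s0 q0 s1 q1 s0' q0' s1' q1' :: real
    assume \<tau>: "0 < \<tau>" "\<tau> < 1" and st: "reaction_step Sg Rr \<tau> s0 q0 s1 q1" "reaction_step Sg Rr \<tau> s0' q0' s1' q1'"
      and M: "s0 * exp (C * \<tau>) \<le> M" "s0' * exp (C * \<tau>) \<le> M"
    obtain s q where s: "s 0 = s0" "q 0 = q0" "s \<tau> = s1" "q \<tau> = q1"
     "\<forall>t\<in>{0..\<tau>}. 0 \<le> s t \<and> 0 \<le> q t \<and> q t \<le> 1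
        \<and> (s has_real_derivative Sg (s t) (q t)) (at t within {0..\<tau>})
        \<and> (q has_real_derivative Rr (s t) (q t)) (at t within {0..\<tau>})"
      using st(1) unfolding reaction_step_def by blast
    obtain s' q' where s': "s' 0 = s0'" "q' 0 = q0'" "s' \<tau> = s1'" "q' \<tau> = q1'"
     "\<forall>t\<in>{0..\<tau>}. 0 \<le> s' t \<and> 0 \<le> q' t \<and> q' t \<le> 1
        \<and> (s' has_real_derivative Sg (s' t) (q' t)) (at t within {0..\<tau>})
        \<and> (q' has_real_derivative Rr (s' t) (q' t)) (at t within {0..\<tau>})"
      using st(2) unfolding reaction_step_def by blast
    have up: "v t \<le> M" if "v 0 * exp (C * \<tau>) \<le> M" "t \<in> {0..\<tau>}"
      "\<forall>t\<in>{0..\<tau>}. 0 \<le> v t \<and> 0 \<le> p t \<and> p t \<le> 1 \<and> (v has_real_derivative Sg (v t) (p t)) (at t within {0..\<tau>})"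
      for v p t
    proof -
      have "v t \<le> v 0 * exp (C * t)"
        using gronwall_within[of \<tau> v "\<lambda>t. Sg (v t) (p t)" C t] that C by auto
      also have "\<dots> \<le> v 0 * exp (C * \<tau>)"
        using that \<tau> C(1) by (intro mult_left_mono) (auto intro: mult_left_mono)
      finally show ?thesis using that by simp
    qed
    have in_dom: "s t \<in> {0..M}" "s' t \<in> {0..M}" "q t \<in> {0..1}" "q' t \<in> {0..1}" if t: "t \<in> {0..\<tau>}" for t
      using up[of s t q] up[of s' t q'] s s' M t by auto
    define D where "D t = \<bar>s t - s' t\<bar> + \<bar>q t - q' t\<bar>" for t
    have lipS: "\<bar>Sg (s t) (q t) - Sg (s' t) (q' t)\<bar> \<le> L * D t" if t: "t \<in> {0..\<tau>}" for t
    proof -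
      have "\<bar>Sg (s t) (q t) - Sg (s' t) (q' t)\<bar> \<le> L1 * D t"
        unfolding D_def using in_dom[OF t] by (intro L1)
      also have "\<dots> \<le> L * D t" using L by (intro mult_right_mono) (auto simp: D_def)
      finally show ?thesis .
    qed
    have lipR: "\<bar>Rr (s t) (q t) - Rr (s' t) (q' t)\<bar> \<le> L * D t" if t: "t \<in> {0..\<tau>}" for t
    proof -
      have "\<bar>Rr (s t) (q t) - Rr (s' t) (q' t)\<bar> \<le> L2 * D t"
        unfolding D_def using in_dom[OF t] by (intro L2)
      also have "\<dots> \<le> L * D t" using L by (intro mult_right_mono) (auto simp: D_def)
      finally show ?thesis .
    qed
    define u where "u t = (s t - s' t)\<^sup>2 + (q t - q' t)\<^sup>2" for t
    define u' where "u' t = 2 * (s t - s' t) * (Sg (s t) (q t) - Sg (s' t) (q' t))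
        + 2 * (q t - q' t) * (Rr (s t) (q t) - Rr (s' t) (q' t))" for t
    have uD: "u t \<le> (D t)\<^sup>2" "(D t)\<^sup>2 \<le> 2 * u t" for t
      using sum_squares_bound[of "\<bar>s t - s' t\<bar>" "\<bar>q t - q' t\<bar>"]
      by (auto simp: u_def D_def power2_sum)
    have D_le: "D t \<le> 2 * exp (2 * L) * D 0" if t: "t \<in> {0..\<tau>}" for t
    proof -
      have "u t \<le> u 0 * exp (4 * L * t)"
      proof (rule gronwall_within[OF _ _ t])
        fix t assume t: "t \<in> {0..\<tau>}"
        show "(u has_real_derivative u' t) (at t within {0..\<tau>})"
          unfolding u_def u'_def using s(5) s'(5) t
          by (auto intro!: derivative_eq_intros simp: algebra_simps)
        have "u' t \<le> 2 * (\<bar>s t - s' t\<bar> * \<bar>Sg (s t) (q t) - Sg (s' t) (q' t)\<bar>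
            + \<bar>q t - q' t\<bar> * \<bar>Rr (s t) (q t) - Rr (s' t) (q' t)\<bar>)"
          unfolding u'_def abs_mult[symmetric] by (simp add: algebra_simps abs_if)
        also have "\<dots> \<le> 2 * (\<bar>s t - s' t\<bar> * (L * D t) + \<bar>q t - q' t\<bar> * (L * D t))"
          using lipS[OF t] lipR[OF t] by (intro mult_left_mono add_mono) auto
        also have "\<dots> = 2 * L * (D t)\<^sup>2" by (simp add: D_def algebra_simps power2_eq_square)
        also have "\<dots> \<le> 2 * L * (2 * u t)" using uD(2)[of t] L by (intro mult_left_mono) auto
        finally show "u' t \<le> 4 * L * u t" by simp
      qed
      also have "\<dots> \<le> (D 0)\<^sup>2 * exp (4 * L)"
      proof (intro mult_mono uD)
        have "4 * L * t \<le> 4 * L * 1" using t \<tau> L by (intro mult_left_mono) auto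
        then show "exp (4 * L * t) \<le> exp (4 * L)" by simp
      qed auto
      finally have "(D t)\<^sup>2 \<le> 2 * ((D 0)\<^sup>2 * exp (4 * L))" using uD(2)[of t] by simp
      also have "\<dots> \<le> (2 * exp (2 * L) * D 0)\<^sup>2"
        by (simp add: power_mult_distrib flip: exp_of_nat_mult)
      finally show ?thesis
        by (rule power2_le_imp_le) (auto simp: D_def)
    qed
    have inc: "\<bar>(v \<tau> - w \<tau>) - (v 0 - w 0)\<bar> \<le> K * \<tau> * D 0"
      if "\<And>t. t \<in> {0..\<tau>} \<Longrightarrow> (v has_real_derivative dv t) (at t within {0..\<tau>})"
        "\<And>t. t \<in> {0..\<tau>} \<Longrightarrow> (w has_real_derivative dw t) (at t within {0..\<tau>})"
        "\<And>t. t \<in> {0..\<tau>} \<Longrightarrow> \<bar>dv t - dw t\<bar> \<le> L * D t" for v w dv dw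
    proof -
      have "norm ((\<lambda>t. v t - w t) \<tau> - (\<lambda>t. v t - w t) 0) \<le> (K * D 0) * norm (\<tau> - 0)"
      proof (rule field_differentiable_bound[where S = "{0..\<tau>}" and f' = "\<lambda>t. dv t - dw t"])
        fix t assume t: "t \<in> {0..\<tau>}"
        show "((\<lambda>t. v t - w t) has_field_derivative dv t - dw t) (at t within {0..\<tau>})"
          using that t by (auto intro!: derivative_eq_intros)
        have "\<bar>dv t - dw t\<bar> \<le> L * D t" using that t by simp
        also have "\<dots> \<le> L * (2 * exp (2 * L) * D 0)" using D_le[OF t] L by (intro mult_left_mono)
        finally show "norm (dv t - dw t) \<le> K * D 0" by (simp add: K_def algebra_simps)
      qed (use \<tau> in auto)
      then show ?thesis using \<tau> by (simp add: algebra_simps)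
    qed
    have "\<bar>(s \<tau> - s' \<tau>) - (s 0 - s' 0)\<bar> \<le> K * \<tau> * D 0"
      by (rule inc[of s "\<lambda>t. Sg (s t) (q t)" s' "\<lambda>t. Sg (s' t) (q' t)"])
        (use s(5) s'(5) lipS in auto)
    moreover have "\<bar>(q \<tau> - q' \<tau>) - (q 0 - q' 0)\<bar> \<le> K * \<tau> * D 0"
      by (rule inc[of q "\<lambda>t. Rr (s t) (q t)" q' "\<lambda>t. Rr (s' t) (q' t)"])
        (use s(5) s'(5) lipR in auto)
    ultimately show "\<bar>s1 - s1'\<bar> \<le> \<bar>s0 - s0'\<bar> + K * \<tau> * (\<bar>s0 - s0'\<bar> + \<bar>q0 - q0'\<bar>) \<and>
       \<bar>q1 - q1'\<bar> \<le> \<bar>q0 - q0'\<bar> + K * \<tau> * (\<bar>s0 - s0'\<bar> + \<bar>q0 - q0'\<bar>)"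
      unfolding D_def s(1-4) s'(1-4) by linarith
  qed
qed

section \<open>Couplings and densities\<close>

definition add_measure :: "'a measure \<Rightarrow> 'a measure \<Rightarrow> 'a measure" where
  "add_measure M N = measure_of (space M) (sets M) (\<lambda>A. emeasure M A + emeasure N A)"

lemma sets_add_measure [simp, measurable_cong]: "sets (add_measure M N) = sets M"
  by (simp add: add_measure_def)

lemma space_add_measure [simp]: "space (add_measure M N) = space M"
  by (simp add: add_measure_def)

lemma emeasure_add_measure:
  assumes "sets N = sets M" "A \<in> sets M"
  shows "emeasure (add_measure M N) A = emeasure M A + emeasure N A"
  unfolding add_measure_def
proof (rule emeasure_measure_of[OF refl])
  show "countably_additive (sets (measure_of (space M) (sets M) (\<lambda>A. emeasure M A + emeasure N A)))
      (\<lambda>A. emeasure M A + emeasure N A)"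
  proof (rule countably_additiveI)
    fix A :: "nat \<Rightarrow> 'a set"
    assume A: "range A \<subseteq> sets (measure_of (space M) (sets M) (\<lambda>A. emeasure M A + emeasure N A))"
      "disjoint_family A"
    then have "range A \<subseteq> sets M" "range A \<subseteq> sets N" using assms by auto
    then show "(\<Sum>i. emeasure M (A i) + emeasure N (A i))
        = emeasure M (\<Union> (range A)) + emeasure N (\<Union> (range A))"
      using A(2) by (subst suminf_add[symmetric]) (auto simp: suminf_emeasure)
  qed
qed (use assms in \<open>auto simp: positive_def sets.space_closed\<close>)

lemma nn_integral_add_measure:
  assumes "sets N = sets M" "f \<in> borel_measurable M"
  shows "(\<integral>\<^sup>+x. f x \<partial>add_measure M N) = (\<integral>\<^sup>+x. f x \<partial>M) + (\<integral>\<^sup>+x. f x \<partial>N)"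
  using assms(2)
proof (induction rule: borel_measurable_induct)
  have mN: "h \<in> borel_measurable N \<longleftrightarrow> h \<in> borel_measurable M" for h :: "'a \<Rightarrow> ennreal"
    using assms(1) measurable_cong_sets by blast
  have mA: "h \<in> borel_measurable (add_measure M N) \<longleftrightarrow> h \<in> borel_measurable M" for h :: "'a \<Rightarrow> ennreal"
    by (rule measurable_cong_sets[THEN arg_cong]) auto
  have sN: "space N = space M" using assms(1) by (rule sets_eq_imp_space_eq)
  {
    case (cong f g)
    have "(\<integral>\<^sup>+x. f x \<partial>K) = (\<integral>\<^sup>+x. g x \<partial>K)" if "space K = space M" for K
      by (rule nn_integral_cong) (use that cong in simp)
    then show ?case using cong sN by simp
  next
    case (set A)
    then show ?case using assms(1) emeasure_add_measure[OF assms(1)] by simp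
  next
    case (mult u c)
    then show ?case using mN mA by (simp add: nn_integral_cmult distrib_left)
  next
    case (add u v)
    then show ?case using mN mA by (simp add: nn_integral_add ac_simps)
  next
    case (seq U)
    have m: "U i \<in> borel_measurable M" for i using seq by auto
    have SUP_eq: "(\<integral>\<^sup>+x. (SUP i. U i) x \<partial>K) = (SUP i. \<integral>\<^sup>+x. U i x \<partial>K)" if "sets K = sets M" for K
    proof -
      have "(\<integral>\<^sup>+x. (SUP i. U i) x \<partial>K) = (\<integral>\<^sup>+x. (SUP i. U i x) \<partial>K)"
        by (intro nn_integral_cong) (simp add: image_comp)
      also have "\<dots> = (SUP i. \<integral>\<^sup>+x. U i x \<partial>K)"
        using seq(3) m that
        by (intro nn_integral_monotone_convergence_SUP) (auto simp: measurable_cong_sets[OF that refl])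
      finally show ?thesis .
    qed
    have inc: "incseq (\<lambda>i. \<integral>\<^sup>+x. U i x \<partial>K)" for K
      using seq(3) by (auto simp: incseq_def le_fun_def intro!: nn_integral_mono)
    show ?case
    proof -
      have IH: "(\<integral>\<^sup>+x. U i x \<partial>add_measure M N) = (\<integral>\<^sup>+x. U i x \<partial>M) + (\<integral>\<^sup>+x. U i x \<partial>N)" for i
        using seq by blast
      show ?thesis
        unfolding SUP_eq[OF sets_add_measure] SUP_eq[OF refl] SUP_eq[OF assms(1)] IH
        by (rule ennreal_SUP_add[OF inc inc])
    qed
  }
qed

lemma dmeas_cong:
  assumes "AE x in lborel. x \<in> {a<..<b} \<longrightarrow> f x = g x"
  shows "dmeas a b f = dmeas a b g"
proof -
  have "(\<integral>\<^sup>+x. ennreal (f x) * indicator {a<..<b} x * indicator A x \<partial>lborel) =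
      (\<integral>\<^sup>+x. ennreal (g x) * indicator {a<..<b} x * indicator A x \<partial>lborel)" for A
    by (rule nn_integral_cong_AE, use assms in eventually_elim) (auto split: split_indicator)
  then show ?thesis unfolding dmeas_def density_def by simp
qed

lemma sets_dmeas [simp, measurable_cong]: "sets (dmeas a b f) = sets borel"
  by (simp add: dmeas_def)

lemma space_dmeas [simp]: "space (dmeas a b f) = UNIV"
  by (simp add: dmeas_def)

lemma nn_integral_dmeas:
  assumes [measurable]: "f \<in> borel_measurable borel" "h \<in> borel_measurable borel"
  shows "(\<integral>\<^sup>+x. h x \<partial>dmeas a b f) = (\<integral>\<^sup>+x. ennreal (f x) * indicator {a<..<b} x * h x \<partial>lborel)"
  unfolding dmeas_def by (rule nn_integral_density) auto

lemma emeasure_dmeas: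
  assumes [measurable]: "f \<in> borel_measurable borel" "A \<in> sets borel"
  shows "emeasure (dmeas a b f) A = (\<integral>\<^sup>+x. ennreal (f x) * indicator ({a<..<b} \<inter> A) x \<partial>lborel)"
  unfolding dmeas_def
  by (subst emeasure_density) (auto intro!: nn_integral_cong split: split_indicator)

lemma emeasure_dmeas_set_integral:
  assumes "f \<in> borel_measurable borel" "A \<in> sets borel"
    and f: "\<And>x. x \<in> {a<..<b} \<Longrightarrow> 0 \<le> f x" "set_integrable lborel {a<..<b} f"
  shows "emeasure (dmeas a b f) A = ennreal (LINT x:{a<..<b} \<inter> A|lborel. f x)"
proof -
  have "set_integrable lborel ({a<..<b} \<inter> A) f"
    using assms(2) by (intro set_integrable_subset[OF f(2)]) auto
  then have "(\<integral>\<^sup>+x. ennreal (indicator ({a<..<b} \<inter> A) x *\<^sub>R f x) \<partial>lborel)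
      = ennreal (LINT x:{a<..<b} \<inter> A|lborel. f x)"
    unfolding set_integrable_def set_lebesgue_integral_def
    by (intro nn_integral_eq_integral) (auto simp: f(1) split: split_indicator)
  then show ?thesis
    using assms by (subst emeasure_dmeas) (auto intro!: nn_integral_cong split: split_indicator
        elim!: trans[rotated])
qed

lemma W2sq_le_map:
  assumes S: "S \<in> measurable \<mu> lborel" and T: "T \<in> measurable \<mu> lborel"
  shows "W2sq (distr \<mu> lborel S) (distr \<mu> lborel T) \<le> (\<integral>\<^sup>+x. ennreal ((S x - T x)\<^sup>2) \<partial>\<mu>)"
proof -
  let ?p = "lborel \<Otimes>\<^sub>M lborel :: (real \<times> real) measure"
  have ST [measurable]: "(\<lambda>x. (S x, T x)) \<in> measurable \<mu> ?p" using assms by (rule measurable_Pair)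
  have "distr \<mu> ?p (\<lambda>x. (S x, T x)) \<in> couplings (distr \<mu> lborel S) (distr \<mu> lborel T)"
    unfolding couplings_def by (auto simp: distr_distr comp_def)
  then have "W2sq (distr \<mu> lborel S) (distr \<mu> lborel T) \<le>
      (\<integral>\<^sup>+ z. ennreal ((fst z - snd z)\<^sup>2) \<partial>distr \<mu> ?p (\<lambda>x. (S x, T x)))"
    unfolding W2sq_def by (rule INF_lower)
  also have "\<dots> = (\<integral>\<^sup>+x. ennreal ((S x - T x)\<^sup>2) \<partial>\<mu>)"
    by (subst nn_integral_distr[OF ST]) auto
  finally show ?thesis .
qed

lemma add_measure_dmeas:
  assumes [measurable]: "f \<in> borel_measurable borel" "g \<in> borel_measurable borel"
    and "\<And>x. x \<in> {a<..<b} \<Longrightarrow> 0 \<le> f x \<and> 0 \<le> g x"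
  shows "add_measure (dmeas a b f) (dmeas a b g) = dmeas a b (\<lambda>x. f x + g x)"
proof (rule measure_eqI)
  fix A assume "A \<in> sets (add_measure (dmeas a b f) (dmeas a b g))"
  then have A [measurable]: "A \<in> sets borel" by simp
  have "emeasure (dmeas a b f) A + emeasure (dmeas a b g) A =
     (\<integral>\<^sup>+x. ennreal (f x) * indicator ({a<..<b} \<inter> A) x + ennreal (g x) * indicator ({a<..<b} \<inter> A) x \<partial>lborel)"
    by (subst nn_integral_add) (auto simp: emeasure_dmeas)
  also have "\<dots> = emeasure (dmeas a b (\<lambda>x. f x + g x)) A"
    using assms(3) by (subst emeasure_dmeas) (auto intro!: nn_integral_cong split: split_indicator)
  finally show "emeasure (add_measure (dmeas a b f) (dmeas a b g)) A = emeasure (dmeas a b (\<lambda>x. f x + g x)) A"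
    by (subst emeasure_add_measure) auto
qed simp

lemma distr_add_measure:
  assumes "sets N = sets M" "f \<in> measurable M K"
  shows "distr (add_measure M N) K f = add_measure (distr M K f) (distr N K f)"
proof (rule measure_eqI)
  fix A assume "A \<in> sets (distr (add_measure M N) K f)"
  then have A: "A \<in> sets K" by simp
  have f: "f \<in> measurable N K" "f \<in> measurable (add_measure M N) K"
    using assms by (auto simp: measurable_cong_sets[OF assms(1) refl] measurable_cong_sets[OF sets_add_measure refl])
  have sN: "space N = space M" using assms(1) by (rule sets_eq_imp_space_eq)
  show "emeasure (distr (add_measure M N) K f) A = emeasure (add_measure (distr M K f) (distr N K f)) A"
    using A f assms sN measurable_sets[OF assms(2) A]
    by (simp add: emeasure_distr emeasure_add_measure)
qed simp

lemma W2sq_add_le: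
  assumes "\<And>\<gamma>1 \<gamma>2. \<gamma>1 \<in> couplings \<mu>1 \<nu>1 \<Longrightarrow> \<gamma>2 \<in> couplings \<mu>2 \<nu>2 \<Longrightarrow>
      sets \<gamma>1 = sets (lborel \<Otimes>\<^sub>M lborel) \<Longrightarrow> sets \<gamma>2 = sets (lborel \<Otimes>\<^sub>M lborel) \<Longrightarrow>
      add_measure \<gamma>1 \<gamma>2 \<in> couplings \<mu> \<nu>"
  shows "W2sq \<mu> \<nu> \<le> W2sq \<mu>1 \<nu>1 + W2sq \<mu>2 \<nu>2"
proof (rule ennreal_le_epsilon)
  let ?c = "\<lambda>z. ennreal ((fst z - snd z)\<^sup>2) :: ennreal"
  fix e :: real assume fin: "W2sq \<mu>1 \<nu>1 + W2sq \<mu>2 \<nu>2 < top" and e: "0 < e"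
  have near: "\<exists>\<gamma>\<in>couplings \<mu> \<nu>. (\<integral>\<^sup>+z. ?c z \<partial>\<gamma>) < W2sq \<mu> \<nu> + ennreal (e / 2)"
    if "W2sq \<mu> \<nu> < top" for \<mu> \<nu>
  proof -
    have "W2sq \<mu> \<nu> < W2sq \<mu> \<nu> + ennreal (e / 2)"
      using that e by (simp add: ennreal_add_left_cancel_less[of _ 0, simplified])
    then show ?thesis unfolding W2sq_def INF_less_iff by blast
  qed
  have "W2sq \<mu>1 \<nu>1 < top" "W2sq \<mu>2 \<nu>2 < top" using fin by (auto simp: less_top)
  then obtain \<gamma>1 \<gamma>2 where 1: "\<gamma>1 \<in> couplings \<mu>1 \<nu>1" "(\<integral>\<^sup>+z. ?c z \<partial>\<gamma>1) < W2sq \<mu>1 \<nu>1 + ennreal (e / 2)"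
    and 2: "\<gamma>2 \<in> couplings \<mu>2 \<nu>2" "(\<integral>\<^sup>+z. ?c z \<partial>\<gamma>2) < W2sq \<mu>2 \<nu>2 + ennreal (e / 2)"
    using near by meson
  have sets: "sets \<gamma>1 = sets (lborel \<Otimes>\<^sub>M lborel)" "sets \<gamma>2 = sets (lborel \<Otimes>\<^sub>M lborel)"
    using 1 2 by (auto simp: couplings_def)
  have "?c \<in> borel_measurable (lborel \<Otimes>\<^sub>M lborel)" by measurable
  then have c: "?c \<in> borel_measurable \<gamma>1" using sets(1) measurable_cong_sets by blast
  have "W2sq \<mu> \<nu> \<le> (\<integral>\<^sup>+z. ?c z \<partial>add_measure \<gamma>1 \<gamma>2)"
    unfolding W2sq_def by (rule INF_lower) (rule assms[OF 1(1) 2(1) sets])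
  also have "\<dots> = (\<integral>\<^sup>+z. ?c z \<partial>\<gamma>1) + (\<integral>\<^sup>+z. ?c z \<partial>\<gamma>2)"
    using sets c by (intro nn_integral_add_measure) auto
  also have "\<dots> \<le> (W2sq \<mu>1 \<nu>1 + ennreal (e / 2)) + (W2sq \<mu>2 \<nu>2 + ennreal (e / 2))"
    using 1 2 by (intro add_mono) auto
  also have "\<dots> = W2sq \<mu>1 \<nu>1 + W2sq \<mu>2 \<nu>2 + (ennreal (e / 2) + ennreal (e / 2))" by (simp add: ac_simps)
  also have "ennreal (e / 2) + ennreal (e / 2) = ennreal e"
    using e by (subst ennreal_plus[symmetric]) auto
  finally show "W2sq \<mu> \<nu> \<le> W2sq \<mu>1 \<nu>1 + W2sq \<mu>2 \<nu>2 + ennreal e" .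
qed

lemma W2sq_dmeas_add_le:
  assumes [measurable]: "f1 \<in> borel_measurable borel" "f2 \<in> borel_measurable borel"
      "g1 \<in> borel_measurable borel" "g2 \<in> borel_measurable borel"
    and f: "\<And>x. x \<in> {a<..<b} \<Longrightarrow> 0 \<le> f1 x \<and> 0 \<le> f2 x"
    and g: "\<And>x. x \<in> {a<..<b} \<Longrightarrow> 0 \<le> g1 x \<and> 0 \<le> g2 x"
  shows "W2sq (dmeas a b (\<lambda>x. f1 x + f2 x)) (dmeas a b (\<lambda>x. g1 x + g2 x))
      \<le> W2sq (dmeas a b f1) (dmeas a b g1) + W2sq (dmeas a b f2) (dmeas a b g2)"
proof (rule W2sq_add_le)
  fix \<gamma>1 \<gamma>2 assume c: "\<gamma>1 \<in> couplings (dmeas a b f1) (dmeas a b g1)"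
    "\<gamma>2 \<in> couplings (dmeas a b f2) (dmeas a b g2)"
    and sets: "sets \<gamma>1 = sets (lborel \<Otimes>\<^sub>M lborel)" "sets \<gamma>2 = sets (lborel \<Otimes>\<^sub>M lborel)"
  have m: "fst \<in> measurable \<gamma>1 lborel" "snd \<in> measurable \<gamma>1 lborel"
    unfolding measurable_cong_sets[OF sets(1) refl] by measurable
  have s12: "sets \<gamma>2 = sets \<gamma>1" using sets by simp
  show "add_measure \<gamma>1 \<gamma>2 \<in> couplings (dmeas a b (\<lambda>x. f1 x + f2 x)) (dmeas a b (\<lambda>x. g1 x + g2 x))"
    using c sets m add_measure_dmeas[OF assms(1,2) f] add_measure_dmeas[OF assms(3,4) g]
    by (simp add: couplings_def distr_add_measure[OF s12])
qed

lemma W2sq_dmeas_finite: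
  assumes [measurable]: "f \<in> borel_measurable borel" "g \<in> borel_measurable borel"
    and mass: "emeasure (dmeas a b f) UNIV = ennreal m" "emeasure (dmeas a b g) UNIV = ennreal m"
  shows "W2sq (dmeas a b f) (dmeas a b g) < \<infinity>"
proof -
  define \<mu> where "\<mu> = dmeas a b f"
  define \<nu> where "\<nu> = dmeas a b g"
  have sets [measurable_cong]: "sets \<mu> = sets lborel" "sets \<nu> = sets lborel" by (auto simp: \<mu>_def \<nu>_def)
  have sp: "space \<mu> = UNIV" "space \<nu> = UNIV" by (auto simp: \<mu>_def \<nu>_def)
  have "finite_measure \<mu>" "finite_measure \<nu>"
    using mass by (auto intro!: finite_measureI simp: \<mu>_def \<nu>_def)
  then interpret \<mu>: finite_measure \<mu> + \<nu>: finite_measure \<nu> by auto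
  interpret pair_sigma_finite \<mu> \<nu> ..
  define c :: ennreal where "c = inverse (ennreal m)"
  define \<gamma> where "\<gamma> = scale_measure c (\<mu> \<Otimes>\<^sub>M \<nu>)"
  have sg: "sets \<gamma> = sets (lborel \<Otimes>\<^sub>M lborel)" unfolding \<gamma>_def by (simp add: sets cong: sets_pair_measure_cong)
  have sp\<gamma>: "space \<gamma> = UNIV" using sets_eq_imp_space_eq[OF sg] by (simp add: space_pair_measure)
  have c: "c * (u * ennreal m) = u" if "u \<le> ennreal m" for u
  proof (cases "ennreal m = 0")
    case False
    then have "ennreal m * c = 1" unfolding c_def by (simp add: ennreal_inverse_mult ennreal_divide_self flip: divide_ennreal_def)
    then show ?thesis by (metis mult.assoc mult.commute mult.right_neutral)
  qed (use that in simp)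
  have le: "emeasure \<mu> A \<le> ennreal m" "emeasure \<nu> A \<le> ennreal m" for A
    using emeasure_space[of \<mu> A] emeasure_space[of \<nu> A] mass sp by (auto simp: \<mu>_def \<nu>_def)
  have m1: "distr \<gamma> lborel fst = \<mu>"
  proof (rule measure_eqI)
    fix A assume "A \<in> sets (distr \<gamma> lborel fst)"
    then have A: "A \<in> sets borel" by simp
    have "fst -` A = A \<times> (UNIV :: real set)" by auto
    then have "emeasure (\<mu> \<Otimes>\<^sub>M \<nu>) (fst -` A) = emeasure \<mu> A * ennreal m"
      using A \<nu>.emeasure_pair_measure_Times[of A \<mu> UNIV] mass by (simp add: sets \<nu>_def)
    moreover have "fst \<in> measurable \<gamma> lborel" unfolding measurable_cong_sets[OF sg refl] by measurable
    ultimately show "emeasure (distr \<gamma> lborel fst) A = emeasure \<mu> A"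
      using A le c by (simp add: emeasure_distr sp\<gamma>) (simp add: \<gamma>_def)
  qed (simp add: sets)
  have m2: "distr \<gamma> lborel snd = \<nu>"
  proof (rule measure_eqI)
    fix A assume "A \<in> sets (distr \<gamma> lborel snd)"
    then have A: "A \<in> sets borel" by simp
    have "snd -` A = (UNIV :: real set) \<times> A" by auto
    then have "emeasure (\<mu> \<Otimes>\<^sub>M \<nu>) (snd -` A) = emeasure \<nu> A * ennreal m"
      using A \<nu>.emeasure_pair_measure_Times[of UNIV \<mu> A] mass by (simp add: sets \<mu>_def mult.commute)
    moreover have "snd \<in> measurable \<gamma> lborel" unfolding measurable_cong_sets[OF sg refl] by measurable
    ultimately show "emeasure (distr \<gamma> lborel snd) A = emeasure \<nu> A"
      using A le c by (simp add: emeasure_distr sp\<gamma>) (simp add: \<gamma>_def)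
  qed (simp add: sets)
  have fst_m: "fst \<in> measurable \<gamma> lborel" "snd \<in> measurable \<gamma> lborel"
    unfolding measurable_cong_sets[OF sg refl] by measurable
  have supp: "AE x in dmeas a b h. x \<in> {a<..<b}" if [measurable]: "h \<in> borel_measurable borel" for h
    unfolding dmeas_def by (subst AE_density) (auto split: split_indicator)
  have "AE x in distr \<gamma> lborel fst. x \<in> {a<..<b}" "AE x in distr \<gamma> lborel snd. x \<in> {a<..<b}"
    unfolding m1 m2 \<mu>_def \<nu>_def by (rule supp; fact)+
  from AE_distrD[OF fst_m(1) this(1)] AE_distrD[OF fst_m(2) this(2)]
  have ae: "AE z in \<gamma>. ennreal ((fst z - snd z)\<^sup>2) \<le> ennreal ((b - a)\<^sup>2)"
  proof eventually_elim
    case (elim z)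
    then have "\<bar>fst z - snd z\<bar> \<le> \<bar>b - a\<bar>" by auto
    then show ?case by (intro ennreal_leI) (simp add: abs_le_square_iff)
  qed
  have "\<gamma> \<in> couplings \<mu> \<nu>" using sg m1 m2 by (simp add: couplings_def)
  then have "W2sq \<mu> \<nu> \<le> (\<integral>\<^sup>+ z. ennreal ((fst z - snd z)\<^sup>2) \<partial>\<gamma>)"
    unfolding W2sq_def by (rule INF_lower)
  also have "\<dots> \<le> (\<integral>\<^sup>+ z. ennreal ((b - a)\<^sup>2) \<partial>\<gamma>)" by (rule nn_integral_mono_AE[OF ae])
  also have "\<dots> = ennreal ((b - a)\<^sup>2) * emeasure \<gamma> (space \<gamma>)" by simp
  also have "emeasure \<gamma> (space \<gamma>) = emeasure (distr \<gamma> lborel fst) UNIV"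
    using fst_m by (simp add: emeasure_distr)
  also have "\<dots> = ennreal m" using m1 mass by (simp add: \<mu>_def)
  finally show ?thesis unfolding \<mu>_def \<nu>_def by (auto simp: ennreal_mult[symmetric] elim!: order.strict_trans1
        simp: ennreal_mult_less_top)
qed

section \<open>The pressure of an internal energy\<close>

text \<open>At \<open>h = 0\<close> the unspecified value \<open>deriv chi 0\<close> is multiplied by zero.\<close>

definition pressure :: "(real \<Rightarrow> real) \<Rightarrow> real \<Rightarrow> real" where
  "pressure chi h = h * deriv chi h - chi h"

context
  fixes chi :: "real \<Rightarrow> real"
  assumes chi: "internal_energy chi"
begin

lemma energy_DERIV: "0 < h \<Longrightarrow> (chi has_real_derivative deriv chi h) (at h)"
  using chi unfolding internal_energy_def by (simp add: DERIV_deriv_iff_real_differentiable)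

lemma energy_deriv_strict_mono:
  assumes "0 < u" "u < v"
  shows "deriv chi u < deriv chi v"
proof (rule DERIV_pos_imp_increasing[OF assms(2)])
  fix x assume "u \<le> x" "x \<le> v"
  then have "0 < x" using assms by simp
  then show "\<exists>y. (deriv chi has_real_derivative y) (at x) \<and> 0 < y"
    using chi unfolding internal_energy_def
    by (intro exI[of _ "deriv (deriv chi) x"]) (simp add: DERIV_deriv_iff_real_differentiable)
qed

lemma energy_continuous_on: "continuous_on {0..} chi"
  using chi unfolding internal_energy_def by simp

lemma energy_mvt:
  assumes "0 \<le> u" "u < v"
  obtains z where "u < z" "z < v" "chi v - chi u = (v - u) * deriv chi z"
proof -
  have "\<exists>l z. u < z \<and> z < v \<and> (chi has_real_derivative l) (at z) \<and> chi v - chi u = (v - u) * l"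
  proof (rule MVT[OF assms(2)])
    show "continuous_on {u..v} chi"
      by (rule continuous_on_subset[OF energy_continuous_on]) (use assms in auto)
    show "chi differentiable (at x)" if "u < x" "x < v" for x
      using energy_DERIV[of x] that assms unfolding real_differentiable_def by auto
  qed
  then obtain l z where z: "u < z" "z < v" "(chi has_real_derivative l) (at z)" "chi v - chi u = (v - u) * l"
    by blast
  then have "l = deriv chi z" by (metis DERIV_imp_deriv)
  then show ?thesis using that z by blast
qed

lemma energy_tangent:
  assumes "0 < h'" "0 \<le> h"
  shows "chi h' + deriv chi h' * (h - h') \<le> chi h"
proof -
  consider "h = h'" | "h < h'" | "h' < h" by linarith
  then show ?thesis
  proof cases
    case 2
    obtain z where z: "h < z" "z < h'" "chi h' - chi h = (h' - h) * deriv chi z"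
      using energy_mvt[OF assms(2) 2] by blast
    have "(h' - h) * deriv chi z \<le> (h' - h) * deriv chi h'"
      using energy_deriv_strict_mono[of z h'] z 2 assms by (intro mult_left_mono) auto
    then show ?thesis using z(3) by (simp add: algebra_simps)
  next
    case 3
    obtain z where z: "h' < z" "z < h" "chi h - chi h' = (h - h') * deriv chi z"
      using energy_mvt[of h' h] assms 3 by auto
    have "(h - h') * deriv chi h' \<le> (h - h') * deriv chi z"
      using energy_deriv_strict_mono[of h' z] z 3 assms by (intro mult_left_mono) auto
    then show ?thesis using z(3) by (simp add: algebra_simps)
  qed simp
qed

lemma pressure_strict_mono:
  assumes "0 \<le> u" "u < v"
  shows "pressure chi u < pressure chi v"
proof -
  obtain z where z: "u < z" "z < v" "chi v - chi u = (v - u) * deriv chi z"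
    using energy_mvt[OF assms] by blast
  have "pressure chi v - pressure chi u
      = (v - u) * (deriv chi v - deriv chi z) + u * (deriv chi v - deriv chi u)"
    using z(3) by (simp add: pressure_def algebra_simps)
  moreover have "0 < (v - u) * (deriv chi v - deriv chi z)"
    using energy_deriv_strict_mono[of z v] z assms by simp
  moreover have "0 \<le> u * (deriv chi v - deriv chi u)"
    using energy_deriv_strict_mono[of u v] assms by (cases "u = 0") auto
  ultimately show ?thesis by linarith
qed

lemma pressure_le_iff: "0 \<le> u \<Longrightarrow> 0 \<le> v \<Longrightarrow> pressure chi u \<le> pressure chi v \<longleftrightarrow> u \<le> v"
  using pressure_strict_mono[of u v] pressure_strict_mono[of v u] by (cases u v rule: linorder_cases) auto

lemma pressure_continuous_on: "continuous_on {0..} (pressure chi)"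
  unfolding continuous_on_def
proof
  fix h :: real assume h: "h \<in> {0..}"
  have c: "(chi \<longlongrightarrow> chi h) (at h within {0..})"
    using energy_continuous_on h by (auto simp: continuous_on_def)
  have "((\<lambda>x. x * deriv chi x) \<longlongrightarrow> h * deriv chi h) (at h within {0..})"
  proof (cases "h = 0")
    case True
    have "(deriv chi \<longlongrightarrow> 0) (at_right 0)" using chi unfolding internal_energy_def by simp
    then have "((\<lambda>x. x * deriv chi x) \<longlongrightarrow> 0 * 0) (at_right 0)" by (intro tendsto_mult) auto
    moreover have "at 0 within {0..} = at_right (0::real)"
      by (rule at_within_Ici_at_right)
    ultimately show ?thesis using True by simp
  next
    case False
    then have "isCont (deriv chi) h"
      using chi h unfolding internal_energy_def
      by (intro differentiable_imp_continuous_within) auto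
    then have "(deriv chi \<longlongrightarrow> deriv chi h) (at h within {0..})"
      unfolding isCont_def by (rule tendsto_within_subset) simp
    then show ?thesis by (intro tendsto_mult) auto
  qed
  then show "(pressure chi \<longlongrightarrow> pressure chi h) (at h within {0..})"
    unfolding pressure_def using c by (rule tendsto_diff)
qed

lemma perspective_le:
  assumes "0 < l" "0 \<le> h"
  shows "l * chi (h / l) - chi h \<le> - (l - 1) * pressure chi (h / l)"
proof (cases "h = 0")
  case True
  then show ?thesis by (simp add: pressure_def algebra_simps)
next
  case False
  define h' where "h' = h / l"
  have h': "0 < h'" "h = l * h'" using False assms by (auto simp: h'_def)
  have "chi h' + deriv chi h' * (h - h') \<le> chi h" using energy_tangent[OF h'(1) assms(2)] .
  then show ?thesis unfolding h'_def[symmetric] using h'(2)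
    by (simp add: pressure_def algebra_simps)
qed

end

section \<open>Flows of bounded divergence on an interval\<close>

locale interval_flow =
  fixes a b :: real and g :: "real \<Rightarrow> real" and e :: real
  assumes ab: "a < b" and g_meas [measurable]: "g \<in> borel_measurable borel"
    and g_bound: "\<And>x. \<bar>g x\<bar> \<le> 1" and g_supp: "\<And>x. x \<notin> {a<..<b} \<Longrightarrow> g x = 0"
    and g_mean: "(LINT x|lborel. g x) = 0" and e: "0 < e" "e < 1"
begin

definition xi :: "real \<Rightarrow> real" where "xi x = (LINT t:{..x}|lborel. g t)"
definition lam :: "real \<Rightarrow> real" where "lam x = 1 + e * g x"
definition S :: "real \<Rightarrow> real" where "S x = x + e * xi x"
definition R :: "real \<Rightarrow> real" where "R = inv S"

lemma g_integrable: "integrable lborel g"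
proof (rule Bochner_Integration.integrable_bound)
  show "integrable lborel (indicator {a..b} :: real \<Rightarrow> real)" using ab by (simp add: integrable_indicator_iff)
  show "AE x in lborel. norm (g x) \<le> norm (indicator {a..b} x :: real)"
    using g_bound g_supp by (intro AE_I2) (auto split: split_indicator)
qed simp

lemma g_set_integrable: "A \<in> sets borel \<Longrightarrow> set_integrable lborel A g"
  unfolding set_integrable_def using g_integrable by (intro integrable_mult_indicator) auto

lemma xi_diff: "x \<le> y \<Longrightarrow> xi y - xi x = (LINT t:{x<..y}|lborel. g t)"
proof -
  assume "x \<le> y"
  then have "{..y} = {..x} \<union> {x<..y}" by auto
  then show ?thesis
    unfolding xi_def using set_integral_Un[of "{..x}" "{x<..y}" lborel g] g_set_integrable
    by (auto simp: disjoint_iff)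
qed

lemma abs_xi_diff: "x \<le> y \<Longrightarrow> \<bar>xi y - xi x\<bar> \<le> y - x"
proof -
  assume xy: "x \<le> y"
  have "\<bar>LINT t:{x<..y}|lborel. g t\<bar> \<le> (LINT t:{x<..y}|lborel. \<bar>g t\<bar>)"
    using set_integral_norm_bound[OF g_set_integrable, of "{x<..y}"] by simp
  also have "\<dots> \<le> (LINT t:{x<..y}|lborel. 1)"
  proof (rule set_integral_mono)
    show "set_integrable lborel {x<..y} (\<lambda>t. \<bar>g t\<bar>)"
      using g_set_integrable by (intro set_integrable_abs) auto
    show "set_integrable lborel {x<..y} (\<lambda>t. 1 :: real)"
      using xy by (simp add: set_integrable_def integrable_indicator_iff)
  qed (rule g_bound)
  also have "\<dots> = y - x" using xy by (simp add: set_lebesgue_integral_def)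
  finally show ?thesis using xi_diff[OF xy] by simp
qed

lemma xi_outside: "x \<notin> {a<..<b} \<Longrightarrow> xi x = 0"
proof -
  assume x: "x \<notin> {a<..<b}"
  have "(\<lambda>t. indicator {..x} t *\<^sub>R g t) = (if x \<le> a then (\<lambda>t. 0) else g)"
    using x g_supp by (auto simp: fun_eq_iff split: split_indicator)
  then show ?thesis unfolding xi_def set_lebesgue_integral_def using g_mean by (auto split: if_splits)
qed

lemma abs_xi_le: "\<bar>xi x\<bar> \<le> b - a"
proof (cases "x \<in> {a<..<b}")
  case True
  then show ?thesis using abs_xi_diff[of a x] xi_outside[of a] by auto
qed (use xi_outside ab in auto)

lemma S_diff:
  assumes "x \<le> y"
  shows "(1 - e) * (y - x) \<le> S y - S x" "S y - S x \<le> 2 * (y - x)"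
proof -
  have "e * \<bar>xi y - xi x\<bar> \<le> e * (y - x)" using abs_xi_diff[OF assms] e by (intro mult_left_mono) auto
  moreover have "\<bar>e * (xi y - xi x)\<bar> = e * \<bar>xi y - xi x\<bar>" using e by (simp add: abs_mult)
  moreover have "e * (y - x) \<le> 1 * (y - x)" using e assms by (intro mult_right_mono) auto
  moreover have "S y - S x = (y - x) + e * (xi y - xi x)" by (simp add: S_def algebra_simps)
  ultimately show "(1 - e) * (y - x) \<le> S y - S x" "S y - S x \<le> 2 * (y - x)"
    by (auto simp: algebra_simps)
qed

lemma S_strict_mono: "strict_mono S"
proof (rule strict_monoI)
  fix x y :: real assume "x < y"
  then have "0 < (1 - e) * (y - x)" using e by simp
  then show "S x < S y" using S_diff(1)[of x y] \<open>x < y\<close> by linarith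
qed

lemma S_outside: "x \<notin> {a<..<b} \<Longrightarrow> S x = x"
  using xi_outside by (simp add: S_def)

lemma S_mem_iff: "S x \<in> {a<..<b} \<longleftrightarrow> x \<in> {a<..<b}"
  using S_outside[of a] S_outside[of b] strict_mono_less[OF S_strict_mono, of a x]
    strict_mono_less[OF S_strict_mono, of x b] by auto

lemma S_continuous_on: "continuous_on A S"
proof -
  have "2-lipschitz_on UNIV S"
  proof (rule lipschitz_onI)
    show "dist (S x) (S y) \<le> 2 * dist x y" for x y
    proof (cases "x \<le> y")
      case True
      have "S x \<le> S y" using True S_strict_mono by (simp add: strict_mono_less_eq)
      then show ?thesis using S_diff(2)[OF True] True by (simp add: dist_real_def)
    next
      case False
      then have "S y \<le> S x" using S_strict_mono by (simp add: strict_mono_less_eq)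
      then show ?thesis using S_diff(2)[of y x] False by (simp add: dist_real_def)
    qed
  qed simp
  then show ?thesis using lipschitz_on_continuous_on continuous_on_subset by blast
qed

lemma S_surj: "\<exists>x. S x = y"
proof (cases "y \<in> {a<..<b}")
  case True
  have "\<exists>x\<ge>a. x \<le> b \<and> S x = y"
    by (rule IVT') (use True ab S_outside[of a] S_outside[of b] S_continuous_on in auto)
  then show ?thesis by blast
qed (use S_outside in blast)

lemma S_R [simp]: "S (R y) = y"
  unfolding R_def using S_surj[of y] by (metis f_inv_into_f rangeI)

lemma R_S [simp]: "R (S x) = x"
  unfolding R_def using strict_mono_imp_inj_on[OF S_strict_mono] by (rule inv_f_f)

lemma R_mono: "mono R"
  by (rule monoI) (metis S_R S_strict_mono strict_mono_less_eq)

lemma S_measurable [measurable]: "S \<in> borel_measurable borel"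
  using S_continuous_on by (rule borel_measurable_continuous_onI)

lemma R_measurable [measurable]: "R \<in> borel_measurable borel"
  using R_mono by (rule borel_measurable_mono)

lemma lam_measurable [measurable]: "lam \<in> borel_measurable borel"
  unfolding lam_def by measurable

lemma lam_bounds: "1 - e \<le> lam x" "lam x \<le> 2"
proof -
  have "\<bar>e * g x\<bar> \<le> e * 1" unfolding abs_mult using e g_bound[of x] by (intro mult_mono) auto
  then show "1 - e \<le> lam x" "lam x \<le> 2" unfolding lam_def using e by linarith+
qed

lemma lam_pos: "0 < lam x"
  using lam_bounds(1)[of x] e by simp

lemma distr_S: "distr (density lborel (\<lambda>x. ennreal (lam x))) lborel S = lborel"
proof (rule lborel_eqI[symmetric])
  fix l u :: real assume lu: "\<And>b. b \<in> Basis \<Longrightarrow> l \<bullet> b \<le> u \<bullet> b"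
  then have "l \<le> u" by simp
  define l' u' where "l' = R l" and "u' = R u"
  have l'u': "l' \<le> u'" using R_mono \<open>l \<le> u\<close> by (simp add: l'_def u'_def monoD)
  have vim: "S -` {l<..<u} = {l'<..<u'}"
    using strict_mono_less[OF S_strict_mono, of l'] strict_mono_less[OF S_strict_mono, of _ u']
    by (auto simp: l'_def u'_def)
  have si: "set_integrable lborel {l'<..<u'} lam"
    unfolding lam_def using g_set_integrable[of "{l'<..<u'}"]
    by (intro set_integral_add set_integrable_mult_right)
       (auto simp: set_integrable_def integrable_indicator_iff emeasure_lborel_Ioo l'u')
  have "emeasure (distr (density lborel (\<lambda>x. ennreal (lam x))) lborel S) (box l u)
      = (\<integral>\<^sup>+x. ennreal (lam x) * indicator {l'<..<u'} x \<partial>lborel)"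
    by (simp add: emeasure_distr emeasure_density vim)
  also have "\<dots> = (\<integral>\<^sup>+x. ennreal (indicator {l'<..<u'} x *\<^sub>R lam x) \<partial>lborel)"
    by (intro nn_integral_cong) (auto split: split_indicator)
  also have "\<dots> = ennreal (LINT x:{l'<..<u'}|lborel. lam x)"
    unfolding set_lebesgue_integral_def using si lam_pos
    by (intro nn_integral_eq_integral) (auto simp: set_integrable_def less_imp_le)
  also have "(LINT x:{l'<..<u'}|lborel. lam x) = (LINT x:{l'<..<u'}|lborel. 1) + (LINT x:{l'<..<u'}|lborel. e * g x)"
    unfolding lam_def using g_set_integrable[of "{l'<..<u'}"]
    by (intro set_integral_add set_integrable_mult_right)
       (auto simp: set_integrable_def integrable_indicator_iff emeasure_lborel_Ioo l'u')
  also have "(LINT x:{l'<..<u'}|lborel. 1) = u' - l'"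
    using l'u' by (simp add: set_lebesgue_integral_def)
  also have "(LINT x:{l'<..<u'}|lborel. e * g x) = e * (xi u' - xi l')"
  proof -
    have "(LINT x:{l'<..<u'}|lborel. g x) = (LINT x:{l'<..u'}|lborel. g x)"
      unfolding set_lebesgue_integral_def
      by (rule integral_cong_AE) (use AE_lborel_singleton[of u'] in \<open>auto split: split_indicator elim!: eventually_mono\<close>)
    then show ?thesis using xi_diff[OF l'u'] by simp
  qed
  also have "(u' - l') + e * (xi u' - xi l') = S u' - S l'" by (simp add: S_def algebra_simps)
  also have "\<dots> = u - l" by (simp add: l'_def u'_def)
  finally show "emeasure (distr (density lborel (\<lambda>x. ennreal (lam x))) lborel S) (box l u) = (\<Prod>b\<in>Basis. (u - l) \<bullet> b)"
    by simp
qed simp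

end

section \<open>Competitors in the diffusion step\<close>

context interval_flow
begin

lemma distr_dmeas_S:
  assumes [measurable]: "u \<in> borel_measurable borel"
  shows "distr (dmeas a b u) lborel S = dmeas a b (\<lambda>y. u (R y) / lam (R y))"
proof -
  let ?U = "\<lambda>y. ennreal (u (R y) / lam (R y)) * indicator {a<..<b} y"
  have "dmeas a b (\<lambda>y. u (R y) / lam (R y)) = density (distr (density lborel (\<lambda>x. ennreal (lam x))) lborel S) ?U"
    unfolding distr_S dmeas_def ..
  also have "\<dots> = distr (density (density lborel (\<lambda>x. ennreal (lam x))) (\<lambda>x. ?U (S x))) lborel S"
    by (rule density_distr) auto
  also have "density (density lborel (\<lambda>x. ennreal (lam x))) (\<lambda>x. ?U (S x)) =
      density lborel (\<lambda>x. ennreal (lam x) * ?U (S x))"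
    by (rule density_density_eq) auto
  also have "(\<lambda>x. ennreal (lam x) * ?U (S x)) = (\<lambda>x. ennreal (u x) * indicator {a<..<b} x)"
  proof
    fix x
    have "ennreal (lam x) * ennreal (u x / lam x) = ennreal (u x)"
    proof (cases "0 \<le> u x")
      case True
      then show ?thesis using lam_pos[of x] by (simp flip: ennreal_mult)
    next
      case False
      then have "u x / lam x \<le> 0" using lam_pos[of x] by (simp add: divide_nonpos_pos)
      then show ?thesis using False by (simp add: ennreal_neg)
    qed
    then show "ennreal (lam x) * ?U (S x) = ennreal (u x) * indicator {a<..<b} x"
      using S_mem_iff[of x] by (auto split: split_indicator)
  qed
  finally show ?thesis unfolding dmeas_def by simp
qed

lemma
  assumes [measurable]: "H \<in> borel_measurable borel"
  shows set_integrable_R: "set_integrable lborel {a<..<b} (\<lambda>y. H (R y)) \<longleftrightarrow>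
      set_integrable lborel {a<..<b} (\<lambda>x. lam x * H x)"
    and set_integral_R: "(LINT y:{a<..<b}|lborel. H (R y)) = (LINT x:{a<..<b}|lborel. lam x * H x)"
proof -
  let ?f = "\<lambda>y. indicator {a<..<b} y *\<^sub>R H (R y)" and ?N = "density lborel (\<lambda>x. ennreal (lam x))"
  have eq: "lam x *\<^sub>R ?f (S x) = indicator {a<..<b} x *\<^sub>R (lam x * H x)" for x
    using S_mem_iff[of x] by (auto split: split_indicator)
  have "integrable lborel ?f \<longleftrightarrow> integrable (distr ?N lborel S) ?f" by (simp add: distr_S)
  also have "\<dots> \<longleftrightarrow> integrable ?N (\<lambda>x. ?f (S x))" by (rule integrable_distr_eq) auto
  also have "\<dots> \<longleftrightarrow> integrable lborel (\<lambda>x. lam x *\<^sub>R ?f (S x))"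
    using lam_pos by (intro integrable_density) (auto simp: less_imp_le)
  finally show "set_integrable lborel {a<..<b} (\<lambda>y. H (R y)) \<longleftrightarrow>
      set_integrable lborel {a<..<b} (\<lambda>x. lam x * H x)"
    unfolding set_integrable_def eq .
  have "integral\<^sup>L lborel ?f = integral\<^sup>L (distr ?N lborel S) ?f" by (simp add: distr_S)
  also have "\<dots> = integral\<^sup>L ?N (\<lambda>x. ?f (S x))" by (rule integral_distr) auto
  also have "\<dots> = integral\<^sup>L lborel (\<lambda>x. lam x *\<^sub>R ?f (S x))"
    using lam_pos by (intro integral_density) (auto simp: less_imp_le)
  finally show "(LINT y:{a<..<b}|lborel. H (R y)) = (LINT x:{a<..<b}|lborel. lam x * H x)"
    unfolding set_lebesgue_integral_def eq .
qed

end

lemma set_integrable_bounded_mult: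
  fixes f \<phi> :: "real \<Rightarrow> real"
  assumes f: "set_integrable lborel A f" and [measurable]: "f \<in> borel_measurable borel"
    "\<phi> \<in> borel_measurable borel" "A \<in> sets borel" and B: "\<And>x. x \<in> A \<Longrightarrow> \<bar>\<phi> x\<bar> \<le> B"
  shows "set_integrable lborel A (\<lambda>x. \<phi> x * f x)"
proof (rule set_integrable_bound[where f = "\<lambda>x. B * f x"])
  show "set_integrable lborel A (\<lambda>x. B * f x)" using f by simp
  show "set_borel_measurable lborel A (\<lambda>x. \<phi> x * f x)" unfolding set_borel_measurable_def by measurable
  show "AE x in lborel. x \<in> A \<longrightarrow> norm (\<phi> x * f x) \<le> norm (B * f x)"
  proof (intro AE_I2 impI)
    fix x assume "x \<in> A"
    then have "\<bar>\<phi> x\<bar> \<le> \<bar>B\<bar>" using B[of x] by simp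
    then show "norm (\<phi> x * f x) \<le> norm (B * f x)" by (simp add: abs_mult mult_right_mono)
  qed
qed

lemma set_integrable_bounded:
  fixes \<phi> :: "real \<Rightarrow> real"
  assumes [measurable]: "\<phi> \<in> borel_measurable borel" and B: "\<And>x. x \<in> {a<..<b} \<Longrightarrow> \<bar>\<phi> x\<bar> \<le> B" and "a \<le> b"
  shows "set_integrable lborel {a<..<b} \<phi>"
proof -
  have "set_integrable lborel {a<..<b} (\<lambda>x. 1 :: real)"
    using \<open>a \<le> b\<close> by (simp add: set_integrable_def integrable_indicator_iff)
  from set_integrable_bounded_mult[OF this, of \<phi> B] B show ?thesis by simp
qed

lemma nn_integral_dmeas_eq_set_integral:
  assumes [measurable]: "u \<in> borel_measurable borel" "\<phi> \<in> borel_measurable borel"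
    and u: "\<And>x. x \<in> {a<..<b} \<Longrightarrow> 0 \<le> u x" "set_integrable lborel {a<..<b} u"
    and \<phi>: "\<And>x. x \<in> {a<..<b} \<Longrightarrow> 0 \<le> \<phi> x \<and> \<phi> x \<le> B"
  shows "(\<integral>\<^sup>+x. ennreal (\<phi> x) \<partial>dmeas a b u) = ennreal (LINT x:{a<..<b}|lborel. \<phi> x * u x)"
proof -
  have "set_integrable lborel {a<..<b} (\<lambda>x. \<phi> x * u x)"
    using \<phi> by (intro set_integrable_bounded_mult[OF u(2), where B = B]) auto
  then have "(\<integral>\<^sup>+x. ennreal (indicator {a<..<b} x *\<^sub>R (\<phi> x * u x)) \<partial>lborel)
      = ennreal (LINT x:{a<..<b}|lborel. \<phi> x * u x)"
    unfolding set_integrable_def set_lebesgue_integral_def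
    using u(1) \<phi> by (intro nn_integral_eq_integral) (auto split: split_indicator)
  moreover have "(\<integral>\<^sup>+x. ennreal (\<phi> x) \<partial>dmeas a b u) = (\<integral>\<^sup>+x. ennreal (indicator {a<..<b} x *\<^sub>R (\<phi> x * u x)) \<partial>lborel)"
    using u(1) \<phi> by (subst nn_integral_dmeas)
      (auto intro!: nn_integral_cong simp: ennreal_mult' mult.commute split: split_indicator)
  ultimately show ?thesis by simp
qed

locale diffusion_step =
  fixes a b \<tau> M :: real and chi sh rh rho eta T :: "real \<Rightarrow> real"
  assumes ab: "a < b" and tau: "0 < \<tau>" and chi: "internal_energy chi"
    and sh_meas [measurable]: "sh \<in> borel_measurable borel"
    and rh_meas [measurable]: "rh \<in> borel_measurable borel"
    and sh_bounds: "\<And>x. x \<in> {a..b} \<Longrightarrow> 0 \<le> sh x \<and> sh x \<le> M"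
    and rh_bounds: "\<And>x. x \<in> {a..b} \<Longrightarrow> 0 \<le> rh x \<and> rh x \<le> 1"
    and adm: "admissible a b chi (LINT x:{a<..<b}|lborel. rh x * sh x)
          (LINT x:{a<..<b}|lborel. (1 - rh x) * sh x) rho eta"
    and minimal: "\<And>\<rho> \<eta>. admissible a b chi (LINT x:{a<..<b}|lborel. rh x * sh x)
          (LINT x:{a<..<b}|lborel. (1 - rh x) * sh x) \<rho> \<eta> \<Longrightarrow>
        jko a b chi \<tau> (\<lambda>x. rh x * sh x) (\<lambda>x. (1 - rh x) * sh x) rho eta
        \<le> jko a b chi \<tau> (\<lambda>x. rh x * sh x) (\<lambda>x. (1 - rh x) * sh x) \<rho> \<eta>"
    and T_meas [measurable]: "T \<in> borel_measurable borel"
    and T_mono: "mono_on {a..b} T" and T_image: "T ` {a..b} \<subseteq> {a..b}"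
    and push: "distr (dmeas a b (\<lambda>x. rho x + eta x)) lborel T = dmeas a b sh"
    and optimal: "(\<integral>\<^sup>+x. ennreal ((x - T x)\<^sup>2) \<partial>(dmeas a b (\<lambda>x. rho x + eta x)))
        = W2sq (dmeas a b (\<lambda>x. rho x + eta x)) (dmeas a b sh)"
begin

abbreviation "\<Omega> \<equiv> {a<..<b}"

definition s :: "real \<Rightarrow> real" where "s x = rho x + eta x"

text \<open>The energy density is unconstrained on negative arguments, so it need not be Borel there.\<close>

definition chi0 :: "real \<Rightarrow> real" where "chi0 h = chi (max 0 h)"

lemma rho_meas [measurable]: "rho \<in> borel_measurable borel"
  and eta_meas [measurable]: "eta \<in> borel_measurable borel"
  using adm by (auto simp: admissible_def)

lemma s_meas [measurable]: "s \<in> borel_measurable borel"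
  unfolding s_def by measurable

lemma chi0_meas [measurable]: "chi0 \<in> borel_measurable borel"
proof -
  have "continuous_on UNIV chi0"
    unfolding chi0_def
    by (rule continuous_on_compose2[OF energy_continuous_on[OF chi]]) (auto intro!: continuous_intros)
  then show ?thesis by (rule borel_measurable_continuous_onI)
qed

lemma T_mem: "x \<in> {a..b} \<Longrightarrow> T x \<in> {a..b}"
  using T_image by blast

lemma s_nonneg: "x \<in> \<Omega> \<Longrightarrow> 0 \<le> s x"
  using adm by (auto simp: admissible_def s_def)

lemma s_integrable: "set_integrable lborel \<Omega> s"
  unfolding s_def using adm by (intro set_integral_add) (auto simp: admissible_def)

lemma chi_s_integrable: "set_integrable lborel \<Omega> (\<lambda>x. chi (s x))"
  using adm by (auto simp: admissible_def s_def)

lemma sh_integrable: "set_integrable lborel \<Omega> sh"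
  using sh_bounds ab by (intro set_integrable_bounded[where B = M]) auto

lemma dmeas_s: "dmeas a b s = dmeas a b (\<lambda>x. rho x + eta x)"
  by (simp add: s_def[abs_def])

lemma half_mass: "emeasure (dmeas a b (\<lambda>x. c x * sh x)) UNIV = ennreal (LINT x:\<Omega>|lborel. c x * sh x)"
  if [measurable]: "c \<in> borel_measurable borel" and c: "\<And>x. x \<in> {a..b} \<Longrightarrow> 0 \<le> c x \<and> c x \<le> 1"
  for c
proof -
  have "set_integrable lborel \<Omega> (\<lambda>x. c x * sh x)"
    using c by (intro set_integrable_bounded_mult[OF sh_integrable, where B = 1]) auto
  from emeasure_dmeas_set_integral[OF _ _ _ this, of UNIV] show ?thesis
    using c sh_bounds by auto
qed

lemma transport_cost_le_species:
  "(LINT x:\<Omega>|lborel. (x - T x)\<^sup>2 * s x) \<le>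
    enn2real (W2sq (dmeas a b rho) (dmeas a b (\<lambda>x. rh x * sh x)))
    + enn2real (W2sq (dmeas a b eta) (dmeas a b (\<lambda>x. (1 - rh x) * sh x)))"
proof -
  let ?W1 = "W2sq (dmeas a b rho) (dmeas a b (\<lambda>x. rh x * sh x))"
  let ?W2 = "W2sq (dmeas a b eta) (dmeas a b (\<lambda>x. (1 - rh x) * sh x))"
  have fin: "?W1 < \<infinity>" "?W2 < \<infinity>"
  proof -
    have 1: "emeasure (dmeas a b rho) UNIV = ennreal (LINT x:\<Omega>|lborel. rh x * sh x)"
      using emeasure_dmeas_set_integral[of rho UNIV a b] adm by (auto simp: admissible_def)
    have 2: "emeasure (dmeas a b eta) UNIV = ennreal (LINT x:\<Omega>|lborel. (1 - rh x) * sh x)"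
      using emeasure_dmeas_set_integral[of eta UNIV a b] adm by (auto simp: admissible_def)
    show "?W1 < \<infinity>" by (rule W2sq_dmeas_finite[OF _ _ 1 half_mass]) (use rh_bounds in auto)
    show "?W2 < \<infinity>" by (rule W2sq_dmeas_finite[OF _ _ 2 half_mass]) (use rh_bounds in auto)
  qed
  have "ennreal (LINT x:\<Omega>|lborel. (x - T x)\<^sup>2 * s x) = (\<integral>\<^sup>+x. ennreal ((x - T x)\<^sup>2) \<partial>dmeas a b s)"
  proof (rule nn_integral_dmeas_eq_set_integral[symmetric])
    show "0 \<le> (x - T x)\<^sup>2 \<and> (x - T x)\<^sup>2 \<le> (b - a)\<^sup>2" if "x \<in> \<Omega>" for x
      using T_mem[of x] that by (auto simp flip: abs_le_square_iff)
  qed (use s_nonneg s_integrable in auto)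
  also have "\<dots> = W2sq (dmeas a b (\<lambda>x. rho x + eta x)) (dmeas a b (\<lambda>x. rh x * sh x + (1 - rh x) * sh x))"
    unfolding dmeas_s optimal by (simp add: algebra_simps)
  also have "\<dots> \<le> ?W1 + ?W2"
    using adm rh_bounds sh_bounds by (intro W2sq_dmeas_add_le) (auto simp: admissible_def)
  also have "\<dots> = ennreal (enn2real ?W1 + enn2real ?W2)"
    using fin by (simp add: ennreal_plus)
  finally show ?thesis by (subst (asm) ennreal_le_iff) auto
qed

lemma push_weighted:
  assumes [measurable]: "c \<in> borel_measurable borel" and c: "\<And>x. x \<in> {a..b} \<Longrightarrow> 0 \<le> c x"
  shows "distr (dmeas a b (\<lambda>x. c (T x) * s x)) lborel T = dmeas a b (\<lambda>x. c x * sh x)"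
proof -
  have 1: "dmeas a b (\<lambda>x. c x * sh x) = density (dmeas a b sh) (\<lambda>x. ennreal (c x))"
    unfolding dmeas_def using c sh_bounds
    by (subst density_density_eq) (auto intro!: density_cong simp: ennreal_mult' mult_ac split: split_indicator)
  have 2: "dmeas a b (\<lambda>x. c (T x) * s x) = density (dmeas a b s) (\<lambda>x. ennreal (c (T x)))"
    unfolding dmeas_def using c T_mem
    by (subst density_density_eq) (auto intro!: density_cong simp: ennreal_mult' mult_ac split: split_indicator)
  show ?thesis
    unfolding 1 2 push[symmetric] dmeas_s[symmetric] by (rule density_distr[symmetric]) auto
qed

lemma variation_inequality:
  assumes "interval_flow a b g e" and k: "\<And>x. g x \<noteq> 0 \<Longrightarrow> s x \<le> k"
  shows "(LINT x:\<Omega>|lborel. (x - T x)\<^sup>2 * s x) / (2 * \<tau>) + (LINT x:\<Omega>|lborel. chi (s x))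
    \<le> (LINT x:\<Omega>|lborel. (interval_flow.S g e x - T x)\<^sup>2 * s x) / (2 * \<tau>)
      + (LINT x:\<Omega>|lborel. interval_flow.lam g e x * chi (s x / interval_flow.lam g e x))"
    and "set_integrable lborel \<Omega> (\<lambda>x. interval_flow.lam g e x * chi (s x / interval_flow.lam g e x))"
proof -
  interpret F: interval_flow a b g e by fact
  define u1 where "u1 x = rh (T x) * s x" for x
  define u2 where "u2 x = (1 - rh (T x)) * s x" for x
  define \<rho>' where "\<rho>' y = u1 (F.R y) / F.lam (F.R y)" for y
  define \<eta>' where "\<eta>' y = u2 (F.R y) / F.lam (F.R y)" for y
  have [measurable]: "u1 \<in> borel_measurable borel" "u2 \<in> borel_measurable borel"
    unfolding u1_def u2_def by auto
  have [measurable]: "\<rho>' \<in> borel_measurable borel" "\<eta>' \<in> borel_measurable borel"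
    unfolding \<rho>'_def \<eta>'_def by auto
  have rT: "0 \<le> rh (T x) \<and> rh (T x) \<le> 1" if "x \<in> \<Omega>" for x
    using rh_bounds[of "T x"] T_mem[of x] that by auto
  have u_nonneg: "0 \<le> u1 x" "0 \<le> u2 x" if "x \<in> \<Omega>" for x
    using rT[OF that] s_nonneg[OF that] by (auto simp: u1_def u2_def)
  have u_int: "set_integrable lborel \<Omega> u1" "set_integrable lborel \<Omega> u2"
    unfolding u1_def u2_def using rT
    by (auto intro!: set_integrable_bounded_mult[OF s_integrable, where B = 1])
  have R_mem: "F.R y \<in> \<Omega>" if "y \<in> \<Omega>" for y
    using that F.S_mem_iff[of "F.R y"] by simp
  have sumeq: "\<rho>' y + \<eta>' y = s (F.R y) / F.lam (F.R y)" for y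
    by (simp add: \<rho>'_def \<eta>'_def u1_def u2_def algebra_simps flip: add_divide_distrib)
  have push1: "distr (dmeas a b u1) lborel T = dmeas a b (\<lambda>x. rh x * sh x)"
    unfolding u1_def using rh_bounds by (intro push_weighted) auto
  have push2: "distr (dmeas a b u2) lborel T = dmeas a b (\<lambda>x. (1 - rh x) * sh x)"
    unfolding u2_def using rh_bounds push_weighted[of "\<lambda>x. 1 - rh x"] by auto
  have S1: "distr (dmeas a b u1) lborel F.S = dmeas a b \<rho>'" unfolding \<rho>'_def by (rule F.distr_dmeas_S) simp
  have S2: "distr (dmeas a b u2) lborel F.S = dmeas a b \<eta>'" unfolding \<eta>'_def by (rule F.distr_dmeas_S) simp
  have S_mem: "F.S x \<in> \<Omega>" if "x \<in> \<Omega>" for x using that F.S_mem_iff by simp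
  have ST: "0 \<le> (F.S x - T x)\<^sup>2 \<and> (F.S x - T x)\<^sup>2 \<le> (b - a)\<^sup>2" if "x \<in> \<Omega>" for x
    using T_mem[of x] S_mem[OF that] that by (auto simp flip: abs_le_square_iff)
  have W1: "enn2real (W2sq (dmeas a b \<rho>') (dmeas a b (\<lambda>x. rh x * sh x)))
      \<le> (LINT x:\<Omega>|lborel. (F.S x - T x)\<^sup>2 * u1 x)"
  proof (rule enn2real_leI)
    show "0 \<le> (LINT x:\<Omega>|lborel. (F.S x - T x)\<^sup>2 * u1 x)"
      unfolding set_lebesgue_integral_def using u_nonneg by (intro integral_nonneg_AE) (auto split: split_indicator)
    have "W2sq (dmeas a b \<rho>') (dmeas a b (\<lambda>x. rh x * sh x)) \<le> (\<integral>\<^sup>+x. ennreal ((F.S x - T x)\<^sup>2) \<partial>dmeas a b u1)"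
      unfolding S1[symmetric] push1[symmetric] by (rule W2sq_le_map) auto
    also have "\<dots> = ennreal (LINT x:\<Omega>|lborel. (F.S x - T x)\<^sup>2 * u1 x)"
      using u_nonneg u_int ST by (intro nn_integral_dmeas_eq_set_integral) auto
    finally show "W2sq (dmeas a b \<rho>') (dmeas a b (\<lambda>x. rh x * sh x)) \<le> \<dots>" .
  qed
  have W2: "enn2real (W2sq (dmeas a b \<eta>') (dmeas a b (\<lambda>x. (1 - rh x) * sh x)))
      \<le> (LINT x:\<Omega>|lborel. (F.S x - T x)\<^sup>2 * u2 x)"
  proof (rule enn2real_leI)
    show "0 \<le> (LINT x:\<Omega>|lborel. (F.S x - T x)\<^sup>2 * u2 x)"
      unfolding set_lebesgue_integral_def using u_nonneg by (intro integral_nonneg_AE) (auto split: split_indicator)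
    have "W2sq (dmeas a b \<eta>') (dmeas a b (\<lambda>x. (1 - rh x) * sh x)) \<le> (\<integral>\<^sup>+x. ennreal ((F.S x - T x)\<^sup>2) \<partial>dmeas a b u2)"
      unfolding S2[symmetric] push2[symmetric] by (rule W2sq_le_map) auto
    also have "\<dots> = ennreal (LINT x:\<Omega>|lborel. (F.S x - T x)\<^sup>2 * u2 x)"
      using u_nonneg u_int ST by (intro nn_integral_dmeas_eq_set_integral) auto
    finally show "W2sq (dmeas a b \<eta>') (dmeas a b (\<lambda>x. (1 - rh x) * sh x)) \<le> \<dots>" .
  qed
  have "(LINT x:\<Omega>|lborel. (F.S x - T x)\<^sup>2 * u1 x) + (LINT x:\<Omega>|lborel. (F.S x - T x)\<^sup>2 * u2 x)
      = (LINT x:\<Omega>|lborel. (F.S x - T x)\<^sup>2 * u1 x + (F.S x - T x)\<^sup>2 * u2 x)"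
    using ST by (intro set_integral_add(2)[symmetric] set_integrable_bounded_mult[where B = "(b - a)\<^sup>2"] u_int) auto
  also have "\<dots> = (LINT x:\<Omega>|lborel. (F.S x - T x)\<^sup>2 * s x)"
    by (simp add: u1_def u2_def algebra_simps)
  finally have W12: "enn2real (W2sq (dmeas a b \<rho>') (dmeas a b (\<lambda>x. rh x * sh x)))
      + enn2real (W2sq (dmeas a b \<eta>') (dmeas a b (\<lambda>x. (1 - rh x) * sh x)))
      \<le> (LINT x:\<Omega>|lborel. (F.S x - T x)\<^sup>2 * s x)"
    using W1 W2 by linarith
  have lam_inv: "F.lam x * (u x / F.lam x) = u x" for u :: "real \<Rightarrow> real" and x
    using F.lam_pos[of x] by simp
  have mass: "(LINT y:\<Omega>|lborel. u (F.R y) / F.lam (F.R y)) = (LINT x:\<Omega>|lborel. c x * sh x)"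
    if [measurable]: "u \<in> borel_measurable borel" "c \<in> borel_measurable borel"
    and *: "\<And>x. x \<in> \<Omega> \<Longrightarrow> 0 \<le> u x" "set_integrable lborel \<Omega> u"
      "distr (dmeas a b u) lborel T = dmeas a b (\<lambda>x. c x * sh x)"
      "\<And>x. x \<in> {a..b} \<Longrightarrow> 0 \<le> c x \<and> c x \<le> 1" for u c
  proof -
    have "ennreal (LINT x:\<Omega>|lborel. u x) = emeasure (dmeas a b u) UNIV"
      using emeasure_dmeas_set_integral[of u UNIV a b] * by simp
    also have "\<dots> = emeasure (distr (dmeas a b u) lborel T) UNIV" by (simp add: emeasure_distr)
    also have "\<dots> = ennreal (LINT x:\<Omega>|lborel. c x * sh x)"
      unfolding *(3) using *(4) by (intro half_mass) auto
    finally have "(LINT x:\<Omega>|lborel. u x) = (LINT x:\<Omega>|lborel. c x * sh x)"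
      using *(1,4) sh_bounds
      by (subst (asm) ennreal_inj)
        (auto simp: set_lebesgue_integral_def intro!: integral_nonneg_AE split: split_indicator)
    moreover have "(LINT y:\<Omega>|lborel. u (F.R y) / F.lam (F.R y)) = (LINT x:\<Omega>|lborel. F.lam x * (u x / F.lam x))"
      by (rule F.set_integral_R) simp
    ultimately show ?thesis by (simp only: lam_inv)
  qed
  have chi_eq: "chi (s x / F.lam x) = chi0 (s x / F.lam x)" if "x \<in> \<Omega>" for x
    using s_nonneg[OF that] F.lam_pos[of x] by (simp add: chi0_def)
  have chi_eq_R: "chi (s (F.R y) / F.lam (F.R y)) = chi0 (s (F.R y) / F.lam (F.R y))" if "y \<in> \<Omega>" for y
    using chi_eq[OF R_mem[OF that]] .
  have energy_int: "set_integrable lborel \<Omega> (\<lambda>x. F.lam x * chi (s x / F.lam x))"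
  proof -
    define k' where "k' = max k 0 / (1 - e)"
    have "compact (chi ` {0..k'})"
      by (rule compact_continuous_image[OF continuous_on_subset[OF energy_continuous_on[OF chi]]]) auto
    then obtain B where B: "\<forall>x\<in>chi ` {0..k'}. norm x \<le> B"
      using compact_imp_bounded bounded_iff by metis
    show ?thesis
    proof (rule set_integrable_bound[where f = "\<lambda>x. \<bar>chi (s x)\<bar> + 2 * \<bar>B\<bar>"])
      have "set_integrable lborel \<Omega> (\<lambda>x. 2 * \<bar>B\<bar>)"
        using ab by (intro set_integrable_bounded[where B = "2 * \<bar>B\<bar>"]) auto
      then show "set_integrable lborel \<Omega> (\<lambda>x. \<bar>chi (s x)\<bar> + 2 * \<bar>B\<bar>)"
        using chi_s_integrable by (intro set_integral_add set_integrable_abs)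
      have "(\<lambda>x. indicator \<Omega> x *\<^sub>R (F.lam x * chi (s x / F.lam x))) =
          (\<lambda>x. indicator \<Omega> x *\<^sub>R (F.lam x * chi0 (s x / F.lam x)))"
        using chi_eq by (auto simp: fun_eq_iff split: split_indicator)
      then show "set_borel_measurable lborel \<Omega> (\<lambda>x. F.lam x * chi (s x / F.lam x))"
        unfolding set_borel_measurable_def by simp
      show "AE x in lborel. x \<in> \<Omega> \<longrightarrow>
          norm (F.lam x * chi (s x / F.lam x)) \<le> norm (\<bar>chi (s x)\<bar> + 2 * \<bar>B\<bar>)"
      proof (intro AE_I2 impI)
        fix x assume x: "x \<in> \<Omega>"
        show "norm (F.lam x * chi (s x / F.lam x)) \<le> norm (\<bar>chi (s x)\<bar> + 2 * \<bar>B\<bar>)"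
        proof (cases "g x = 0")
          case True
          then show ?thesis by (simp add: F.lam_def)
        next
          case False
          have "s x / F.lam x \<le> max k 0 / (1 - e)"
            using k[OF False] F.lam_bounds(1)[of x] F.e by (intro frac_le) auto
          then have "s x / F.lam x \<in> {0..k'}"
            using s_nonneg[OF x] F.lam_pos[of x] by (simp add: k'_def)
          then have "norm (chi (s x / F.lam x)) \<le> B" using B by blast
          then have "\<bar>chi (s x / F.lam x)\<bar> \<le> \<bar>B\<bar>" by simp
          then have "\<bar>F.lam x\<bar> * \<bar>chi (s x / F.lam x)\<bar> \<le> 2 * \<bar>B\<bar>"
            using F.lam_pos[of x] F.lam_bounds(2)[of x] by (intro mult_mono) auto
          then show ?thesis by (simp add: abs_mult)
        qed
      qed
    qed
  qed
  show "set_integrable lborel \<Omega> (\<lambda>x. F.lam x * chi (s x / F.lam x))" by (rule energy_int)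
  have energy_int': "set_integrable lborel \<Omega> (\<lambda>x. F.lam x * chi0 (s x / F.lam x))"
    using energy_int by (rule set_integrable_cong[THEN iffD1, rotated -1]) (auto simp: chi_eq)
  have "admissible a b chi (LINT x:\<Omega>|lborel. rh x * sh x) (LINT x:\<Omega>|lborel. (1 - rh x) * sh x) \<rho>' \<eta>'"
    unfolding admissible_def
  proof (intro conjI ballI)
    fix y assume y: "y \<in> \<Omega>"
    show "0 \<le> \<rho>' y" "0 \<le> \<eta>' y"
      using u_nonneg[OF R_mem[OF y]] F.lam_pos[of "F.R y"] by (auto simp: \<rho>'_def \<eta>'_def)
  next
    show "set_integrable lborel \<Omega> \<rho>'" "set_integrable lborel \<Omega> \<eta>'"
      unfolding \<rho>'_def \<eta>'_def using u_int
      by (subst F.set_integrable_R[where H = "\<lambda>x. _ x / F.lam x"]; simp only: lam_inv; simp)+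
    show "(LINT x:\<Omega>|lborel. \<rho>' x) = (LINT x:\<Omega>|lborel. rh x * sh x)"
      unfolding \<rho>'_def by (rule mass[OF _ _ u_nonneg(1) u_int(1) push1]) (use rh_bounds in auto)
    show "(LINT x:\<Omega>|lborel. \<eta>' x) = (LINT x:\<Omega>|lborel. (1 - rh x) * sh x)"
      unfolding \<eta>'_def by (rule mass[OF _ _ u_nonneg(2) u_int(2) push2]) (use rh_bounds in auto)
    have "set_integrable lborel \<Omega> (\<lambda>y. chi0 (s (F.R y) / F.lam (F.R y)))"
      using energy_int' by (subst F.set_integrable_R[where H = "\<lambda>x. chi0 (s x / F.lam x)"]) auto
    then show "set_integrable lborel \<Omega> (\<lambda>y. chi (\<rho>' y + \<eta>' y))"
      by (rule set_integrable_cong[THEN iffD1, rotated -1]) (auto simp: sumeq chi_eq_R)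
  qed auto
  from minimal[OF this]
  have "jko a b chi \<tau> (\<lambda>x. rh x * sh x) (\<lambda>x. (1 - rh x) * sh x) rho eta
      \<le> jko a b chi \<tau> (\<lambda>x. rh x * sh x) (\<lambda>x. (1 - rh x) * sh x) \<rho>' \<eta>'" .
  moreover have "energy a b chi \<rho>' \<eta>' = (LINT x:\<Omega>|lborel. F.lam x * chi (s x / F.lam x))"
  proof -
    have "energy a b chi \<rho>' \<eta>' = (LINT y:\<Omega>|lborel. chi0 (s (F.R y) / F.lam (F.R y)))"
      unfolding energy_def by (rule set_lebesgue_integral_cong) (auto simp: sumeq chi_eq_R)
    also have "\<dots> = (LINT x:\<Omega>|lborel. F.lam x * chi0 (s x / F.lam x))"
      by (rule F.set_integral_R) simp
    also have "\<dots> = (LINT x:\<Omega>|lborel. F.lam x * chi (s x / F.lam x))"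
      by (rule set_lebesgue_integral_cong) (auto simp: chi_eq)
    finally show ?thesis .
  qed
  moreover have "energy a b chi rho eta = (LINT x:\<Omega>|lborel. chi (s x))" by (simp add: energy_def s_def)
  ultimately have "(LINT x:\<Omega>|lborel. chi (s x)) +
      (enn2real (W2sq (dmeas a b rho) (dmeas a b (\<lambda>x. rh x * sh x)))
        + enn2real (W2sq (dmeas a b eta) (dmeas a b (\<lambda>x. (1 - rh x) * sh x)))) / (2 * \<tau>)
     \<le> (LINT x:\<Omega>|lborel. F.lam x * chi (s x / F.lam x)) +
      (enn2real (W2sq (dmeas a b \<rho>') (dmeas a b (\<lambda>x. rh x * sh x)))
        + enn2real (W2sq (dmeas a b \<eta>') (dmeas a b (\<lambda>x. (1 - rh x) * sh x)))) / (2 * \<tau>)"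
    unfolding jko_def by simp
  moreover have "(LINT x:\<Omega>|lborel. (x - T x)\<^sup>2 * s x) / (2 * \<tau>) \<le>
     (enn2real (W2sq (dmeas a b rho) (dmeas a b (\<lambda>x. rh x * sh x)))
        + enn2real (W2sq (dmeas a b eta) (dmeas a b (\<lambda>x. (1 - rh x) * sh x)))) / (2 * \<tau>)"
    using transport_cost_le_species tau by (intro divide_right_mono) auto
  moreover have "(enn2real (W2sq (dmeas a b \<rho>') (dmeas a b (\<lambda>x. rh x * sh x)))
        + enn2real (W2sq (dmeas a b \<eta>') (dmeas a b (\<lambda>x. (1 - rh x) * sh x)))) / (2 * \<tau>)
     \<le> (LINT x:\<Omega>|lborel. (F.S x - T x)\<^sup>2 * s x) / (2 * \<tau>)"
    using W12 tau by (intro divide_right_mono) auto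
  ultimately show "(LINT x:\<Omega>|lborel. (x - T x)\<^sup>2 * s x) / (2 * \<tau>) + (LINT x:\<Omega>|lborel. chi (s x))
    \<le> (LINT x:\<Omega>|lborel. (F.S x - T x)\<^sup>2 * s x) / (2 * \<tau>)
      + (LINT x:\<Omega>|lborel. F.lam x * chi (s x / F.lam x))" by linarith
qed

end

section \<open>The Euler-Lagrange equation\<close>

context diffusion_step
begin

definition w0 :: "real \<Rightarrow> real" where "w0 x = indicator \<Omega> x * ((x - T x) * s x / \<tau>)"

definition W :: "real \<Rightarrow> real" where "W x = (LINT t:{x..b}|lborel. w0 t)"

definition p0 :: "real \<Rightarrow> real" where "p0 h = pressure chi (max 0 h)"

lemma w0_meas [measurable]: "w0 \<in> borel_measurable borel"
  unfolding w0_def by measurable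

lemma w0_integrable: "integrable lborel w0"
proof -
  have "set_integrable lborel \<Omega> (\<lambda>x. ((x - T x) / \<tau>) * s x)"
  proof (rule set_integrable_bounded_mult[OF s_integrable, where B = "(b - a) / \<tau>"])
    show "\<bar>(x - T x) / \<tau>\<bar> \<le> (b - a) / \<tau>" if "x \<in> \<Omega>" for x
      using T_mem[of x] that tau by (auto simp: abs_le_iff divide_right_mono field_simps)
  qed auto
  then show ?thesis unfolding set_integrable_def w0_def by simp
qed

lemma w0_set_integrable: "A \<in> sets borel \<Longrightarrow> set_integrable lborel A w0"
  unfolding set_integrable_def using w0_integrable by (intro integrable_mult_indicator) auto

lemma p0_continuous_on: "continuous_on UNIV p0"
  unfolding p0_def
  by (rule continuous_on_compose2[OF pressure_continuous_on[OF chi]]) (auto intro!: continuous_intros)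

lemma p0_meas [measurable]: "p0 \<in> borel_measurable borel"
  using p0_continuous_on by (rule borel_measurable_continuous_onI)

lemma first_variation:
  assumes [measurable]: "g \<in> borel_measurable borel" and g1: "\<And>x. \<bar>g x\<bar> \<le> 1"
    and supp: "\<And>x. g x \<noteq> 0 \<Longrightarrow> x \<in> \<Omega> \<and> s x \<le> k" and mean: "(LINT x|lborel. g x) = 0"
  shows "(LINT x:\<Omega>|lborel. g x * p0 (s x)) \<le> (LINT x:\<Omega>|lborel. interval_flow.xi g x * w0 x)"
proof -
  define xi where "xi = interval_flow.xi g"
  define e where "e n = 1 / real (n + 2)" for n
  define l where "l n x = 1 + e n * g x" for n x
  define Q where "Q n = (LINT x:\<Omega>|lborel. g x * p0 (s x / l n x))" for n
  define X where "X = (LINT x:\<Omega>|lborel. xi x * w0 x)"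
  define Y where "Y = (LINT x:\<Omega>|lborel. (xi x)\<^sup>2 * s x)"
  have e: "0 < e n" "e n \<le> 1 / 2" for n by (auto simp: e_def field_simps)
  have flow: "interval_flow a b g (e n)" for n
  proof unfold_locales
    show "e n < 1" using e(2)[of n] by linarith
    show "x \<notin> \<Omega> \<Longrightarrow> g x = 0" for x using supp by blast
  qed (use ab g1 mean e in auto)
  interpret F0: interval_flow a b g "e 0" by (rule flow)
  have xi_eq: "xi x = (LINT t:{..x}|lborel. g t)" for x unfolding xi_def by (rule F0.xi_def)
  have xi_meas [measurable]: "xi \<in> borel_measurable borel"
  proof -
    have "xi x = (F0.S x - x) / e 0" for x using F0.S_def[of x] e(1)[of 0] by (simp add: xi_def)
    then have "xi = (\<lambda>x. (F0.S x - x) / e 0)" by auto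
    then show ?thesis by simp
  qed
  have xi_bound: "\<bar>xi x\<bar> \<le> b - a" for x unfolding xi_def by (rule F0.abs_xi_le)
  have l_meas [measurable]: "l n \<in> borel_measurable borel" for n unfolding l_def by measurable
  have l_bounds: "1 / 2 \<le> l n x" for n x
  proof -
    have "\<bar>e n * g x\<bar> \<le> (1 / 2) * 1" unfolding abs_mult using e[of n] g1[of x] by (intro mult_mono) auto
    then show ?thesis unfolding l_def by linarith
  qed
  define k' where "k' = 2 * max k 0"
  have "compact (p0 ` {0..k'})"
    by (rule compact_continuous_image[OF continuous_on_subset[OF p0_continuous_on]]) auto
  then obtain B where B: "\<forall>x\<in>p0 ` {0..k'}. norm x \<le> B"
    using compact_imp_bounded bounded_iff by metis
  have bound: "\<bar>g x * p0 (s x / l n x)\<bar> \<le> \<bar>B\<bar>" if x: "x \<in> \<Omega>" for n x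
  proof (cases "g x = 0")
    case False
    have "s x / l n x \<le> max k 0 / (1 / 2)"
      using supp[OF False] l_bounds[where n = n and x = x] by (intro frac_le) auto
    then have "s x / l n x \<in> {0..k'}"
      using s_nonneg[OF x] l_bounds[where n = n and x = x] by (auto simp: k'_def)
    then have "norm (p0 (s x / l n x)) \<le> B" using B by blast
    then have "\<bar>g x\<bar> * \<bar>p0 (s x / l n x)\<bar> \<le> 1 * \<bar>B\<bar>" using g1[of x] by (intro mult_mono) auto
    then show ?thesis by (simp add: abs_mult)
  qed simp
  have Qint: "set_integrable lborel \<Omega> (\<lambda>x. g x * p0 (s x / l n x))" for n
    using bound ab by (intro set_integrable_bounded) auto
  have xi_w0: "set_integrable lborel \<Omega> (\<lambda>x. xi x * w0 x)"
    using xi_bound w0_set_integrable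
    by (intro set_integrable_bounded_mult[where B = "b - a"]) auto
  have step: "Q n \<le> X + e n * (Y / (2 * \<tau>))" for n
  proof -
    interpret F: interval_flow a b g "e n" by (rule flow)
    have lam: "F.lam = l n" by (auto simp: F.lam_def l_def)
    have S: "F.S x = x + e n * xi x" for x by (simp add: F.S_def xi_def)
    have VI: "(LINT x:\<Omega>|lborel. (x - T x)\<^sup>2 * s x) / (2 * \<tau>) + (LINT x:\<Omega>|lborel. chi (s x))
        \<le> (LINT x:\<Omega>|lborel. (x + e n * xi x - T x)\<^sup>2 * s x) / (2 * \<tau>)
          + (LINT x:\<Omega>|lborel. l n x * chi (s x / l n x))"
      using variation_inequality(1)[OF flow, of k n] supp unfolding lam S by blast
    have En: "set_integrable lborel \<Omega> (\<lambda>x. l n x * chi (s x / l n x))"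
      using variation_inequality(2)[OF flow, of k n] supp unfolding lam by blast
    have "(LINT x:\<Omega>|lborel. (x + e n * xi x - T x)\<^sup>2 * s x)
        = (LINT x:\<Omega>|lborel. (x - T x)\<^sup>2 * s x + (2 * e n * \<tau> * (xi x * w0 x) + (e n)\<^sup>2 * ((xi x)\<^sup>2 * s x)))"
      using tau by (intro set_lebesgue_integral_cong) (auto simp: w0_def power2_eq_square field_simps)
    also have "\<dots> = (LINT x:\<Omega>|lborel. (x - T x)\<^sup>2 * s x) + (2 * e n * \<tau> * X + (e n)\<^sup>2 * Y)"
    proof -
      have 1: "set_integrable lborel \<Omega> (\<lambda>x. (x - T x)\<^sup>2 * s x)"
      proof (rule set_integrable_bounded_mult[OF s_integrable, where B = "(b - a)\<^sup>2"])
        show "\<bar>(x - T x)\<^sup>2\<bar> \<le> (b - a)\<^sup>2" if "x \<in> \<Omega>" for x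
          using T_mem[of x] that by (auto simp flip: abs_le_square_iff)
      qed auto
      have 2: "set_integrable lborel \<Omega> (\<lambda>x. (xi x)\<^sup>2 * s x)"
      proof (rule set_integrable_bounded_mult[OF s_integrable, where B = "(b - a)\<^sup>2"])
        show "\<bar>(xi x)\<^sup>2\<bar> \<le> (b - a)\<^sup>2" for x
          using xi_bound[of x] by (simp flip: abs_le_square_iff)
      qed auto
      show ?thesis
        unfolding X_def Y_def using 1 2 xi_w0 by (simp add: set_integral_add)
    qed
    finally have A: "(LINT x:\<Omega>|lborel. (x + e n * xi x - T x)\<^sup>2 * s x) / (2 * \<tau>)
        = (LINT x:\<Omega>|lborel. (x - T x)\<^sup>2 * s x) / (2 * \<tau>) + (e n * X + (e n)\<^sup>2 * Y / (2 * \<tau>))"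
      using tau by (simp add: field_simps)
    have "(LINT x:\<Omega>|lborel. l n x * chi (s x / l n x)) - (LINT x:\<Omega>|lborel. chi (s x))
        = (LINT x:\<Omega>|lborel. l n x * chi (s x / l n x) - chi (s x))"
      using En chi_s_integrable by (simp add: set_integral_diff)
    also have "\<dots> \<le> (LINT x:\<Omega>|lborel. - e n * (g x * p0 (s x / l n x)))"
    proof (rule set_integral_mono)
      show "set_integrable lborel \<Omega> (\<lambda>x. l n x * chi (s x / l n x) - chi (s x))"
        by (rule set_integral_diff(1)[OF En chi_s_integrable])
      show "set_integrable lborel \<Omega> (\<lambda>x. - e n * (g x * p0 (s x / l n x)))"
        by (rule set_integrable_mult_right[OF Qint])
      fix x assume x: "x \<in> \<Omega>"
      have "l n x * chi (s x / l n x) - chi (s x) \<le> - (l n x - 1) * pressure chi (s x / l n x)"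
        using l_bounds[of n x] by (intro perspective_le[OF chi] s_nonneg[OF x]) auto
      moreover have "0 \<le> s x / l n x" using s_nonneg[OF x] l_bounds[of n x] by simp
      ultimately show "l n x * chi (s x / l n x) - chi (s x) \<le> - e n * (g x * p0 (s x / l n x))"
        by (simp add: p0_def l_def algebra_simps)
    qed
    also have "\<dots> = - e n * Q n" unfolding Q_def by (rule set_integral_mult_right)
    finally have "e n * Q n \<le> e n * X + (e n)\<^sup>2 * Y / (2 * \<tau>)" using VI A by linarith
    also have "\<dots> = e n * (X + e n * (Y / (2 * \<tau>)))" by (simp add: power2_eq_square algebra_simps)
    finally show ?thesis using e(1)[of n] by simp
  qed
  have e_lim: "e \<longlonglongrightarrow> 0"
    unfolding e_def by (rule LIMSEQ_ignore_initial_segment[OF lim_1_over_n])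
  have "Q \<longlonglongrightarrow> (LINT x:\<Omega>|lborel. g x * p0 (s x))"
    unfolding Q_def set_lebesgue_integral_def
  proof (rule integral_dominated_convergence[where w = "\<lambda>x. indicator \<Omega> x *\<^sub>R \<bar>B\<bar>"])
    show "integrable lborel (\<lambda>x. indicator \<Omega> x *\<^sub>R \<bar>B\<bar>)"
      using set_integrable_bounded[of "\<lambda>_. \<bar>B\<bar>" a b "\<bar>B\<bar>"] ab by (simp add: set_integrable_def)
    show "AE x in lborel. (\<lambda>i. indicator \<Omega> x *\<^sub>R (g x * p0 (s x / l i x))) \<longlonglongrightarrow> indicator \<Omega> x *\<^sub>R (g x * p0 (s x))"
    proof (rule AE_I2)
      fix x
      have "(\<lambda>i. s x / l i x) \<longlonglongrightarrow> s x / (1 + 0 * g x)"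
        unfolding l_def by (intro tendsto_intros e_lim) auto
      then have "(\<lambda>i. p0 (s x / l i x)) \<longlonglongrightarrow> p0 (s x)"
        using p0_continuous_on by (intro continuous_on_tendsto_compose[OF p0_continuous_on]) auto
      then show "(\<lambda>i. indicator \<Omega> x *\<^sub>R (g x * p0 (s x / l i x))) \<longlonglongrightarrow> indicator \<Omega> x *\<^sub>R (g x * p0 (s x))"
        by (intro tendsto_intros)
    qed
    show "AE x in lborel. norm (indicator \<Omega> x *\<^sub>R (g x * p0 (s x / l i x))) \<le> indicator \<Omega> x *\<^sub>R \<bar>B\<bar>" for i
      using bound by (intro AE_I2) (auto split: split_indicator)
  qed auto
  moreover have "(\<lambda>n. X + e n * (Y / (2 * \<tau>))) \<longlonglongrightarrow> X + 0 * (Y / (2 * \<tau>))"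
    by (intro tendsto_intros e_lim)
  ultimately have "(LINT x:\<Omega>|lborel. g x * p0 (s x)) \<le> X + 0 * (Y / (2 * \<tau>))"
    using step by (intro LIMSEQ_le) auto
  then show ?thesis by (simp add: X_def xi_def)
qed

lemma xi_w0_Fubini:
  assumes [measurable]: "g \<in> borel_measurable borel" and g1: "\<And>x. \<bar>g x\<bar> \<le> 1"
    and supp: "\<And>x. g x \<noteq> 0 \<Longrightarrow> x \<in> \<Omega>"
  shows "(LINT x:\<Omega>|lborel. (LINT t:{..x}|lborel. g t) * w0 x) = (LINT t:\<Omega>|lborel. g t * W t)"
proof -
  define f where "f x t = w0 x * (indicator {..x} t * g t)" for x t :: real
  have f_meas [measurable]: "(\<lambda>(x, t). f x t) \<in> borel_measurable (lborel \<Otimes>\<^sub>M lborel)"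
  proof -
    have "f = (\<lambda>x t. w0 x * ((if t \<le> x then 1 else 0) * g t))"
      by (auto simp: f_def fun_eq_iff split: split_indicator)
    then show ?thesis by simp
  qed
  have g_int: "integrable lborel (\<lambda>t. c * (indicator {..x} t * g t))" for x c
  proof (rule Bochner_Integration.integrable_bound)
    show "integrable lborel (\<lambda>t. \<bar>c\<bar> * indicator {a<..<b} t)"
      using ab by (simp add: integrable_indicator_iff)
    show "AE t in lborel. norm (c * (indicator {..x} t * g t)) \<le> norm (\<bar>c\<bar> * indicator {a<..<b} t)"
      using g1 supp by (intro AE_I2) (force simp: abs_mult mult_left_le split: split_indicator)
  qed auto
  have "integrable (lborel \<Otimes>\<^sub>M lborel) (\<lambda>(x, t). f x t)"
  proof (rule lborel_pair.Fubini_integrable)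
    show "AE x in lborel. integrable lborel (\<lambda>y. case (x, y) of (x, t) \<Rightarrow> f x t)"
      using g_int by (simp add: f_def)
    show "integrable lborel (\<lambda>x. LINT y|lborel. norm (case (x, y) of (x, t) \<Rightarrow> f x t))"
    proof (rule Bochner_Integration.integrable_bound)
      show "integrable lborel (\<lambda>x. (b - a) * w0 x)" using w0_integrable by simp
      show "AE x in lborel. norm (LINT y|lborel. norm (case (x, y) of (x, t) \<Rightarrow> f x t)) \<le> norm ((b - a) * w0 x)"
      proof (rule AE_I2)
        fix x
        have "(LINT y|lborel. \<bar>f x y\<bar>) \<le> (LINT y|lborel. \<bar>w0 x\<bar> * indicator {a<..<b} y)"
        proof (rule integral_mono)
          show "integrable lborel (\<lambda>y. \<bar>f x y\<bar>)" using g_int by (simp add: f_def)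
          show "integrable lborel (\<lambda>y. \<bar>w0 x\<bar> * indicator {a<..<b} y)"
            using ab by (simp add: integrable_indicator_iff)
          show "\<bar>f x y\<bar> \<le> \<bar>w0 x\<bar> * indicator {a<..<b} y" for y
            unfolding f_def abs_mult using g1[of y] supp[of y]
            by (intro mult_left_mono) (auto split: split_indicator)
        qed
        also have "\<dots> = \<bar>w0 x\<bar> * (b - a)" using ab by simp
        finally show "norm (LINT y|lborel. norm (case (x, y) of (x, t) \<Rightarrow> f x t)) \<le> norm ((b - a) * w0 x)"
          using ab by (simp add: abs_mult mult.commute)
      qed
    qed measurable
  qed simp
  then have "(LINT t|lborel. LINT x|lborel. f x t) = (LINT x|lborel. LINT t|lborel. f x t)"
    by (rule lborel_pair.Fubini_integral)
  moreover have "(LINT t|lborel. f x t) = indicator \<Omega> x *\<^sub>R ((LINT t:{..x}|lborel. g t) * w0 x)" for x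
  proof (cases "x \<in> \<Omega>")
    case True
    then show ?thesis by (simp add: f_def set_lebesgue_integral_def mult.commute)
  qed (simp add: f_def w0_def)
  moreover have "(LINT x|lborel. f x t) = indicator \<Omega> t *\<^sub>R (g t * W t)" for t
  proof -
    have "(LINT x|lborel. f x t) = (LINT x|lborel. g t * (indicator {t..b} x *\<^sub>R w0 x))"
      by (rule Bochner_Integration.integral_cong) (auto simp: f_def w0_def split: split_indicator)
    also have "\<dots> = g t * W t" by (simp add: W_def set_lebesgue_integral_def)
    finally show ?thesis using supp[of t] by (auto split: split_indicator)
  qed
  ultimately show ?thesis unfolding set_lebesgue_integral_def by simp
qed

lemma W_continuous_on: "continuous_on {a..b} W"
proof -
  have "w0 integrable_on {a..b}"
    using set_borel_integral_eq_integral(1)[OF w0_set_integrable[of "{a..b}"]] by simp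
  then have "continuous_on {a..b} (\<lambda>x. integral {x..b} w0)"
    by (rule indefinite_integral_continuous_1')
  then show ?thesis
    unfolding W_def using set_borel_integral_eq_integral(2)[OF w0_set_integrable] by simp
qed

lemma W_diff:
  assumes "u \<le> v" "v \<le> b"
  shows "W u - W v = (LINT t:{u<..<v}|lborel. w0 t)"
proof -
  have "{u..b} = {u..<v} \<union> {v..b}" using assms by auto
  then have "W u = (LINT t:{u..<v}|lborel. w0 t) + W v"
    unfolding W_def using w0_set_integrable by (simp add: set_integral_Un disjoint_iff)
  moreover have "(LINT t:{u..<v}|lborel. w0 t) = (LINT t:{u<..<v}|lborel. w0 t)"
    by (rule set_integral_cong_set)
       (use AE_lborel_singleton[of u] in \<open>auto simp: set_borel_measurable_def elim!: eventually_mono\<close>)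
  ultimately show ?thesis by simp
qed

text \<open>Test the first variation with the negative deviation of \<open>W - p0 \<circ> s\<close> from its mean.\<close>

lemma euler_lagrange_sublevel:
  "\<exists>m. AE x in lborel. x \<in> \<Omega> \<and> s x \<le> k \<longrightarrow> W x - p0 (s x) = m"
proof -
  define A where "A = {x \<in> \<Omega>. s x \<le> k}"
  have A [measurable]: "A \<in> sets borel" unfolding A_def by measurable
  have A_fin: "emeasure lborel A < \<infinity>"
  proof -
    have "emeasure lborel A \<le> emeasure lborel \<Omega>" by (rule emeasure_mono) (auto simp: A_def)
    then show ?thesis using ab by (auto simp: less_top[symmetric] top_unique)
  qed
  define Wm where "Wm x = indicator \<Omega> x *\<^sub>R W x" for x
  have Wm_meas [measurable]: "Wm \<in> borel_measurable borel"
    unfolding Wm_def by (rule borel_measurable_continuous_on_indicator)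
      (auto intro: continuous_on_subset[OF W_continuous_on])
  define f where "f x = indicator A x * (Wm x - p0 (s x))" for x
  have f_meas [measurable]: "f \<in> borel_measurable borel" unfolding f_def by measurable
  have "compact (W ` {a..b})" "compact (p0 ` {0..k})"
    by (auto intro!: compact_continuous_image W_continuous_on continuous_on_subset[OF p0_continuous_on])
  then obtain B1 B2 where B: "\<forall>x\<in>W ` {a..b}. norm x \<le> B1" "\<forall>x\<in>p0 ` {0..k}. norm x \<le> B2"
    using compact_imp_bounded bounded_iff by metis
  have f_bound: "\<bar>f x\<bar> \<le> \<bar>B1\<bar> + \<bar>B2\<bar>" for x
  proof (cases "x \<in> A")
    case True
    then have "norm (W x) \<le> B1" "norm (p0 (s x)) \<le> B2"
      using B s_nonneg[of x] by (auto simp: A_def)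
    then show ?thesis using True by (simp add: f_def Wm_def A_def)
  qed (simp add: f_def)
  define m where "m = (LINT x|lborel. f x) / measure lborel A"
  define h where "h x = indicator A x * (f x - m)" for x
  have h_meas [measurable]: "h \<in> borel_measurable borel" unfolding h_def by measurable
  define D where "D = \<bar>B1\<bar> + \<bar>B2\<bar> + \<bar>m\<bar> + 1"
  have D: "0 < D" by (simp add: D_def)
  have h_bound: "\<bar>h x\<bar> \<le> D" for x
    using f_bound[of x] by (auto simp: h_def D_def split: split_indicator)
  have int_A: "integrable lborel u" if [measurable]: "u \<in> borel_measurable borel"
    and "\<And>x. \<bar>u x\<bar> \<le> C * indicator A x" for u :: "real \<Rightarrow> real" and C
  proof (rule Bochner_Integration.integrable_bound)
    show "integrable lborel (\<lambda>x. C * indicator A x)" using A_fin by (simp add: integrable_indicator_iff)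
    show "AE x in lborel. norm (u x) \<le> norm (C * indicator A x)"
      using that(2) by (intro AE_I2) (metis abs_ge_self order_trans real_norm_def)
  qed simp
  have f_int: "integrable lborel f"
  proof (rule int_A[of _ "\<bar>B1\<bar> + \<bar>B2\<bar>"])
    show "\<bar>f x\<bar> \<le> (\<bar>B1\<bar> + \<bar>B2\<bar>) * indicator A x" for x
      using f_bound[of x] by (cases "x \<in> A") (auto simp: f_def)
  qed simp
  have h_int: "integrable lborel h"
  proof (rule int_A[of _ D])
    show "\<bar>h x\<bar> \<le> D * indicator A x" for x
      using h_bound[of x] by (cases "x \<in> A") (auto simp: h_def)
  qed simp
  have h2_int: "integrable lborel (\<lambda>x. (h x)\<^sup>2)"
  proof (rule int_A[of _ "D\<^sup>2"])
    show "\<bar>(h x)\<^sup>2\<bar> \<le> D\<^sup>2 * indicator A x" for x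
      using h_bound[of x] D by (cases "x \<in> A") (auto simp: h_def simp flip: abs_le_square_iff)
  qed simp
  have h_eq: "h x = f x - m * indicator A x" for x
    by (auto simp: h_def f_def split: split_indicator)
  have h_mean: "(LINT x|lborel. h x) = 0"
  proof -
    have "(LINT x|lborel. h x) = (LINT x|lborel. f x) - m * measure lborel A"
      unfolding h_eq using f_int A_fin by (subst Bochner_Integration.integral_diff) (auto simp: integrable_indicator_iff)
    moreover have "(LINT x|lborel. f x) = m * measure lborel A"
    proof (cases "measure lborel A = 0")
      case True
      then have "emeasure lborel A = 0" using A_fin by (simp add: emeasure_eq_ennreal_measure less_top)
      then have "AE x in lborel. x \<notin> A" by (intro AE_not_in) (simp add: null_sets_def)
      then have "AE x in lborel. f x = 0" by eventually_elim (simp add: f_def)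
      then have "(LINT x|lborel. f x) = 0" using integral_eq_zero_AE by blast
      then show ?thesis using True by simp
    qed (simp add: m_def)
    ultimately show ?thesis by simp
  qed
  define g where "g x = - h x / D" for x
  have g_meas [measurable]: "g \<in> borel_measurable borel" unfolding g_def by measurable
  have g1: "\<bar>g x\<bar> \<le> 1" for x using h_bound[of x] D by (simp add: g_def abs_divide)
  have g_supp: "x \<in> \<Omega> \<and> s x \<le> k" if "g x \<noteq> 0" for x
    using that by (auto simp: g_def h_def A_def split: split_indicator_asm)
  have g_mean: "(LINT x|lborel. g x) = 0" using h_mean by (simp add: g_def)
  have "interval_flow a b g (1 / 2)"
    using ab g1 g_mean g_supp by unfold_locales auto
  then have xi: "interval_flow.xi g x = (LINT t:{..x}|lborel. g t)" for x
    by (rule interval_flow.xi_def)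
  have "(LINT x:\<Omega>|lborel. g x * p0 (s x)) \<le> (LINT x:\<Omega>|lborel. interval_flow.xi g x * w0 x)"
    by (rule first_variation[OF g_meas g1 g_supp g_mean])
  also have "\<dots> = (LINT x:\<Omega>|lborel. g x * W x)"
    unfolding xi by (rule xi_w0_Fubini[OF g_meas g1]) (use g_supp in blast)
  finally have le: "(LINT x:\<Omega>|lborel. g x * p0 (s x)) \<le> (LINT x:\<Omega>|lborel. g x * W x)" .
  have eqW: "indicator \<Omega> x *\<^sub>R (g x * W x) = g x * Wm x" for x by (simp add: Wm_def)
  have eqp: "indicator \<Omega> x *\<^sub>R (g x * p0 (s x)) = g x * p0 (s x)" for x
    using g_supp[of x] by (auto split: split_indicator)
  have g0: "x \<notin> A \<Longrightarrow> g x = 0" for x by (simp add: g_def h_def)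
  have i1: "integrable lborel (\<lambda>x. g x * Wm x)"
  proof (rule int_A[of _ "\<bar>B1\<bar>"])
    fix x
    show "\<bar>g x * Wm x\<bar> \<le> \<bar>B1\<bar> * indicator A x"
    proof (cases "x \<in> A")
      case True
      then have "norm (W x) \<le> B1" using B by (auto simp: A_def)
      then have "\<bar>g x\<bar> * \<bar>W x\<bar> \<le> 1 * \<bar>B1\<bar>" using g1[of x] by (intro mult_mono) auto
      then show ?thesis using True by (simp add: Wm_def A_def abs_mult)
    qed (simp add: g0)
  qed simp
  have i2: "integrable lborel (\<lambda>x. g x * p0 (s x))"
  proof (rule int_A[of _ "\<bar>B2\<bar>"])
    fix x
    show "\<bar>g x * p0 (s x)\<bar> \<le> \<bar>B2\<bar> * indicator A x"
    proof (cases "x \<in> A")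
      case True
      then have "norm (p0 (s x)) \<le> B2" using B s_nonneg[of x] by (auto simp: A_def)
      then have "\<bar>g x\<bar> * \<bar>p0 (s x)\<bar> \<le> 1 * \<bar>B2\<bar>" using g1[of x] by (intro mult_mono) auto
      then show ?thesis using True by (simp add: abs_mult)
    qed (simp add: g0)
  qed simp
  have "0 \<le> (LINT x|lborel. g x * Wm x) - (LINT x|lborel. g x * p0 (s x))"
    using le unfolding set_lebesgue_integral_def eqW eqp by simp
  also have "\<dots> = (LINT x|lborel. g x * Wm x - g x * p0 (s x))" using i1 i2 by simp
  also have "\<dots> = (LINT x|lborel. m * g x - (h x)\<^sup>2 / D)"
  proof (rule Bochner_Integration.integral_cong[OF refl])
    show "g x * Wm x - g x * p0 (s x) = m * g x - (h x)\<^sup>2 / D" for x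
    proof (cases "x \<in> A")
      case True
      then have "h x = Wm x - p0 (s x) - m" by (simp add: h_def f_def)
      then have "Wm x - p0 (s x) = h x + m" by simp
      then have "g x * Wm x - g x * p0 (s x) = g x * (h x + m)" by (metis right_diff_distrib)
      also have "\<dots> = m * g x - (h x)\<^sup>2 / D" using D by (simp add: g_def power2_eq_square field_simps)
      finally show ?thesis .
    qed (simp add: g_def h_def)
  qed
  also have "\<dots> = m * (LINT x|lborel. g x) - (LINT x|lborel. (h x)\<^sup>2) / D"
    using h_int h2_int by (simp add: g_def)
  also have "\<dots> = - (LINT x|lborel. (h x)\<^sup>2) / D" using g_mean by simp
  finally have "(LINT x|lborel. (h x)\<^sup>2) \<le> 0" using D by (simp add: divide_le_0_iff)
  moreover have "0 \<le> (LINT x|lborel. (h x)\<^sup>2)" by simp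
  ultimately have "(LINT x|lborel. (h x)\<^sup>2) = 0" by linarith
  then have "AE x in lborel. (h x)\<^sup>2 = 0"
    using integral_nonneg_eq_0_iff_AE[OF h2_int] by simp
  then have "AE x in lborel. x \<in> \<Omega> \<and> s x \<le> k \<longrightarrow> W x - p0 (s x) = m"
    by eventually_elim (auto simp: h_def f_def A_def Wm_def)
  then show ?thesis by blast
qed

lemma euler_lagrange: "\<exists>c. AE x in lborel. x \<in> \<Omega> \<longrightarrow> p0 (s x) = W x + c"
proof -
  have "\<forall>k::nat. \<exists>m. AE x in lborel. x \<in> \<Omega> \<and> s x \<le> real k \<longrightarrow> W x - p0 (s x) = m"
    using euler_lagrange_sublevel by blast
  then obtain m where m: "\<And>k::nat. AE x in lborel. x \<in> \<Omega> \<and> s x \<le> real k \<longrightarrow> W x - p0 (s x) = m k"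
    by metis
  have "AE x in lborel. \<forall>k. x \<in> \<Omega> \<and> s x \<le> real k \<longrightarrow> W x - p0 (s x) = m k"
    using m by (simp add: AE_all_countable)
  from AE_E3[OF this] obtain N where N0: "\<And>x. x \<in> space lborel - N \<Longrightarrow>
      \<forall>k. x \<in> \<Omega> \<and> s x \<le> real k \<longrightarrow> W x - p0 (s x) = m k" and N2: "N \<in> null_sets lborel" by blast
  have N1: "W x - p0 (s x) = m k" if "x \<notin> N" "x \<in> \<Omega>" "s x \<le> real k" for x k
    using N0[of x] that by simp
  note N = N1 N2
  have "\<exists>x\<in>\<Omega>. x \<notin> N"
  proof (rule ccontr)
    assume "\<not> ?thesis"
    then have "emeasure lborel \<Omega> \<le> emeasure lborel N" using N(2) by (intro emeasure_mono) auto
    then show False using null_setsD1[OF N(2)] ab by simp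
  qed
  then obtain x0 where x0: "x0 \<in> \<Omega>" "x0 \<notin> N" by blast
  obtain k0 :: nat where k0: "s x0 \<le> real k0" using real_arch_simple by blast
  have mk: "m k = m k0" if "k0 \<le> k" for k
  proof -
    have "s x0 \<le> real k" using k0 that by linarith
    then show ?thesis using N(1)[OF x0(2,1)] k0 by metis
  qed
  have "AE x in lborel. x \<notin> N" by (rule AE_not_in[OF N(2)])
  then have "AE x in lborel. x \<in> \<Omega> \<longrightarrow> p0 (s x) = W x + (- m k0)"
  proof eventually_elim
    case (elim x)
    show ?case
    proof
      assume x: "x \<in> \<Omega>"
      obtain k1 :: nat where k1: "s x \<le> real k1" using real_arch_simple by blast
      have "s x \<le> real (max k0 k1)" using k1 by (simp add: le_max_iff_disj)
      then have "W x - p0 (s x) = m (max k0 k1)" by (rule N(1)[OF elim x])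
      then show "p0 (s x) = W x + (- m k0)" using mk[of "max k0 k1"] by simp
    qed
  qed
  then show ?thesis by blast
qed

end

section \<open>The diffusion step does not increase the variation\<close>

lemma first_exit:
  fixes q :: "real \<Rightarrow> real"
  assumes "continuous_on {x..b} q" "l < q x"
  shows "(\<forall>t\<in>{x..b}. l \<le> q t) \<or> (\<exists>w. x < w \<and> w \<le> b \<and> q w < q x \<and> (\<forall>t\<in>{x..<w}. l \<le> q t))"
proof (cases "\<forall>t\<in>{x..b}. l \<le> q t")
  case False
  define K where "K = {t \<in> {x..b}. q t \<le> l}"
  have "closed K" unfolding K_def using assms(1) by (intro continuous_on_closed_Collect_le) auto
  moreover have "bounded K" by (rule bounded_subset[of "{x..b}"]) (auto simp: K_def)
  ultimately have "compact K" by (simp add: compact_eq_bounded_closed)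
  moreover have "K \<noteq> {}" using False by (force simp: K_def)
  ultimately obtain w where w: "w \<in> K" "\<forall>t\<in>K. w \<le> t" using compact_attains_inf by blast
  have "w \<noteq> x" using w(1) assms(2) by (auto simp: K_def)
  then have "x < w" "w \<le> b" "q w < q x" using w(1) assms(2) by (auto simp: K_def)
  moreover have "\<forall>t\<in>{x..<w}. l \<le> q t" using w \<open>w \<le> b\<close> by (force simp: K_def)
  ultimately show ?thesis by blast
qed simp

lemma first_exit_left:
  fixes q :: "real \<Rightarrow> real"
  assumes "continuous_on {a..x} q" "l < q x"
  shows "(\<forall>t\<in>{a..x}. l \<le> q t) \<or> (\<exists>w. w < x \<and> a \<le> w \<and> q w < q x \<and> (\<forall>t\<in>{w<..x}. l \<le> q t))"
proof -
  have "continuous_on {- x..- a} (\<lambda>t. q (- t))"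
    by (rule continuous_on_compose2[OF assms(1)]) (auto intro!: continuous_intros)
  then consider "\<forall>t\<in>{- x..- a}. l \<le> q (- t)"
    | w where "- x < w" "w \<le> - a" "q (- w) < q x" "\<forall>t\<in>{- x..<w}. l \<le> q (- t)"
    using first_exit[of "- x" "- a" "\<lambda>t. q (- t)" l] assms(2) by auto
  then show ?thesis
  proof cases
    case 1
    have "l \<le> q t" if "t \<in> {a..x}" for t using 1[rule_format, of "- t"] that by auto
    then show ?thesis by blast
  next
    case 2
    have "l \<le> q t" if "t \<in> {- w<..x}" for t using 2(4)[rule_format, of "- t"] that by auto
    then show ?thesis using 2 by (intro disjI2 exI[of _ "- w"]) auto
  qed
qed

lemma set_integral_mono_set:
  fixes f :: "real \<Rightarrow> real"
  assumes "A \<subseteq> B" "A \<in> sets borel" "set_integrable lborel B f" "\<And>x. x \<in> B \<Longrightarrow> 0 \<le> f x"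
  shows "(LINT x:A|lborel. f x) \<le> (LINT x:B|lborel. f x)"
proof -
  have "set_integrable lborel A f" by (rule set_integrable_subset[OF assms(3)]) (use assms in auto)
  then show ?thesis
    using assms unfolding set_lebesgue_integral_def set_integrable_def
    by (intro integral_mono) (auto split: split_indicator)
qed

lemma set_integrable_const_real:
  fixes c :: real assumes "A \<in> sets borel" "A \<subseteq> {u..v :: real}"
  shows "set_integrable lborel A (\<lambda>x. c)"
proof -
  have "emeasure lborel A \<le> emeasure lborel {u..v}" using assms by (intro emeasure_mono) auto
  also have "\<dots> < \<infinity>" by (simp add: emeasure_lborel_Icc_eq)
  finally show ?thesis using assms(1) unfolding set_integrable_def by (simp add: integrable_indicator_iff)
qed

context diffusion_step
begin

text \<open>Fixing the end points changes \<open>T\<close> on a null set only and makes extrema of the density at the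
  boundary behave like interior ones.\<close>

definition T' :: "real \<Rightarrow> real" where "T' x = (if x \<le> a then a else if b \<le> x then b else T x)"

definition q :: "real \<Rightarrow> real" where
  "q x = W x + (SOME c. AE x in lborel. x \<in> \<Omega> \<longrightarrow> p0 (s x) = W x + c)"

lemma T'_mem: "T' x \<in> {a..b}"
  using T_mem[of x] ab by (auto simp: T'_def)

lemma T'_mono: "mono_on {a..b} T'"
proof (rule mono_onI)
  fix x y assume xy: "x \<in> {a..b}" "y \<in> {a..b}" "x \<le> y"
  show "T' x \<le> T' y"
    using mono_onD[OF T_mono xy(1,2,3)] T'_mem[of x] T'_mem[of y] T_mem[of x] T_mem[of y] xy ab
    by (auto simp: T'_def)
qed

lemma T'_eq: "x \<in> \<Omega> \<Longrightarrow> T' x = T x"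
  by (simp add: T'_def)

lemma q_AE: "AE x in lborel. x \<in> \<Omega> \<longrightarrow> p0 (s x) = q x"
  unfolding q_def using someI_ex[OF euler_lagrange] .

lemma q_continuous_on: "continuous_on {a..b} q"
  unfolding q_def by (intro continuous_intros W_continuous_on)

lemma q_diff: "u \<le> v \<Longrightarrow> v \<le> b \<Longrightarrow> q u - q v = (LINT t:{u<..<v}|lborel. w0 t)"
  using W_diff by (simp add: q_def)

lemma q_decrease:
  assumes "a \<le> u" "u < v" "v \<le> b" "q v < q u"
  shows "\<exists>t\<in>{u<..<v}. T' t < t"
proof (rule ccontr)
  assume no: "\<not> ?thesis"
  have "w0 t \<le> 0" if "t \<in> {u<..<v}" for t
  proof -
    have "t \<in> \<Omega>" using that assms by auto
    moreover have "t \<le> T t" using no that T'_eq[OF \<open>t \<in> \<Omega>\<close>] by (metis linorder_not_less)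
    ultimately show ?thesis using s_nonneg[of t] tau
      by (simp add: w0_def divide_le_0_iff mult_le_0_iff)
  qed
  then have "(LINT t:{u<..<v}|lborel. w0 t) \<le> (LINT t:{u<..<v}|lborel. 0)"
    using w0_set_integrable by (intro set_integral_mono) (auto simp: set_integrable_def)
  then show False using q_diff[of u v] assms by simp
qed

lemma q_increase:
  assumes "a \<le> u" "u < v" "v \<le> b" "q u < q v"
  shows "\<exists>t\<in>{u<..<v}. t < T' t"
proof (rule ccontr)
  assume no: "\<not> ?thesis"
  have "0 \<le> w0 t" if "t \<in> {u<..<v}" for t
  proof -
    have "t \<in> \<Omega>" using that assms by auto
    moreover have "T t \<le> t" using no that T'_eq[OF \<open>t \<in> \<Omega>\<close>] by (metis linorder_not_less)
    ultimately show ?thesis using s_nonneg[of t] tau by (simp add: w0_def)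
  qed
  then have "(LINT t:{u<..<v}|lborel. 0) \<le> (LINT t:{u<..<v}|lborel. w0 t)"
    using w0_set_integrable by (intro set_integral_mono) (auto simp: set_integrable_def)
  then show False using q_diff[of u v] assms by simp
qed

lemma superlevel_interval:
  assumes x: "x \<in> {a..b}" and l: "l < q x"
  obtains z' z where "z' \<in> {a..x}" "z \<in> {x..b}" "z' < z" "\<forall>t\<in>{z'..z}. l \<le> q t" "z' \<le> T' z'" "T' z \<le> z"
proof -
  have cont: "continuous_on {x..b} q" "continuous_on {a..x} q"
    using x by (auto intro: continuous_on_subset[OF q_continuous_on])
  obtain z where z: "z \<in> {x..b}" "x < z \<or> x = b" "\<forall>t\<in>{x..z}. l \<le> q t" "T' z \<le> z"
    using first_exit[OF cont(1) l]
  proof (elim disjE exE conjE)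
    assume "\<forall>t\<in>{x..b}. l \<le> q t"
    then show thesis using x ab by (intro that[of b]) (auto simp: T'_def)
  next
    fix w assume w: "x < w" "w \<le> b" "q w < q x" "\<forall>t\<in>{x..<w}. l \<le> q t"
    then obtain t where "t \<in> {x<..<w}" "T' t < t" using q_decrease[of x w] x by auto
    then show thesis using w by (intro that[of t]) auto
  qed
  obtain z' where z': "z' \<in> {a..x}" "z' < x \<or> x = a" "\<forall>t\<in>{z'..x}. l \<le> q t" "z' \<le> T' z'"
    using first_exit_left[OF cont(2) l]
  proof (elim disjE exE conjE)
    assume "\<forall>t\<in>{a..x}. l \<le> q t"
    then show thesis using x ab by (intro that[of a]) (auto simp: T'_def)
  next
    fix w assume w: "w < x" "a \<le> w" "q w < q x" "\<forall>t\<in>{w<..x}. l \<le> q t"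
    then obtain t where "t \<in> {w<..<x}" "t < T' t" using q_increase[of w x] x by auto
    then show thesis using w by (intro that[of t]) auto
  qed
  have "z' < z" using z z' x ab by auto
  moreover have "l \<le> q t" if "t \<in> {z'..z}" for t
    using z(3) z'(3) that by (cases "t \<le> x") auto
  ultimately show ?thesis using that z z' by blast
qed

lemma sublevel_interval:
  assumes x: "x \<in> {a..b}" and l: "q x < l"
  obtains z' z where "z' \<in> {a..x}" "z \<in> {x..b}" "z' < z" "\<forall>t\<in>{z'..z}. q t \<le> l" "T' z' \<le> z'" "z \<le> T' z"
proof -
  have cont: "continuous_on {x..b} (\<lambda>t. - q t)" "continuous_on {a..x} (\<lambda>t. - q t)"
    using x by (auto intro!: continuous_intros continuous_on_subset[OF q_continuous_on])
  have l': "- l < - q x" using l by simp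
  obtain z where z: "z \<in> {x..b}" "x < z \<or> x = b" "\<forall>t\<in>{x..z}. q t \<le> l" "z \<le> T' z"
    using first_exit[OF cont(1) l']
  proof (elim disjE exE conjE)
    assume "\<forall>t\<in>{x..b}. - l \<le> - q t"
    then show thesis using x ab by (intro that[of b]) (auto simp: T'_def)
  next
    fix w assume w: "x < w" "w \<le> b" "- q w < - q x" "\<forall>t\<in>{x..<w}. - l \<le> - q t"
    then obtain t where "t \<in> {x<..<w}" "t < T' t" using q_increase[of x w] x by auto
    then show thesis using w by (intro that[of t]) auto
  qed
  obtain z' where z': "z' \<in> {a..x}" "z' < x \<or> x = a" "\<forall>t\<in>{z'..x}. q t \<le> l" "T' z' \<le> z'"
    using first_exit_left[OF cont(2) l']
  proof (elim disjE exE conjE)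
    assume "\<forall>t\<in>{a..x}. - l \<le> - q t"
    then show thesis using x ab by (intro that[of a]) (auto simp: T'_def)
  next
    fix w assume w: "w < x" "a \<le> w" "- q w < - q x" "\<forall>t\<in>{w<..x}. - l \<le> - q t"
    then obtain t where "t \<in> {w<..<x}" "T' t < t" using q_decrease[of w x] x by auto
    then show thesis using w by (intro that[of t]) auto
  qed
  have "z' < z" using z z' x ab by auto
  moreover have "q t \<le> l" if "t \<in> {z'..z}" for t
    using z(3) z'(3) that by (cases "t \<le> x") auto
  ultimately show ?thesis using that z z' by blast
qed

lemma mass_push:
  assumes [measurable]: "B \<in> sets borel"
  shows "(LINT x:\<Omega> \<inter> T -` B|lborel. s x) = (LINT y:\<Omega> \<inter> B|lborel. sh y)"
proof -
  have [measurable]: "T -` B \<in> sets borel" using measurable_sets[OF T_meas assms] by simp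
  have "ennreal (LINT x:\<Omega> \<inter> T -` B|lborel. s x) = emeasure (dmeas a b s) (T -` B)"
    using s_nonneg s_integrable by (intro emeasure_dmeas_set_integral[symmetric]) auto
  also have "\<dots> = emeasure (dmeas a b sh) B"
    unfolding push[symmetric] dmeas_s[symmetric] by (subst emeasure_distr) auto
  also have "\<dots> = ennreal (LINT y:\<Omega> \<inter> B|lborel. sh y)"
    using sh_bounds sh_integrable by (intro emeasure_dmeas_set_integral) auto
  finally show ?thesis
    using s_nonneg sh_bounds by (subst (asm) ennreal_inj)
      (auto simp: set_lebesgue_integral_def intro!: integral_nonneg_AE split: split_indicator)
qed

lemma mass_forward:
  assumes "a \<le> u" "u < v" "v \<le> b"
  shows "(LINT x:{u<..<v}|lborel. s x) \<le> (LINT y:\<Omega> \<inter> {T' u..T' v}|lborel. sh y)"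
proof -
  have [measurable]: "T -` {T' u..T' v} \<in> sets borel"
    using measurable_sets[OF T_meas, of "{T' u..T' v}"] by simp
  have "T' t = T t" "T' u \<le> T' t" "T' t \<le> T' v" if "t \<in> {u<..<v}" for t
    using that assms by (auto intro!: mono_onD[OF T'_mono] T'_eq)
  then have "{u<..<v} \<subseteq> \<Omega> \<inter> T -` {T' u..T' v}"
    using assms by fastforce
  then have "(LINT x:{u<..<v}|lborel. s x) \<le> (LINT x:\<Omega> \<inter> T -` {T' u..T' v}|lborel. s x)"
    using s_nonneg by (intro set_integral_mono_set set_integrable_subset[OF s_integrable]) auto
  then show ?thesis using mass_push[of "{T' u..T' v}"] by simp
qed

lemma mass_backward:
  assumes "a \<le> u" "u < v" "v \<le> b"
  shows "(LINT y:{T' u<..<T' v}|lborel. sh y) \<le> (LINT x:{u<..<v}|lborel. s x)"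
proof -
  have [measurable]: "T -` {T' u<..<T' v} \<in> sets borel"
    using measurable_sets[OF T_meas, of "{T' u<..<T' v}"] by simp
  have sub: "\<Omega> \<inter> T -` {T' u<..<T' v} \<subseteq> \<Omega> \<inter> {u..v}"
  proof
    fix t assume t: "t \<in> \<Omega> \<inter> T -` {T' u<..<T' v}"
    then have *: "T' u < T' t" "T' t < T' v" using T'_eq[of t] by auto
    have "u \<le> t"
    proof (rule ccontr)
      assume "\<not> u \<le> t"
      then have "T' t \<le> T' u" using t assms by (intro mono_onD[OF T'_mono]) auto
      then show False using * by simp
    qed
    moreover have "t \<le> v"
    proof (rule ccontr)
      assume "\<not> t \<le> v"
      then have "T' v \<le> T' t" using t assms by (intro mono_onD[OF T'_mono]) auto
      then show False using * by simp
    qed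
    ultimately show "t \<in> \<Omega> \<inter> {u..v}" using t by auto
  qed
  have "{T' u<..<T' v} = \<Omega> \<inter> {T' u<..<T' v}" using T'_mem[of u] T'_mem[of v] by auto
  then have "(LINT y:{T' u<..<T' v}|lborel. sh y) = (LINT x:\<Omega> \<inter> T -` {T' u<..<T' v}|lborel. s x)"
    using mass_push[of "{T' u<..<T' v}"] by simp
  also have "\<dots> \<le> (LINT x:\<Omega> \<inter> {u..v}|lborel. s x)"
    using s_nonneg sub by (intro set_integral_mono_set set_integrable_subset[OF s_integrable]) auto
  also have "\<dots> = (LINT x:{u<..<v}|lborel. s x)"
  proof (rule set_integral_cong_set)
    show "AE x in lborel. (x \<in> {u<..<v}) = (x \<in> \<Omega> \<inter> {u..v})"
      using AE_lborel_singleton[of u] AE_lborel_singleton[of v]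
      by eventually_elim (use assms in auto)
  qed (auto simp: set_borel_measurable_def)
  finally show ?thesis .
qed

lemma p0_eq: "0 \<le> h \<Longrightarrow> p0 h = pressure chi h"
  by (simp add: p0_def)

lemma high_point:
  assumes x: "x \<in> {a..b}" and L: "0 \<le> L" "pressure chi L < q x" and d: "0 < d"
  shows "\<exists>z' z y. z' \<in> {a..x} \<and> z \<in> {x..b} \<and> (\<forall>t\<in>{z'..z}. pressure chi L \<le> q t) \<and>
    y \<in> {T' z'..T' z} \<and> L - d \<le> sh y"
proof -
  obtain z' z where z: "z' \<in> {a..x}" "z \<in> {x..b}" "z' < z" "\<forall>t\<in>{z'..z}. pressure chi L \<le> q t"
    "z' \<le> T' z'" "T' z \<le> z" by (rule superlevel_interval[OF x L(2)])
  have "\<exists>y\<in>{T' z'..T' z}. L - d \<le> sh y"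
  proof (rule ccontr)
    assume no: "\<not> ?thesis"
    have TT: "T' z' \<le> T' z" using z x by (intro mono_onD[OF T'_mono]) auto
    then have "sh (T' z') < L - d" using no by force
    moreover have "0 \<le> sh (T' z')" using sh_bounds[OF T'_mem] by simp
    ultimately have Ld: "0 < L - d" by linarith
    have "L * (z - z') = (LINT t:{z'<..<z}|lborel. L)" using z(3) by (simp add: set_lebesgue_integral_def)
    also have "\<dots> \<le> (LINT t:{z'<..<z}|lborel. s t)"
    proof (rule set_integral_mono_AE)
      show "set_integrable lborel {z'<..<z} (\<lambda>t. L)"
        by (rule set_integrable_const_real[of _ z' z]) auto
      show "set_integrable lborel {z'<..<z} s"
        by (rule set_integrable_subset[OF s_integrable]) (use z in auto)
      show "AE t\<in>{z'<..<z} in lborel. L \<le> s t"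
        using q_AE
      proof eventually_elim
        case (elim t)
        show ?case
        proof
          assume t: "t \<in> {z'<..<z}"
          then have t': "t \<in> \<Omega>" "t \<in> {z'..z}" using z by auto
          then have "pressure chi L \<le> pressure chi (s t)"
            using elim z(4) s_nonneg[of t] by (metis p0_eq)
          then show "L \<le> s t" using pressure_le_iff[OF chi L(1) s_nonneg[OF t'(1)]] by simp
        qed
      qed
    qed
    also have "\<dots> \<le> (LINT y:\<Omega> \<inter> {T' z'..T' z}|lborel. sh y)"
      using z x by (intro mass_forward) auto
    also have "\<dots> \<le> (LINT y:\<Omega> \<inter> {T' z'..T' z}|lborel. L - d)"
    proof (rule set_integral_mono)
      show "set_integrable lborel (\<Omega> \<inter> {T' z'..T' z}) sh"
        by (rule set_integrable_subset[OF sh_integrable]) auto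
      show "set_integrable lborel (\<Omega> \<inter> {T' z'..T' z}) (\<lambda>y. L - d)"
        by (rule set_integrable_const_real[of _ a b]) auto
      show "sh y \<le> L - d" if "y \<in> \<Omega> \<inter> {T' z'..T' z}" for y using no that by force
    qed
    also have "\<dots> \<le> (LINT y:{T' z'..T' z}|lborel. L - d)"
      using Ld by (intro set_integral_mono_set set_integrable_const_real) auto
    also have "\<dots> = (L - d) * (T' z - T' z')" using TT by (simp add: set_lebesgue_integral_def)
    also have "\<dots> \<le> (L - d) * (z - z')" using Ld z by (intro mult_left_mono) auto
    also have "\<dots> < L * (z - z')" using d z(3) by simp
    finally show False by simp
  qed
  then show ?thesis using z by blast
qed

lemma low_point:
  assumes x: "x \<in> {a..b}" and L: "0 \<le> L" "q x < pressure chi L" and d: "0 < d"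
  shows "\<exists>z' z y. z' \<in> {a..x} \<and> z \<in> {x..b} \<and> (\<forall>t\<in>{z'..z}. q t \<le> pressure chi L) \<and>
    y \<in> {T' z'..T' z} \<and> sh y \<le> L + d"
proof -
  obtain z' z where z: "z' \<in> {a..x}" "z \<in> {x..b}" "z' < z" "\<forall>t\<in>{z'..z}. q t \<le> pressure chi L"
    "T' z' \<le> z'" "z \<le> T' z" by (rule sublevel_interval[OF x L(2)])
  have "\<exists>y\<in>{T' z'..T' z}. sh y \<le> L + d"
  proof (rule ccontr)
    assume no: "\<not> ?thesis"
    have TT: "T' z' < T' z" using z by linarith
    have sub: "{T' z'<..<T' z} \<subseteq> \<Omega>" using T'_mem[of z'] T'_mem[of z] by auto
    have "(L + d) * (T' z - T' z') = (LINT y:{T' z'<..<T' z}|lborel. L + d)"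
      using TT by (simp add: set_lebesgue_integral_def)
    also have "\<dots> \<le> (LINT y:{T' z'<..<T' z}|lborel. sh y)"
    proof (rule set_integral_mono)
      show "set_integrable lborel {T' z'<..<T' z} sh"
        by (rule set_integrable_subset[OF sh_integrable]) (use sub in auto)
      show "set_integrable lborel {T' z'<..<T' z} (\<lambda>y. L + d)"
        by (rule set_integrable_const_real[of _ "T' z'" "T' z"]) auto
      show "L + d \<le> sh y" if "y \<in> {T' z'<..<T' z}" for y
        using no that by (meson greaterThanLessThan_subseteq_atLeastAtMost_iff less_imp_le linear order_refl subsetD)
    qed
    also have "\<dots> \<le> (LINT t:{z'<..<z}|lborel. s t)" using z x by (intro mass_backward) auto
    also have "\<dots> \<le> (LINT t:{z'<..<z}|lborel. L)"
    proof (rule set_integral_mono_AE)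
      show "set_integrable lborel {z'<..<z} (\<lambda>t. L)"
        by (rule set_integrable_const_real[of _ z' z]) auto
      show "set_integrable lborel {z'<..<z} s"
        by (rule set_integrable_subset[OF s_integrable]) (use z in auto)
      show "AE t\<in>{z'<..<z} in lborel. s t \<le> L"
        using q_AE
      proof eventually_elim
        case (elim t)
        show ?case
        proof
          assume t: "t \<in> {z'<..<z}"
          then have t': "t \<in> \<Omega>" "t \<in> {z'..z}" using z by auto
          then have "pressure chi (s t) \<le> pressure chi L"
            using elim z(4) s_nonneg[of t] by (metis p0_eq)
          then show "s t \<le> L" using pressure_le_iff[OF chi s_nonneg[OF t'(1)] L(1)] by simp
        qed
      qed
    qed
    also have "\<dots> = L * (z - z')" using z(3) by (simp add: set_lebesgue_integral_def)
    also have "\<dots> \<le> L * (T' z - T' z')" using L z by (intro mult_left_mono) auto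
    also have "\<dots> < (L + d) * (T' z - T' z')" using d TT by simp
    finally show False by simp
  qed
  then show ?thesis using z by blast
qed

lemma M_nonneg: "0 \<le> M"
  using sh_bounds[of a] ab by auto

lemma q_lower: "x \<in> {a..b} \<Longrightarrow> pressure chi 0 \<le> q x"
proof (rule ccontr)
  assume x: "x \<in> {a..b}" and "\<not> pressure chi 0 \<le> q x"
  then obtain l where l: "q x < l" "l < pressure chi 0" using dense[of "q x" "pressure chi 0"] by auto
  obtain z' z where z: "z' \<in> {a..x}" "z \<in> {x..b}" "z' < z" "\<forall>t\<in>{z'..z}. q t \<le> l"
    by (rule sublevel_interval[OF x l(1)])
  have "AE t in lborel. t \<notin> {z'<..<z}"
    using q_AE
  proof eventually_elim
    case (elim t)
    show ?case
    proof
      assume "t \<in> {z'<..<z}"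
      then have t: "t \<in> \<Omega>" "t \<in> {z'..z}" using z by auto
      then have "pressure chi (s t) \<le> l" using elim z(4) s_nonneg[of t] by (metis p0_eq)
      moreover have "pressure chi 0 \<le> pressure chi (s t)"
        using pressure_le_iff[OF chi order_refl s_nonneg[OF t(1)]] s_nonneg[OF t(1)] by simp
      ultimately show False using l by simp
    qed
  qed
  then have "emeasure lborel {z'<..<z} = 0"
    by (subst (asm) AE_iff_measurable[where N = "{z'<..<z}"]) auto
  then show False using z(3) by simp
qed

lemma q_upper: "x \<in> {a..b} \<Longrightarrow> q x \<le> pressure chi M"
proof (rule ccontr)
  assume x: "x \<in> {a..b}" and "\<not> q x \<le> pressure chi M"
  then have less: "pressure chi M < q x" by simp
  have "continuous_on {0..} (pressure chi)" by (rule pressure_continuous_on[OF chi])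
  then have "(pressure chi \<longlongrightarrow> pressure chi M) (at M within {0..})"
    using M_nonneg by (simp add: continuous_on_def)
  then have "(pressure chi \<longlongrightarrow> pressure chi M) (at_right M)"
    by (rule tendsto_within_subset) (use M_nonneg in auto)
  then have "\<forall>\<^sub>F h in at_right M. pressure chi h < q x" using less by (rule order_tendstoD)
  then obtain L where L: "M < L" "pressure chi L < q x"
    by (metis eventually_at_right_field dense)
  have "\<exists>z' z y. z' \<in> {a..x} \<and> z \<in> {x..b} \<and> (\<forall>t\<in>{z'..z}. pressure chi L \<le> q t) \<and>
    y \<in> {T' z'..T' z} \<and> L - (L - M) / 2 \<le> sh y"
    using high_point[OF x, of L "(L - M) / 2"] L M_nonneg by auto
  then obtain z' z y where y: "y \<in> {T' z'..T' z}" "L - (L - M) / 2 \<le> sh y" by blast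
  have "y \<in> {a..b}" using y(1) T'_mem[of z'] T'_mem[of z] by auto
  then have "L - (L - M) / 2 \<le> M" using sh_bounds[of y] y(2) by simp
  then show False using L(1) by (simp add: field_simps)
qed

theorem contraction:
  "\<exists>st. (AE x in lborel. x \<in> \<Omega> \<longrightarrow> st x = rho x + eta x) \<and> (\<forall>x\<in>{a..b}. 0 \<le> st x \<and> st x \<le> M)
    \<and> pvar {a..b} st \<le> pvar {a..b} sh"
proof -
  have "\<exists>h. 0 \<le> h \<and> h \<le> M \<and> pressure chi h = q x" if x: "x \<in> {a..b}" for x
    using q_lower[OF x] q_upper[OF x] M_nonneg
    by (intro IVT') (auto intro: continuous_on_subset[OF pressure_continuous_on[OF chi]])
  then obtain st where st: "\<And>x. x \<in> {a..b} \<Longrightarrow> 0 \<le> st x \<and> st x \<le> M \<and> pressure chi (st x) = q x"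
    by metis
  have "AE x in lborel. x \<in> \<Omega> \<longrightarrow> st x = rho x + eta x"
    using q_AE
  proof eventually_elim
    case (elim x)
    show ?case
    proof
      assume x: "x \<in> \<Omega>"
      then have "pressure chi (s x) = pressure chi (st x)"
        using elim st[of x] s_nonneg[OF x] by (simp add: p0_eq)
      then have "s x = st x"
        using pressure_le_iff[OF chi, of "s x" "st x"] pressure_le_iff[OF chi, of "st x" "s x"]
          s_nonneg[OF x] st[of x] x by auto
      then show "st x = rho x + eta x" by (simp add: s_def)
    qed
  qed
  moreover have "pvar {a..b} st \<le> pvar {a..b} sh"
  proof (rule pvar_le_of_extremal_points[OF T'_mono])
    show "T' ` {a..b} \<subseteq> {a..b}" using T'_mem by auto
    fix x e :: real assume x: "x \<in> {a..b}" and e: "0 < e"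
    have le_iff: "h \<le> st t \<longleftrightarrow> pressure chi h \<le> q t" "st t \<le> h \<longleftrightarrow> q t \<le> pressure chi h"
      if "t \<in> {a..b}" "0 \<le> h" for h t
      using pressure_le_iff[OF chi, of h "st t"] pressure_le_iff[OF chi, of "st t" h] st[OF that(1)] that(2) by auto
    show "\<exists>z' z y. z' \<in> {a..x} \<and> z \<in> {x..b} \<and> (\<forall>t\<in>{z'..z}. st x - e \<le> st t) \<and>
        y \<in> {T' z'..T' z} \<and> st x - 2 * e \<le> sh y"
    proof (cases "0 \<le> st x - e")
      case True
      then have "pressure chi (st x - e) < q x"
        using pressure_strict_mono[OF chi, of "st x - e" "st x"] st[OF x] e by simp
      then obtain z' z y where "z' \<in> {a..x}" "z \<in> {x..b}" "\<forall>t\<in>{z'..z}. pressure chi (st x - e) \<le> q t"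
        "y \<in> {T' z'..T' z}" "st x - e - e \<le> sh y"
        using high_point[OF x True _ e] by blast
      then show ?thesis using le_iff(1)[OF _ True]
        by (intro exI[of _ z'] exI[of _ z] exI[of _ y]) auto
    next
      case False
      have "0 \<le> sh (T' x)" using sh_bounds[OF T'_mem] by simp
      then show ?thesis using False x e by (intro exI[of _ x] exI[of _ x] exI[of _ "T' x"]) auto
    qed
    have nn: "0 \<le> st x + e" using st[OF x] e by simp
    have "q x < pressure chi (st x + e)"
      using pressure_strict_mono[OF chi, of "st x" "st x + e"] st[OF x] e by simp
    then obtain z' z y where "z' \<in> {a..x}" "z \<in> {x..b}" "\<forall>t\<in>{z'..z}. q t \<le> pressure chi (st x + e)"
      "y \<in> {T' z'..T' z}" "sh y \<le> st x + e + e"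
      using low_point[OF x nn _ e] by blast
    then show "\<exists>z' z y. z' \<in> {a..x} \<and> z \<in> {x..b} \<and> (\<forall>t\<in>{z'..z}. st t \<le> st x + e) \<and>
        y \<in> {T' z'..T' z} \<and> sh y \<le> st x + 2 * e"
      using le_iff(2)[OF _ nn] by (intro exI[of _ z'] exI[of _ z] exI[of _ y]) auto
  qed
  ultimately show ?thesis using st by blast
qed

end

section \<open>Uniform bounds for the splitting scheme\<close>

lemma pvar_add_finite:
  assumes "pvar S f < \<infinity>" "pvar S g < \<infinity>"
  shows "pvar S (\<lambda>x. f x + g x) < \<infinity>"
proof -
  obtain A B where "pvar S f = ereal A" "pvar S g = ereal B"
    using pvar_eq_ereal[OF assms(1)] pvar_eq_ereal[OF assms(2)] by metis
  then have "pvar S (\<lambda>x. f x + g x) \<le> ereal (1 * A + 1 * B)"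
    by (intro pvar_combination[where f = f and g = g]) auto
  then show ?thesis by (rule le_less_trans) simp
qed

lemma diffusion_step_bounds:
  assumes ab: "a < b" and tau: "0 < \<tau>" and chi: "internal_energy chi"
    and sh: "\<And>x. x \<in> {a..b} \<Longrightarrow> 0 \<le> sh x \<and> sh x \<le> M" "pvar {a..b} sh < \<infinity>"
    and rh: "\<And>x. x \<in> {a..b} \<Longrightarrow> 0 \<le> rh x \<and> rh x \<le> 1" "pvar {a..b} rh < \<infinity>"
    and adm: "admissible a b chi (LINT x:{a<..<b}|lborel. rh x * sh x)
          (LINT x:{a<..<b}|lborel. (1 - rh x) * sh x) rho eta"
    and minimal: "\<And>\<rho> \<eta>. admissible a b chi (LINT x:{a<..<b}|lborel. rh x * sh x)
          (LINT x:{a<..<b}|lborel. (1 - rh x) * sh x) \<rho> \<eta> \<Longrightarrow>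
        jko a b chi \<tau> (\<lambda>x. rh x * sh x) (\<lambda>x. (1 - rh x) * sh x) rho eta
        \<le> jko a b chi \<tau> (\<lambda>x. rh x * sh x) (\<lambda>x. (1 - rh x) * sh x) \<rho> \<eta>"
    and sg: "AE x in lborel. x \<in> {a<..<b} \<longrightarrow> sg x = rho x + eta x" "good_rep a b sg"
    and T: "T \<in> borel_measurable borel" "mono_on {a..b} T" "T ` {a..b} \<subseteq> {a..b}"
    and push: "distr (dmeas a b sg) lborel T = dmeas a b sh"
    and optimal: "(\<integral>\<^sup>+x. ennreal ((x - T x)\<^sup>2) \<partial>(dmeas a b sg)) = W2sq (dmeas a b sg) (dmeas a b sh)"
  shows "(\<forall>x\<in>{a..b}. 0 \<le> sg x \<and> sg x \<le> M) \<and> pvar {a..b} sg \<le> pvar {a..b} sh"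
proof -
  define sh' where "sh' x = indicator {a..b} x * sh x" for x
  define rh' where "rh' x = indicator {a..b} x * rh x" for x
  have sg_eq: "dmeas a b sg = dmeas a b (\<lambda>x. rho x + eta x)" by (rule dmeas_cong[OF sg(1)])
  have sh_eq: "dmeas a b sh = dmeas a b sh'"
    by (rule dmeas_cong) (auto simp: sh'_def)
  have eqs: "(LINT x:{a<..<b}|lborel. rh x * sh x) = (LINT x:{a<..<b}|lborel. rh' x * sh' x)"
    "(LINT x:{a<..<b}|lborel. (1 - rh x) * sh x) = (LINT x:{a<..<b}|lborel. (1 - rh' x) * sh' x)"
    by (auto intro!: set_lebesgue_integral_cong simp: sh'_def rh'_def)
  have "dmeas a b (\<lambda>x. rh x * sh x) = dmeas a b (\<lambda>x. rh' x * sh' x)"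
    "dmeas a b (\<lambda>x. (1 - rh x) * sh x) = dmeas a b (\<lambda>x. (1 - rh' x) * sh' x)"
    by (auto intro!: dmeas_cong simp: sh'_def rh'_def)
  then have jko_eq: "jko a b chi \<tau> (\<lambda>x. rh x * sh x) (\<lambda>x. (1 - rh x) * sh x) =
      jko a b chi \<tau> (\<lambda>x. rh' x * sh' x) (\<lambda>x. (1 - rh' x) * sh' x)"
    by (intro ext) (simp add: jko_def)
  interpret D: diffusion_step a b \<tau> M chi sh' rh' rho eta T
  proof
    show "sh' \<in> borel_measurable borel" "rh' \<in> borel_measurable borel"
      using pvar_finite_borel_measurable[OF sh(2)] pvar_finite_borel_measurable[OF rh(2)]
      by (simp_all add: sh'_def[abs_def] rh'_def[abs_def])
    show "distr (dmeas a b (\<lambda>x. rho x + eta x)) lborel T = dmeas a b sh'"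
      using push unfolding sg_eq sh_eq .
    show "(\<integral>\<^sup>+x. ennreal ((x - T x)\<^sup>2) \<partial>(dmeas a b (\<lambda>x. rho x + eta x)))
        = W2sq (dmeas a b (\<lambda>x. rho x + eta x)) (dmeas a b sh')"
      using optimal unfolding sg_eq sh_eq .
    show "admissible a b chi (LINT x:{a<..<b}|lborel. rh' x * sh' x)
          (LINT x:{a<..<b}|lborel. (1 - rh' x) * sh' x) rho eta"
      using adm unfolding eqs .
    show "jko a b chi \<tau> (\<lambda>x. rh' x * sh' x) (\<lambda>x. (1 - rh' x) * sh' x) rho eta
        \<le> jko a b chi \<tau> (\<lambda>x. rh' x * sh' x) (\<lambda>x. (1 - rh' x) * sh' x) \<rho> \<eta>"
      if "admissible a b chi (LINT x:{a<..<b}|lborel. rh' x * sh' x)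
          (LINT x:{a<..<b}|lborel. (1 - rh' x) * sh' x) \<rho> \<eta>" for \<rho> \<eta>
      using minimal[unfolded eqs jko_eq, OF that] .
  qed (use ab tau chi T sh rh in \<open>auto simp: sh'_def rh'_def\<close>)
  obtain st where st: "AE x in lborel. x \<in> {a<..<b} \<longrightarrow> st x = rho x + eta x"
    "\<forall>x\<in>{a..b}. 0 \<le> st x \<and> st x \<le> M" "pvar {a..b} st \<le> pvar {a..b} sh'"
    using D.contraction by blast
  have "pvar {a..b} sh' = pvar {a..b} sh" by (rule pvar_cong) (simp add: sh'_def)
  then have st_var: "pvar {a..b} st \<le> pvar {a..b} sh" using st(3) by simp
  have ae: "AE x in lborel. x \<in> {a<..<b} \<longrightarrow> st x = sg x"
    using st(1) sg(1) by eventually_elim auto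
  have "pvar {a..b} sg \<le> pvar {a..b} st" using sg(2) ae by (simp add: good_rep_def)
  moreover have "0 \<le> sg x \<and> sg x \<le> M" if "x \<in> {a..b}" for x
  proof (rule good_rep_bounds[OF ab sg(2) D.M_nonneg _ ae _ that])
    show "AE x in lborel. x \<in> {a<..<b} \<longrightarrow> 0 \<le> sg x \<and> sg x \<le> M"
      using ae
    proof eventually_elim
      case (elim x)
      then show ?case using st(2)[rule_format, of x] by auto
    qed
    show "pvar {a..b} st < \<infinity>" using st_var sh(2) by (rule le_less_trans)
  qed
  ultimately show ?thesis using st_var by (meson order_trans)
qed

theorem mainTheorem9:
  fixes a b T :: real and chi :: "real \<Rightarrow> real"
    and F1 F2 G1 G2 :: "real \<times> real \<Rightarrow> real"
    and rho0 eta0 r0 :: "real \<Rightarrow> real"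
  assumes "a < b" and "T > 0"
    and "internal_energy chi"
    and "rate_fun F1" "rate_fun F2" "rate_fun G1" "rate_fun G2"
    and "\<forall>\<eta>\<ge>0. G1 (0, \<eta>) \<ge> 0" and "\<forall>\<rho>\<ge>0. G2 (\<rho>, 0) \<ge> 0"
    and "\<forall>x\<in>{a..b}. 0 \<le> rho0 x \<and> 0 \<le> eta0 x"
    and "pvar {a<..<b} rho0 < \<infinity>" and "pvar {a<..<b} eta0 < \<infinity>"
    and "\<exists>M. \<forall>x\<in>{a<..<b}. \<bar>rho0 x\<bar> \<le> M \<and> \<bar>eta0 x\<bar> \<le> M"
    and "pvar {a<..<b} r0 < \<infinity>" and "\<forall>x\<in>{a..b}. 0 \<le> r0 x \<and> r0 x \<le> 1"
    and "\<forall>x\<in>{a..b}. rho0 x + eta0 x > 0 \<longrightarrow> r0 x = rho0 x / (rho0 x + eta0 x)"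
  shows "\<exists>C::real. \<forall>\<tau> N sg r sigh rh rhoD etaD Tm.
           0 < \<tau> \<and> \<tau> < 1 \<and> real N * \<tau> = T
           \<and> splitting_run a b chi F1 F2 G1 G2 rho0 eta0 r0 \<tau> N sg r sigh rh rhoD etaD Tm
           \<longrightarrow> (\<forall>t\<in>{0..T}.
                  (\<forall>x\<in>{a<..<b}. \<bar>pc_interp \<tau> r t x\<bar> \<le> C \<and> \<bar>pc_interp \<tau> sg t x\<bar> \<le> C)
                \<and> pvar {a<..<b} (pc_interp \<tau> r t) \<le> ereal C
                \<and> pvar {a<..<b} (pc_interp \<tau> sg t) \<le> ereal C
                \<and> (\<forall>x\<in>{a<..<b}. \<bar>pc_interp \<tau> (\<lambda>n y. r n y * sg n y) t x\<bar> \<le> C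
                               \<and> \<bar>pc_interp \<tau> (\<lambda>n y. (1 - r n y) * sg n y) t x\<bar> \<le> C)
                \<and> pvar {a<..<b} (pc_interp \<tau> (\<lambda>n y. r n y * sg n y) t) \<le> ereal C
                \<and> pvar {a<..<b} (pc_interp \<tau> (\<lambda>n y. (1 - r n y) * sg n y) t) \<le> ereal C)"
proof -
  let ?Sg = "SigF F1 F2 G1 G2" and ?Rr = "RF F1 F2 G1 G2"
  note ab = assms(1) and rates = assms(4-7)
  obtain C where C: "0 \<le> C" "\<And>s r. 0 \<le> s \<Longrightarrow> r \<in> {0..1} \<Longrightarrow> ?Sg s r \<le> C * s"
    using SigF_growth[OF rates] by metis
  have "pvar {a..b} (\<lambda>x. rho0 x + eta0 x) < \<infinity>"
    using pvar_add_finite pvar_finite_closure[OF ab] assms(11,12) by blast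
  then obtain A0 where A0: "pvar {a..b} (\<lambda>x. rho0 x + eta0 x) = ereal A0" "0 \<le> A0"
    using pvar_eq_ereal by blast
  obtain B0 where B0: "pvar {a..b} r0 = ereal B0" "0 \<le> B0"
    using pvar_eq_ereal pvar_finite_closure[OF ab assms(14)] by blast
  define M0 where "M0 = rho0 a + eta0 a + A0"
  have M0: "rho0 x + eta0 x \<le> M0" if "x \<in> {a..b}" for x
    using abs_diff_le_pvar[of a "{a..b}" x "\<lambda>x. rho0 x + eta0 x" A0] A0 that ab by (auto simp: M0_def)
  have M0_nonneg: "0 \<le> M0" using assms(10) A0 ab by (simp add: M0_def)
  define M where "M = M0 * exp (C * T)"
  obtain K where K: "0 \<le> K" "\<And>\<tau> s0 q0 s1 q1 s0' q0' s1' q1'. 0 < \<tau> \<Longrightarrow> \<tau> < 1 \<Longrightarrow>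
       reaction_step ?Sg ?Rr \<tau> s0 q0 s1 q1 \<Longrightarrow> reaction_step ?Sg ?Rr \<tau> s0' q0' s1' q1' \<Longrightarrow>
       s0 * exp (C * \<tau>) \<le> M \<Longrightarrow> s0' * exp (C * \<tau>) \<le> M \<Longrightarrow>
       \<bar>s1 - s1'\<bar> \<le> \<bar>s0 - s0'\<bar> + K * \<tau> * (\<bar>s0 - s0'\<bar> + \<bar>q0 - q0'\<bar>) \<and>
       \<bar>q1 - q1'\<bar> \<le> \<bar>q0 - q0'\<bar> + K * \<tau> * (\<bar>s0 - s0'\<bar> + \<bar>q0 - q0'\<bar>)"
    using reaction_step_stability[OF bounded_lipschitz_SigF[OF rates] bounded_lipschitz_RF[OF rates] C]
    by blast
  define V where "V = (A0 + B0) * exp (2 * K * T)"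
  have M_nonneg: "0 \<le> M" and V_nonneg: "0 \<le> V" using M0_nonneg A0 B0 by (auto simp: M_def V_def)
  define CC where "CC = 1 + M + V + M * V"
  have MV: "0 \<le> M * V" using M_nonneg V_nonneg by simp
  show ?thesis
  proof (rule exI[of _ CC], intro allI impI ballI, elim conjE)
    fix \<tau> :: real and N :: nat and sg r sigh rh rhoD etaD Tm :: "nat \<Rightarrow> real \<Rightarrow> real" and t :: real
    assume \<tau>: "0 < \<tau>" "\<tau> < 1" and NT: "real N * \<tau> = T" and t: "t \<in> {0..T}"
      and run: "splitting_run a b chi F1 F2 G1 G2 rho0 eta0 r0 \<tau> N sg r sigh rh rhoD etaD Tm"
    have init: "\<And>x. x \<in> {a..b} \<Longrightarrow> sg 0 x = rho0 x + eta0 x \<and> r 0 x = r0 x"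
      using run unfolding splitting_run_def by blast
    have react: "\<And>n x. n < N \<Longrightarrow> x \<in> {a..b} \<Longrightarrow> reaction_step ?Sg ?Rr \<tau> (sg n x) (r n x) (sigh n x) (rh n x)"
      using run unfolding splitting_run_def by blast
    have adm: "admissible a b chi (LINT x:{a<..<b}|lborel. rh n x * sigh n x)
          (LINT x:{a<..<b}|lborel. (1 - rh n x) * sigh n x) (rhoD n) (etaD n)" if "n < N" for n
      using run that unfolding splitting_run_def Let_def by blast
    have minimal: "jko a b chi \<tau> (\<lambda>x. rh n x * sigh n x) (\<lambda>x. (1 - rh n x) * sigh n x) (rhoD n) (etaD n)
        \<le> jko a b chi \<tau> (\<lambda>x. rh n x * sigh n x) (\<lambda>x. (1 - rh n x) * sigh n x) \<rho> \<eta>"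
      if "n < N" "admissible a b chi (LINT x:{a<..<b}|lborel. rh n x * sigh n x)
          (LINT x:{a<..<b}|lborel. (1 - rh n x) * sigh n x) \<rho> \<eta>" for n \<rho> \<eta>
      using run that unfolding splitting_run_def Let_def by blast
    have rep: "AE x in lborel. x \<in> {a<..<b} \<longrightarrow> sg (Suc n) x = rhoD n x + etaD n x"
      "good_rep a b (sg (Suc n))" if "n < N" for n
      using run that unfolding splitting_run_def by blast+
    have map: "Tm n \<in> borel_measurable borel" "mono_on {a..b} (Tm n)" "Tm n ` {a..b} \<subseteq> {a..b}"
      "distr (dmeas a b (sg (Suc n))) lborel (Tm n) = dmeas a b (sigh n)"
      "(\<integral>\<^sup>+ x. ennreal ((x - Tm n x)\<^sup>2) \<partial>(dmeas a b (sg (Suc n)))) = W2sq (dmeas a b (sg (Suc n))) (dmeas a b (sigh n))"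
      "\<And>x. x \<in> {a..b} \<Longrightarrow> r (Suc n) x = rh n (Tm n x)" if "n < N" for n
      using run that unfolding splitting_run_def by blast+
    have le_T: "real n * \<tau> \<le> T" if "n \<le> N" for n
      using that \<tau> NT by (metis mult_right_mono of_nat_le_iff less_imp_le)
    have main: "(\<forall>x\<in>{a..b}. 0 \<le> sg n x \<and> sg n x \<le> M0 * exp (C * (real n * \<tau>)) \<and> 0 \<le> r n x \<and> r n x \<le> 1) \<and>
       (\<exists>A B. 0 \<le> A \<and> 0 \<le> B \<and> A + B \<le> (A0 + B0) * exp (2 * K * (real n * \<tau>)) \<and>
          pvar {a..b} (sg n) \<le> ereal A \<and> pvar {a..b} (r n) \<le> ereal B)" if "n \<le> N" for n
      using that
    proof (induction n)
      case 0
      have "pvar {a..b} (sg 0) = ereal A0" "pvar {a..b} (r 0) = ereal B0"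
        unfolding A0(1)[symmetric] B0(1)[symmetric] using init by (auto intro!: pvar_cong)
      then show ?case using init M0 assms(10,15) A0(2) B0(2)
        by (intro conjI ballI exI[of _ A0] exI[of _ B0]) auto
    next
      case (Suc n)
      then have n: "n < N" by simp
      obtain A B where IH: "\<And>x. x \<in> {a..b} \<Longrightarrow> 0 \<le> sg n x \<and> sg n x \<le> M0 * exp (C * (real n * \<tau>)) \<and> 0 \<le> r n x \<and> r n x \<le> 1"
        and AB: "0 \<le> A" "0 \<le> B" "A + B \<le> (A0 + B0) * exp (2 * K * (real n * \<tau>))"
          "pvar {a..b} (sg n) \<le> ereal A" "pvar {a..b} (r n) \<le> ereal B"
        using Suc.IH n by auto
      define M' where "M' = M0 * exp (C * (real (Suc n) * \<tau>))"
      have M'_eq: "M0 * exp (C * (real n * \<tau>)) * exp (C * \<tau>) = M'"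
        by (simp add: M'_def algebra_simps flip: exp_add)
      have M'_le: "M' \<le> M"
        unfolding M'_def M_def using le_T[OF Suc.prems] C(1) M0_nonneg
        by (intro mult_left_mono) (auto intro: mult_left_mono)
      have s_le: "sg n x * exp (C * \<tau>) \<le> M'" if "x \<in> {a..b}" for x
        unfolding M'_eq[symmetric] using IH[OF that] by (intro mult_right_mono) auto
      have half: "0 \<le> sigh n x \<and> sigh n x \<le> M'" "0 \<le> rh n x \<and> rh n x \<le> 1" if x: "x \<in> {a..b}" for x
        using reaction_step_bounds[OF react[OF n x] less_imp_le[OF \<tau>(1)] C(2)] s_le[OF x] by auto
      have stab: "\<bar>sigh n x - sigh n y\<bar> \<le> \<bar>sg n x - sg n y\<bar> + K * \<tau> * (\<bar>sg n x - sg n y\<bar> + \<bar>r n x - r n y\<bar>)"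
        "\<bar>rh n x - rh n y\<bar> \<le> \<bar>r n x - r n y\<bar> + K * \<tau> * (\<bar>sg n x - sg n y\<bar> + \<bar>r n x - r n y\<bar>)"
        if "x \<in> {a..b}" "y \<in> {a..b}" for x y
        using K(2)[OF \<tau> react[OF n that(1)] react[OF n that(2)]] s_le[OF that(1)] s_le[OF that(2)] M'_le by auto
      define A' where "A' = (1 + K * \<tau>) * A + K * \<tau> * B"
      define B' where "B' = K * \<tau> * A + (1 + K * \<tau>) * B"
      have K\<tau>: "0 \<le> K * \<tau>" using K(1) \<tau>(1) by simp
      have A': "pvar {a..b} (sigh n) \<le> ereal A'"
        unfolding A'_def using stab(1) K\<tau> AB by (intro pvar_combination) (auto simp: algebra_simps)
      have B': "pvar {a..b} (rh n) \<le> ereal B'"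
        unfolding B'_def using stab(2) K\<tau> AB by (intro pvar_combination) (auto simp: algebra_simps)
      have fin: "pvar {a..b} (sigh n) < \<infinity>" "pvar {a..b} (rh n) < \<infinity>"
        using A' B' by (auto elim!: le_less_trans)
      have D: "(\<forall>x\<in>{a..b}. 0 \<le> sg (Suc n) x \<and> sg (Suc n) x \<le> M') \<and> pvar {a..b} (sg (Suc n)) \<le> pvar {a..b} (sigh n)"
        by (rule diffusion_step_bounds[OF ab \<tau>(1) assms(3) half(1) fin(1) half(2) fin(2) adm[OF n] minimal[OF n]
              rep[OF n] map(1-5)[OF n]])
      have "r (Suc n) x \<in> {0..1}" if "x \<in> {a..b}" for x
      proof -
        have "Tm n x \<in> {a..b}" using map(3)[OF n] that by blast
        then show ?thesis using map(6)[OF n that] half(2)[of "Tm n x"] by auto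
      qed
      moreover have "pvar {a..b} (r (Suc n)) \<le> ereal B'"
      proof -
        have "pvar {a..b} (r (Suc n)) = pvar {a..b} (\<lambda>x. rh n (Tm n x))"
          by (rule pvar_cong) (rule map(6)[OF n])
        also have "\<dots> \<le> pvar {a..b} (rh n)" by (rule pvar_compose_mono[OF map(2,3)[OF n]])
        finally show ?thesis using B' by (rule order_trans)
      qed
      moreover have "pvar {a..b} (sg (Suc n)) \<le> ereal A'" using D A' by (meson order_trans)
      moreover have "A' + B' \<le> (A0 + B0) * exp (2 * K * (real (Suc n) * \<tau>))"
      proof -
        have "A' + B' = (A + B) * (1 + 2 * (K * \<tau>))" by (simp add: A'_def B'_def algebra_simps)
        also have "\<dots> \<le> ((A0 + B0) * exp (2 * K * (real n * \<tau>))) * exp (2 * (K * \<tau>))"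
          using AB K\<tau> exp_ge_add_one_self[of "2 * (K * \<tau>)"] by (intro mult_mono) auto
        also have "\<dots> = (A0 + B0) * exp (2 * K * (real (Suc n) * \<tau>))"
          by (simp add: algebra_simps flip: exp_add)
        finally show ?thesis .
      qed
      moreover have "0 \<le> A'" "0 \<le> B'" using AB K\<tau> by (auto simp: A'_def B'_def)
      ultimately show ?case using D unfolding M'_def[symmetric]
        by (intro conjI ballI exI[of _ A'] exI[of _ B']) auto
    qed
    define n where "n = nat \<lfloor>t / \<tau>\<rfloor>"
    have "t / \<tau> \<le> real N" using t NT \<tau> by (simp add: field_simps)
    then have n: "n \<le> N" unfolding n_def by linarith
    obtain A B where bd: "\<And>x. x \<in> {a..b} \<Longrightarrow> 0 \<le> sg n x \<and> sg n x \<le> M0 * exp (C * (real n * \<tau>)) \<and> 0 \<le> r n x \<and> r n x \<le> 1"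
      and AB: "0 \<le> A" "0 \<le> B" "A + B \<le> (A0 + B0) * exp (2 * K * (real n * \<tau>))"
        "pvar {a..b} (sg n) \<le> ereal A" "pvar {a..b} (r n) \<le> ereal B"
      using main[OF n] by auto
    have "M0 * exp (C * (real n * \<tau>)) \<le> M"
      unfolding M_def using le_T[OF n] C(1) M0_nonneg by (intro mult_left_mono) (auto intro: mult_left_mono)
    then have bounds: "0 \<le> sg n x" "sg n x \<le> M" "0 \<le> r n x" "r n x \<le> 1" if "x \<in> {a<..<b}" for x
      using bd[of x] that by auto
    have "(A0 + B0) * exp (2 * K * (real n * \<tau>)) \<le> V"
      unfolding V_def using le_T[OF n] K(1) A0 B0 by (intro mult_left_mono) (auto intro: mult_left_mono)
    then have AV: "A \<le> V" "B \<le> V" using AB by auto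
    have sub: "pvar {a<..<b} f \<le> pvar {a..b} f" for f by (rule pvar_mono) auto
    have s_var: "pvar {a<..<b} (sg n) \<le> ereal V"
      using sub[of "sg n"] AB(4) AV(1) by (meson ereal_less_eq(3) order_trans)
    have r_var: "pvar {a<..<b} (r n) \<le> ereal V"
      using sub[of "r n"] AB(5) AV(2) by (meson ereal_less_eq(3) order_trans)
    have prod: "pvar {a<..<b} (\<lambda>y. c y * sg n y) \<le> ereal (1 * V + M * V)"
      if c: "\<And>x. x \<in> {a<..<b} \<Longrightarrow> \<bar>c x\<bar> \<le> 1"
        "\<And>x y. x \<in> {a<..<b} \<Longrightarrow> y \<in> {a<..<b} \<Longrightarrow> \<bar>c x - c y\<bar> = \<bar>r n x - r n y\<bar>" for c
    proof (rule pvar_combination[OF _ _ M_nonneg s_var r_var])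
      fix x y assume xy: "x \<in> {a<..<b}" "y \<in> {a<..<b}"
      show "\<bar>c x * sg n x - c y * sg n y\<bar> \<le> 1 * \<bar>sg n x - sg n y\<bar> + M * \<bar>r n x - r n y\<bar>"
        unfolding c(2)[OF xy, symmetric] using c(1)[OF xy(1)] bounds[OF xy(2)] by (intro abs_mult_diff_le) auto
    qed simp
    have pr: "pvar {a<..<b} (\<lambda>y. r n y * sg n y) \<le> ereal CC"
      "pvar {a<..<b} (\<lambda>y. (1 - r n y) * sg n y) \<le> ereal CC"
    proof -
      have CC: "ereal (1 * V + M * V) \<le> ereal CC" using M_nonneg by (simp add: CC_def)
      have "\<bar>r n x\<bar> \<le> 1" "\<bar>1 - r n x\<bar> \<le> 1" if "x \<in> {a<..<b}" for x using bounds[OF that] by auto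
      then show "pvar {a<..<b} (\<lambda>y. r n y * sg n y) \<le> ereal CC"
        "pvar {a<..<b} (\<lambda>y. (1 - r n y) * sg n y) \<le> ereal CC"
        by (auto intro!: order_trans[OF prod CC])
    qed
    have VC: "ereal V \<le> ereal CC" using M_nonneg MV by (simp add: CC_def)
    have pt: "\<bar>r n x\<bar> \<le> CC \<and> \<bar>sg n x\<bar> \<le> CC \<and> \<bar>r n x * sg n x\<bar> \<le> CC \<and> \<bar>(1 - r n x) * sg n x\<bar> \<le> CC"
      if x: "x \<in> {a<..<b}" for x
    proof -
      have "\<bar>c * sg n x\<bar> \<le> 1 * M" if "\<bar>c\<bar> \<le> 1" for c
        unfolding abs_mult using bounds[OF x] that by (intro mult_mono) auto
      from this[of "r n x"] this[of "1 - r n x"]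
      have "\<bar>r n x * sg n x\<bar> \<le> M" "\<bar>(1 - r n x) * sg n x\<bar> \<le> M" using bounds[OF x] by simp_all
      moreover have "1 \<le> CC" "M \<le> CC" using M_nonneg V_nonneg MV unfolding CC_def by linarith+
      ultimately show ?thesis using bounds[OF x] by auto
    qed
    show "(\<forall>x\<in>{a<..<b}. \<bar>pc_interp \<tau> r t x\<bar> \<le> CC \<and> \<bar>pc_interp \<tau> sg t x\<bar> \<le> CC)
                \<and> pvar {a<..<b} (pc_interp \<tau> r t) \<le> ereal CC
                \<and> pvar {a<..<b} (pc_interp \<tau> sg t) \<le> ereal CC
                \<and> (\<forall>x\<in>{a<..<b}. \<bar>pc_interp \<tau> (\<lambda>n y. r n y * sg n y) t x\<bar> \<le> CC
                               \<and> \<bar>pc_interp \<tau> (\<lambda>n y. (1 - r n y) * sg n y) t x\<bar> \<le> CC)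
                \<and> pvar {a<..<b} (pc_interp \<tau> (\<lambda>n y. r n y * sg n y) t) \<le> ereal CC
                \<and> pvar {a<..<b} (pc_interp \<tau> (\<lambda>n y. (1 - r n y) * sg n y) t) \<le> ereal CC"
      unfolding pc_interp_def n_def[symmetric]
      using pt pr order_trans[OF s_var VC] order_trans[OF r_var VC] by blast
  qed
qed

end
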